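(* Let $(M^n,g)$ be a compact $n$-dimensional Riemannian manifold admitting a non-trivial conformal vector field $V$, and let $\Phi$ be the skew-symmetric $(1,1)$-tensor associated to $V$. If $\Phi(V)=0$, then $\Phi = 0$ on $M$, and so $V$ is closed.
   Context: A smooth vector field $V$ on $(M,g)$ is conformal if there is a smooth function $\psi$ on $M$ (the conformal factor) with $\mathcal{L}_V g = 2\psi g$, where $\mathcal{L}_V$ is the Lie derivative. It is non-trivial if it is not a Killing field, equivalently if $\psi$ is not identically zero. Let $\eta = \langle V,\cdot\rangle$ be the dual $1$-form of $V$; $V$ is closed if $d\eta=0$. The skew-symmetric $(1,1)$-tensor $\Phi: TM\to TM$ associated to $V$ is defined by $\langle \Phi(X),Y\rangle = \tfrac12 d\eta(X,Y)$ for all vector fields $X,Y$, where $d\eta(X,Y)=X(\eta(Y))-Y(\eta(X))-\eta([X,Y])$; equivalently $\nabla_X V = \psi X + \Phi(X)$ for all $X$, with $\nabla$ the Levi-Civita connection.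
   Formalization: The manifold M is additionally assumed connected; otherwise the claim fails, e.g. for the disjoint union of a round 3-sphere with a conformal gradient field and a round 3-sphere with the unit Hopf Killing field. *)

theory Defs
  imports "HOL-Analysis.Analysis"
begin

section \<open>Smooth maps between Euclidean spaces\<close>

primrec C_k_on :: "nat \<Rightarrow> 'e set \<Rightarrow> ('e::euclidean_space \<Rightarrow> 'f::real_normed_vector) \<Rightarrow> bool" where
  "C_k_on 0 S f \<longleftrightarrow> continuous_on S f"
| "C_k_on (Suc k) S f \<longleftrightarrow>
     (\<forall>x\<in>S. f differentiable (at x)) \<and> (\<forall>v. C_k_on k S (\<lambda>x. frechet_derivative f (at x) v))"

text \<open>Meant for open \<open>S\<close>: the derivatives are taken in the ambient space.\<close>

definition smooth_on :: "'e set \<Rightarrow> ('e::euclidean_space \<Rightarrow> 'f::real_normed_vector) \<Rightarrow> bool" where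
  "smooth_on S f \<longleftrightarrow> (\<forall>k. C_k_on k S f)"


section \<open>Smooth manifolds without boundary\<close>

text \<open>The points of the manifold are the elements of a type \<open>'a\<close>, which is Hausdorff and second
  countable by its type classes; the dimension is \<open>DIM('e)\<close>. A chart is an open set together with
  a coordinate map, whose values outside that set are irrelevant. The atlas is not required to be
  maximal: every atlas determines a smooth structure, and all notions below depend only on that
  structure.\<close>

type_synonym ('a, 'e) chart = "'a set \<times> ('a \<Rightarrow> 'e)"

abbreviation chart_dom :: "('a, 'e) chart \<Rightarrow> 'a set" where "chart_dom \<equiv> fst"
abbreviation chart_map :: "('a, 'e) chart \<Rightarrow> 'a \<Rightarrow> 'e" where "chart_map \<equiv> snd"

definition chart_inv :: "('a, 'e) chart \<Rightarrow> 'e \<Rightarrow> 'a" where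
  "chart_inv c = inv_into (chart_dom c) (chart_map c)"

definition is_chart :: "('a::topological_space, 'e::euclidean_space) chart \<Rightarrow> bool" where
  "is_chart c \<longleftrightarrow> open (chart_dom c) \<and> open (chart_map c ` chart_dom c) \<and>
     homeomorphism (chart_dom c) (chart_map c ` chart_dom c) (chart_map c) (chart_inv c)"

definition transition :: "('a, 'e) chart \<Rightarrow> ('a, 'e) chart \<Rightarrow> 'e \<Rightarrow> 'e" where
  "transition c d = chart_map d \<circ> chart_inv c"

definition smooth_manifold ::
    "('a::{t2_space,second_countable_topology}, 'e::euclidean_space) chart set \<Rightarrow> bool" where
  "smooth_manifold A \<longleftrightarrow> (\<forall>c\<in>A. is_chart c) \<and> (\<Union>c\<in>A. chart_dom c) = UNIV \<and>
     (\<forall>c\<in>A. \<forall>d\<in>A. smooth_on (chart_map c ` (chart_dom c \<inter> chart_dom d)) (transition c d))"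

definition smooth_function_on ::
    "('a::topological_space, 'e::euclidean_space) chart set \<Rightarrow> 'a set \<Rightarrow> ('a \<Rightarrow> real) \<Rightarrow> bool" where
  "smooth_function_on A U f \<longleftrightarrow> open U \<and>
     (\<forall>c\<in>A. smooth_on (chart_map c ` (U \<inter> chart_dom c)) (f \<circ> chart_inv c))"


section \<open>Tangent vectors and vector fields\<close>

text \<open>A tangent vector at \<open>p\<close> is a family of coordinate vectors, one for each chart around \<open>p\<close>,
  which are related by the derivatives of the transition maps. Setting the irrelevant entries
  to \<open>0\<close> makes the representation unique, so that equality of tangent vectors is equality in
  HOL, and the vector space operations are the entrywise ones.\<close>

type_synonym ('a, 'e) tangent = "('a, 'e) chart \<Rightarrow> 'e"

definition tangent_space ::
    "('a, 'e::euclidean_space) chart set \<Rightarrow> 'a \<Rightarrow> ('a, 'e) tangent set" where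
  "tangent_space A p = {v.
     (\<forall>c. \<not> (c \<in> A \<and> p \<in> chart_dom c) \<longrightarrow> v c = 0) \<and>
     (\<forall>c\<in>A. \<forall>d\<in>A. p \<in> chart_dom c \<inter> chart_dom d \<longrightarrow>
        v d = frechet_derivative (transition c d) (at (chart_map c p)) (v c))}"

definition tangent_zero :: "('a, 'e::euclidean_space) tangent" where
  "tangent_zero = (\<lambda>c. 0)"

definition tangent_add ::
    "('a, 'e::euclidean_space) tangent \<Rightarrow> ('a, 'e) tangent \<Rightarrow> ('a, 'e) tangent" where
  "tangent_add v w = (\<lambda>c. v c + w c)"

definition tangent_scale ::
    "real \<Rightarrow> ('a, 'e::euclidean_space) tangent \<Rightarrow> ('a, 'e) tangent" where
  "tangent_scale a v = (\<lambda>c. a *\<^sub>R v c)"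

definition coord_rep ::
    "('a, 'e) chart \<Rightarrow> ('a \<Rightarrow> ('a, 'e) tangent) \<Rightarrow> 'e \<Rightarrow> 'e" where
  "coord_rep c X = (\<lambda>x. X (chart_inv c x) c)"

text \<open>Smooth vector fields on an open set \<open>U\<close>; the values outside \<open>U\<close> are irrelevant.\<close>

definition vector_field_on ::
    "('a::topological_space, 'e::euclidean_space) chart set \<Rightarrow> 'a set \<Rightarrow>
     ('a \<Rightarrow> ('a, 'e) tangent) \<Rightarrow> bool" where
  "vector_field_on A U X \<longleftrightarrow> open U \<and> (\<forall>p\<in>U. X p \<in> tangent_space A p) \<and>
     (\<forall>c\<in>A. smooth_on (chart_map c ` (U \<inter> chart_dom c)) (coord_rep c X))"

text \<open>The derivative of a function at \<open>p\<close> along a tangent vector at \<open>p\<close>; by the chain rule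
  the result does not depend on the chart that is picked.\<close>

definition chart_at :: "('a, 'e) chart set \<Rightarrow> 'a \<Rightarrow> ('a, 'e) chart" where
  "chart_at A p = (SOME c. c \<in> A \<and> p \<in> chart_dom c)"

definition deriv_along ::
    "('a, 'e::euclidean_space) chart set \<Rightarrow> 'a \<Rightarrow> ('a, 'e) tangent \<Rightarrow> ('a \<Rightarrow> real) \<Rightarrow> real" where
  "deriv_along A p v f =
     (let c = chart_at A p in frechet_derivative (f \<circ> chart_inv c) (at (chart_map c p)) (v c))"

text \<open>In coordinates, \<open>[X, Y]\<^sup>i = X(Y\<^sup>i) - Y(X\<^sup>i)\<close>.\<close>

definition lie_bracket ::
    "('a, 'e::euclidean_space) chart set \<Rightarrow> ('a \<Rightarrow> ('a, 'e) tangent) \<Rightarrow> ('a \<Rightarrow> ('a, 'e) tangent) \<Rightarrow>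
     'a \<Rightarrow> ('a, 'e) tangent" where
  "lie_bracket A X Y p = (\<lambda>c.
     if c \<in> A \<and> p \<in> chart_dom c
     then frechet_derivative (coord_rep c Y) (at (chart_map c p)) (X p c) -
          frechet_derivative (coord_rep c X) (at (chart_map c p)) (Y p c)
     else 0)"


section \<open>Riemannian metrics\<close>

type_synonym ('a, 'e) metric = "'a \<Rightarrow> ('a, 'e) tangent \<Rightarrow> ('a, 'e) tangent \<Rightarrow> real"

definition riemannian_metric ::
    "('a::topological_space, 'e::euclidean_space) chart set \<Rightarrow> ('a, 'e) metric \<Rightarrow> bool" where
  "riemannian_metric A g \<longleftrightarrow>
     (\<forall>p. \<forall>u\<in>tangent_space A p. \<forall>v\<in>tangent_space A p. \<forall>w\<in>tangent_space A p. \<forall>a.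
        g p (tangent_add u v) w = g p u w + g p v w \<and>
        g p (tangent_scale a u) w = a * g p u w \<and>
        g p u w = g p w u) \<and>
     (\<forall>p. \<forall>v\<in>tangent_space A p. v \<noteq> tangent_zero \<longrightarrow> g p v v > 0) \<and>
     (\<forall>U X Y. vector_field_on A U X \<longrightarrow> vector_field_on A U Y \<longrightarrow>
        smooth_function_on A U (\<lambda>p. g p (X p) (Y p)))"

definition riemannian_manifold ::
    "('a::{t2_space,second_countable_topology}, 'e::euclidean_space) chart set \<Rightarrow>
     ('a, 'e) metric \<Rightarrow> bool" where
  "riemannian_manifold A g \<longleftrightarrow> smooth_manifold A \<and> riemannian_metric A g"


section \<open>Conformal vector fields\<close>

text \<open>\<open>(L\<^sub>V g)(X, Y) = V(g(X, Y)) - g([V, X], Y) - g(X, [V, Y])\<close>.\<close>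

definition lie_derivative_metric ::
    "('a, 'e::euclidean_space) chart set \<Rightarrow> ('a, 'e) metric \<Rightarrow> ('a \<Rightarrow> ('a, 'e) tangent) \<Rightarrow>
     ('a \<Rightarrow> ('a, 'e) tangent) \<Rightarrow> ('a \<Rightarrow> ('a, 'e) tangent) \<Rightarrow> 'a \<Rightarrow> real" where
  "lie_derivative_metric A g V X Y p =
     deriv_along A p (V p) (\<lambda>q. g q (X q) (Y q))
     - g p (lie_bracket A V X p) (Y p) - g p (X p) (lie_bracket A V Y p)"

text \<open>An equation between tensor fields is an equation at every point. It is expressed by
  evaluating both sides on all smooth vector fields on open subsets of the manifold (including
  the whole manifold), so that every pair of tangent vectors at a point is reached.\<close>

definition conformal_with_factor ::
    "('a::topological_space, 'e::euclidean_space) chart set \<Rightarrow> ('a, 'e) metric \<Rightarrow>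
     ('a \<Rightarrow> ('a, 'e) tangent) \<Rightarrow> ('a \<Rightarrow> real) \<Rightarrow> bool" where
  "conformal_with_factor A g V \<psi> \<longleftrightarrow>
     vector_field_on A UNIV V \<and> smooth_function_on A UNIV \<psi> \<and>
     (\<forall>U X Y. vector_field_on A U X \<longrightarrow> vector_field_on A U Y \<longrightarrow>
        (\<forall>p\<in>U. lie_derivative_metric A g V X Y p = 2 * \<psi> p * g p (X p) (Y p)))"

definition conformal_vector_field ::
    "('a::topological_space, 'e::euclidean_space) chart set \<Rightarrow> ('a, 'e) metric \<Rightarrow>
     ('a \<Rightarrow> ('a, 'e) tangent) \<Rightarrow> bool" where
  "conformal_vector_field A g V \<longleftrightarrow> (\<exists>\<psi>. conformal_with_factor A g V \<psi>)"

definition killing_vector_field ::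
    "('a::topological_space, 'e::euclidean_space) chart set \<Rightarrow> ('a, 'e) metric \<Rightarrow>
     ('a \<Rightarrow> ('a, 'e) tangent) \<Rightarrow> bool" where
  "killing_vector_field A g V \<longleftrightarrow> vector_field_on A UNIV V \<and>
     (\<forall>U X Y. vector_field_on A U X \<longrightarrow> vector_field_on A U Y \<longrightarrow>
        (\<forall>p\<in>U. lie_derivative_metric A g V X Y p = 0))"


section \<open>The dual form and the associated skew-symmetric tensor\<close>

definition dual_form ::
    "('a, 'e) metric \<Rightarrow> ('a \<Rightarrow> ('a, 'e) tangent) \<Rightarrow> 'a \<Rightarrow> ('a, 'e) tangent \<Rightarrow> real" where
  "dual_form g V = (\<lambda>p v. g p (V p) v)"

text \<open>\<open>d\<eta>(X, Y) = X(\<eta>(Y)) - Y(\<eta>(X)) - \<eta>([X, Y])\<close>, without a factor \<open>1/2\<close>.\<close>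

definition exterior_derivative ::
    "('a, 'e::euclidean_space) chart set \<Rightarrow> ('a \<Rightarrow> ('a, 'e) tangent \<Rightarrow> real) \<Rightarrow>
     ('a \<Rightarrow> ('a, 'e) tangent) \<Rightarrow> ('a \<Rightarrow> ('a, 'e) tangent) \<Rightarrow> 'a \<Rightarrow> real" where
  "exterior_derivative A \<eta> X Y p =
     deriv_along A p (X p) (\<lambda>q. \<eta> q (Y q)) - deriv_along A p (Y p) (\<lambda>q. \<eta> q (X q))
     - \<eta> p (lie_bracket A X Y p)"

definition closed_vector_field ::
    "('a::topological_space, 'e::euclidean_space) chart set \<Rightarrow> ('a, 'e) metric \<Rightarrow>
     ('a \<Rightarrow> ('a, 'e) tangent) \<Rightarrow> bool" where
  "closed_vector_field A g V \<longleftrightarrow>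
     (\<forall>U X Y. vector_field_on A U X \<longrightarrow> vector_field_on A U Y \<longrightarrow>
        (\<forall>p\<in>U. exterior_derivative A (dual_form g V) X Y p = 0))"

definition tensor_field_1_1 ::
    "('a::topological_space, 'e::euclidean_space) chart set \<Rightarrow>
     ('a \<Rightarrow> ('a, 'e) tangent \<Rightarrow> ('a, 'e) tangent) \<Rightarrow> bool" where
  "tensor_field_1_1 A \<Phi> \<longleftrightarrow>
     (\<forall>p. \<forall>v\<in>tangent_space A p. \<Phi> p v \<in> tangent_space A p) \<and>
     (\<forall>p. \<forall>v\<in>tangent_space A p. \<forall>w\<in>tangent_space A p. \<forall>a.
        \<Phi> p (tangent_add v w) = tangent_add (\<Phi> p v) (\<Phi> p w) \<and>
        \<Phi> p (tangent_scale a v) = tangent_scale a (\<Phi> p v)) \<and>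
     (\<forall>U X. vector_field_on A U X \<longrightarrow> vector_field_on A U (\<lambda>p. \<Phi> p (X p)))"

text \<open>Since the metric is nondegenerate, these conditions determine \<open>\<Phi> p v\<close> for all tangent
  vectors \<open>v\<close> at \<open>p\<close>, and they make \<open>\<Phi>\<close> skew-symmetric.\<close>

definition associated_tensor ::
    "('a::topological_space, 'e::euclidean_space) chart set \<Rightarrow> ('a, 'e) metric \<Rightarrow>
     ('a \<Rightarrow> ('a, 'e) tangent) \<Rightarrow> ('a \<Rightarrow> ('a, 'e) tangent \<Rightarrow> ('a, 'e) tangent) \<Rightarrow> bool" where
  "associated_tensor A g V \<Phi> \<longleftrightarrow> tensor_field_1_1 A \<Phi> \<and>
     (\<forall>U X Y. vector_field_on A U X \<longrightarrow> vector_field_on A U Y \<longrightarrow>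
        (\<forall>p\<in>U. g p (\<Phi> p (X p)) (Y p) = 1 / 2 * exterior_derivative A (dual_form g V) X Y p))"

end

theory Submission
  imports Defs
begin

text \<open>
  Write \<open>\<eta> = \<langle>V, \<cdot>\<rangle>\<close> and \<open>f = |V|\<^sup>2\<close>. Evaluating the conformal equation on the pair \<open>(V, Y)\<close>
  gives \<open>L\<^sub>V \<eta> = 2 \<psi> \<eta>\<close>, and \<open>\<Phi>(V) = 0\<close> says \<open>i\<^sub>V d\<eta> = 0\<close>, so Cartan's formula turns this into
  \<open>df = 2 \<psi> \<eta>\<close>. On the open set \<open>N = {f > 0}\<close> the form \<open>\<beta> = \<eta> / f\<close> therefore satisfies
  \<open>\<beta>(V) = 1\<close>, \<open>L\<^sub>V \<beta> = 0\<close> and \<open>df = (V f) \<beta>\<close>. The flow \<open>\<phi>\<^sub>t\<close> of \<open>V\<close> is complete because \<open>M\<close> is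
  compact.

  The key point is that a curve \<open>\<gamma>\<close> in \<open>N\<close> can be traded for waiting time: since \<open>\<phi>\<^sub>t\<close> preserves
  \<open>\<beta>\<close>, the function \<open>w(s, t) = f(\<phi>\<^sub>t(\<gamma>(s)))\<close> satisfies the transport equation
  \<open>w\<^sub>s = \<beta>(\<gamma>'(s)) w\<^sub>t\<close>, and its characteristics give \<open>f(\<phi>\<^sub>t(\<gamma>(1))) = f(\<phi>\<^sub>t\<^sub>+\<^sub>a(\<gamma>(0)))\<close> with \<open>a\<close>
  the integral of \<open>\<beta>\<close> along \<open>\<gamma>\<close> (\<open>f_along_segment\<close>).

  Suppose \<open>\<Phi> \<noteq> 0\<close> somewhere. As \<open>\<eta> = 0\<close> wherever \<open>V = 0\<close>, there is then a point \<open>q\<close> with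
  \<open>f(q) > 0\<close> and \<open>d\<eta> \<noteq> 0\<close>, hence \<open>d\<beta> \<noteq> 0\<close> (\<open>curvature_at_regular_point\<close>). Going around a small
  triangle at \<open>q\<close> shows that the integral of \<open>\<beta>\<close> over its boundary, which by Stokes is non-zero
  and of second order in the size of the triangle, is a period of \<open>t \<mapsto> f(\<phi>\<^sub>t(q))\<close>. A
  differentiable function with arbitrarily small periods is constant, so \<open>f\<close> is constant on the
  orbit of \<open>q\<close> (\<open>f_constant_on_orbit\<close>). The set of points on whose orbit \<open>f\<close> has this constant
  value is closed, and it is open by the trade of curves for time; so \<open>f\<close> is constant on the
  connected manifold \<open>M\<close> (\<open>f_globally_constant\<close>). Then \<open>0 = df(V) = 2 \<psi> f\<close> with \<open>f > 0\<close>, so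
  \<open>\<psi> = 0\<close> and \<open>V\<close> is Killing.

  The conclusion cannot be reached locally. For the standard field on a product of a circle with
  another manifold, a function \<open>f\<close> that varies only over a short arc of the circle forces
  \<open>d\<beta> = 0\<close> over that arc but puts no local restriction on \<open>d\<beta>\<close> over the rest; it is the flow,
  carrying \<open>d\<beta>\<close> around the circle, that does.

  The derivative of \<open>w\<close> in \<open>s\<close> is obtained from estimates alone: by the Gronwall inequality a
  curve is carried along by the flow with a controlled first order, and its \<open>\<beta>\<close>-component is
  conserved to that order (\<open>moves_at_flow\<close>).
\<close>

section \<open>Calculus of smooth maps\<close>

lemma C_k_on_cong:
  assumes "open S" "C_k_on k S f" "\<And>x. x \<in> S \<Longrightarrow> f x = g x"
  shows "C_k_on k S g"
  using assms(2,3)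
proof (induction k arbitrary: f g)
  case 0
  then show ?case by (metis C_k_on.simps(1) continuous_on_cong)
next
  case (Suc k)
  have diff: "f differentiable at x" if "x \<in> S" for x
    using Suc.prems(1) that by simp
  have eq: "frechet_derivative f (at x) = frechet_derivative g (at x)" if "x \<in> S" for x
    using frechet_derivative_transform_within_open[OF diff[OF that] assms(1) that] Suc.prems(2) by simp
  have "g differentiable at x" if "x \<in> S" for x
    using diff[OF that] that assms(1) Suc.prems(2)
    by (metis differentiable_def has_derivative_transform_within_open)
  moreover have "C_k_on k S (\<lambda>x. frechet_derivative g (at x) v)" for v
    using Suc.IH[of "\<lambda>x. frechet_derivative f (at x) v"] Suc.prems(1) eq by simp
  ultimately show ?case by simp
qed

lemma C_k_on_subset:
  assumes "C_k_on k S f" "T \<subseteq> S"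
  shows "C_k_on k T f"
  using assms
proof (induction k arbitrary: f)
  case 0 then show ?case by (auto intro: continuous_on_subset)
next
  case (Suc k) then show ?case by (auto simp: subset_iff)
qed

lemma C_k_on_continuous: "C_k_on k S f \<Longrightarrow> continuous_on S f"
  by (cases k) (simp_all add: continuous_at_imp_continuous_on differentiable_imp_continuous_within)

lemma C_k_on_SucD: "C_k_on (Suc k) S f \<Longrightarrow> C_k_on k S f"
proof (induction k arbitrary: f)
  case 0 then show ?case using C_k_on_continuous[of "Suc 0"] by simp
next
  case (Suc k)
  then show ?case by (metis C_k_on.simps(2))
qed

lemma C_k_on_const: "C_k_on k S (\<lambda>x. c)"
  by (induction k arbitrary: c) auto

lemma C_k_on_linear:
  assumes "open S" "C_k_on k S f" "bounded_linear h"
  shows "C_k_on k S (\<lambda>x. h (f x))"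
  using assms(2)
proof (induction k arbitrary: f)
  case 0 then show ?case
    using assms(3) by (auto intro: bounded_linear.continuous_on)
next
  case (Suc k)
  have d: "(f has_derivative frechet_derivative f (at x)) (at x)" if "x \<in> S" for x
    using Suc.prems(1) that by (simp flip: frechet_derivative_works)
  have d': "((\<lambda>x. h (f x)) has_derivative (\<lambda>v. h (frechet_derivative f (at x) v))) (at x)"
    if "x \<in> S" for x
    using bounded_linear.has_derivative[OF assms(3) d[OF that]] .
  have e: "frechet_derivative (\<lambda>x. h (f x)) (at x) = (\<lambda>v. h (frechet_derivative f (at x) v))"
    if "x \<in> S" for x
    using frechet_derivative_at[OF d'[OF that]] by simp
  have "C_k_on k S (\<lambda>x. frechet_derivative (\<lambda>x. h (f x)) (at x) v)" for v
    by (rule C_k_on_cong[OF assms(1), of _ "\<lambda>x. h (frechet_derivative f (at x) v)"])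
       (use Suc in \<open>auto simp: e\<close>)
  then show ?case using d' by (auto simp: differentiable_def)
qed

lemma C_k_on_add:
  assumes "open S" "C_k_on k S f" "C_k_on k S g"
  shows "C_k_on k S (\<lambda>x. f x + g x)"
  using assms(2,3)
proof (induction k arbitrary: f g)
  case 0 then show ?case by (auto intro: continuous_on_add)
next
  case (Suc k)
  have d: "(f has_derivative frechet_derivative f (at x)) (at x)"
     "(g has_derivative frechet_derivative g (at x)) (at x)" if "x \<in> S" for x
    using Suc.prems that by (simp_all flip: frechet_derivative_works)
  have d': "((\<lambda>x. f x + g x) has_derivative
      (\<lambda>v. frechet_derivative f (at x) v + frechet_derivative g (at x) v)) (at x)"
    if "x \<in> S" for x
    using has_derivative_add[OF d(1)[OF that] d(2)[OF that]] .
  have e: "frechet_derivative (\<lambda>x. f x + g x) (at x) =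
      (\<lambda>v. frechet_derivative f (at x) v + frechet_derivative g (at x) v)" if "x \<in> S" for x
    using frechet_derivative_at[OF d'[OF that]] by simp
  have "C_k_on k S (\<lambda>x. frechet_derivative (\<lambda>x. f x + g x) (at x) v)" for v
    by (rule C_k_on_cong[OF assms(1), of _
        "\<lambda>x. frechet_derivative f (at x) v + frechet_derivative g (at x) v"])
       (use Suc in \<open>auto simp: e\<close>)
  then show ?case using d' by (auto simp: differentiable_def)
qed

lemma C_k_on_sum:
  assumes "open S" "finite I" "\<And>i. i \<in> I \<Longrightarrow> C_k_on k S (f i)"
  shows "C_k_on k S (\<lambda>x. \<Sum>i\<in>I. f i x)"
  using assms(2,3)
  by (induction I rule: finite_induct) (simp_all add: C_k_on_const C_k_on_add[OF assms(1)])

lemma C_k_on_scaleR: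
  fixes a :: "'e::euclidean_space \<Rightarrow> real"
  assumes "open S" "C_k_on k S a" "C_k_on k S f"
  shows "C_k_on k S (\<lambda>x. a x *\<^sub>R f x)"
  using assms(2,3)
proof (induction k arbitrary: a f)
  case 0 then show ?case by (auto intro: continuous_on_scaleR)
next
  case (Suc k)
  have d: "(a has_derivative frechet_derivative a (at x)) (at x)"
     "(f has_derivative frechet_derivative f (at x)) (at x)" if "x \<in> S" for x
    using Suc.prems that by (simp_all flip: frechet_derivative_works)
  have d': "((\<lambda>x. a x *\<^sub>R f x) has_derivative
      (\<lambda>v. a x *\<^sub>R frechet_derivative f (at x) v + frechet_derivative a (at x) v *\<^sub>R f x)) (at x)"
    if "x \<in> S" for x
    using has_derivative_scaleR[OF d(1)[OF that] d(2)[OF that]] .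
  have e: "frechet_derivative (\<lambda>x. a x *\<^sub>R f x) (at x) =
      (\<lambda>v. a x *\<^sub>R frechet_derivative f (at x) v + frechet_derivative a (at x) v *\<^sub>R f x)" if "x \<in> S" for x
    using frechet_derivative_at[OF d'[OF that]] by simp
  have "C_k_on k S (\<lambda>x. frechet_derivative (\<lambda>x. a x *\<^sub>R f x) (at x) v)" for v
  proof (rule C_k_on_cong[OF assms(1), of _
        "\<lambda>x. a x *\<^sub>R frechet_derivative f (at x) v + frechet_derivative a (at x) v *\<^sub>R f x"])
    show "C_k_on k S (\<lambda>x. a x *\<^sub>R frechet_derivative f (at x) v + frechet_derivative a (at x) v *\<^sub>R f x)"
      using Suc C_k_on_SucD[OF Suc.prems(1)] C_k_on_SucD[OF Suc.prems(2)]
      by (intro C_k_on_add[OF assms(1)] Suc.IH) simp_all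
  qed (simp add: e)
  then show ?case using d' by (auto simp: differentiable_def)
qed

text \<open>The induction on \<open>k\<close> works because the chain rule, expanded in a basis, exhibits each
  directional derivative of the composition as a sum of products of derivatives of \<open>h\<close> with
  derivatives of \<open>f\<close> that are composed with \<open>h\<close>.\<close>

lemma C_k_on_compose:
  fixes h :: "'e::euclidean_space \<Rightarrow> 'm::euclidean_space"
  assumes "open S" "open T" "h ` S \<subseteq> T" "C_k_on k S h" "C_k_on k T f"
  shows "C_k_on k S (\<lambda>x. f (h x))"
  using assms(4,5)
proof (induction k arbitrary: f)
  case 0 then show ?case
    using continuous_on_compose2[OF _ _ assms(3), of f] by simp
next
  case (Suc k)
  have d: "(h has_derivative frechet_derivative h (at x)) (at x)" if "x \<in> S" for x
    using Suc.prems(1) that by (simp flip: frechet_derivative_works)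
  have df: "(f has_derivative frechet_derivative f (at (h x))) (at (h x))" if "x \<in> S" for x
    using Suc.prems(2) subsetD[OF assms(3) imageI[OF that]] by (simp flip: frechet_derivative_works)
  have d': "((\<lambda>x. f (h x)) has_derivative
      (\<lambda>v. frechet_derivative f (at (h x)) (frechet_derivative h (at x) v))) (at x)"
    if "x \<in> S" for x
    using has_derivative_compose[OF d[OF that] df[OF that]] by simp
  have e: "frechet_derivative (\<lambda>x. f (h x)) (at x) v = 
     (\<Sum>b\<in>Basis. (frechet_derivative h (at x) v \<bullet> b) *\<^sub>R frechet_derivative f (at (h x)) b)"
    if "x \<in> S" for x v
  proof -
    have lin: "linear (frechet_derivative f (at (h x)))"
      using df[OF that] has_derivative_linear by blast
    have "frechet_derivative f (at (h x)) (frechet_derivative h (at x) v) =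
      frechet_derivative f (at (h x)) (\<Sum>b\<in>Basis. (frechet_derivative h (at x) v \<bullet> b) *\<^sub>R b)"
      by (simp add: euclidean_representation)
    also have "\<dots> = (\<Sum>b\<in>Basis. (frechet_derivative h (at x) v \<bullet> b) *\<^sub>R frechet_derivative f (at (h x)) b)"
      by (simp add: linear_sum[OF lin] linear_cmul[OF lin])
    finally show ?thesis
      using frechet_derivative_at[OF d'[OF that]] by metis
  qed
  have "C_k_on k S (\<lambda>x. frechet_derivative (\<lambda>x. f (h x)) (at x) v)" for v
  proof (rule C_k_on_cong[OF assms(1), of _
     "\<lambda>x. \<Sum>b\<in>Basis. (frechet_derivative h (at x) v \<bullet> b) *\<^sub>R frechet_derivative f (at (h x)) b"])
    show "C_k_on k S (\<lambda>x. \<Sum>b\<in>Basis. (frechet_derivative h (at x) v \<bullet> b) *\<^sub>R frechet_derivative f (at (h x)) b)"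
      using Suc.prems C_k_on_SucD[OF Suc.prems(1)]
      by (intro C_k_on_sum C_k_on_scaleR C_k_on_linear[where h="\<lambda>y. y \<bullet> b" for b]
          bounded_linear_inner_left Suc.IH assms(1) finite_Basis) simp_all
  qed (simp add: e)
  then show ?case using d' by (auto simp: differentiable_def)
qed

lemma smooth_on_compose:
  fixes h :: "'e::euclidean_space \<Rightarrow> 'm::euclidean_space"
  assumes "open S" "open T" "h ` S \<subseteq> T" "smooth_on S h" "smooth_on T f"
  shows "smooth_on S (\<lambda>x. f (h x))"
  using assms C_k_on_compose unfolding smooth_on_def by blast

lemma smooth_on_subset: "smooth_on S f \<Longrightarrow> T \<subseteq> S \<Longrightarrow> smooth_on T f"
  using C_k_on_subset unfolding smooth_on_def by blast

lemma smooth_on_cong: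
  "open S \<Longrightarrow> smooth_on S f \<Longrightarrow> (\<And>x. x \<in> S \<Longrightarrow> f x = g x) \<Longrightarrow> smooth_on S g"
  using C_k_on_cong unfolding smooth_on_def by metis

lemma smooth_on_derivative: "smooth_on S f \<Longrightarrow> smooth_on S (\<lambda>x. frechet_derivative f (at x) v)"
  unfolding smooth_on_def by (metis C_k_on.simps(2))

lemma smooth_on_has_derivative:
  "smooth_on S f \<Longrightarrow> x \<in> S \<Longrightarrow> (f has_derivative frechet_derivative f (at x)) (at x)"
  unfolding smooth_on_def using C_k_on.simps(2)[of 0] frechet_derivative_works by blast

lemma smooth_on_continuous: "smooth_on S f \<Longrightarrow> continuous_on S f"
  unfolding smooth_on_def using C_k_on.simps(1) by blast

section \<open>Symmetry of second derivatives\<close>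

text \<open>Two applications of the mean value theorem, first along \<open>v\<close> and then along \<open>u\<close>. The left-hand
  side is symmetric in \<open>u\<close> and \<open>v\<close>, which is what makes mixed derivatives commute.\<close>

lemma second_difference_mvt:
  fixes f :: "'e::euclidean_space \<Rightarrow> real"
  assumes "smooth_on S f" "h > 0"
    and in_S: "\<And>s t. \<lbrakk>0 \<le> s; s \<le> h; 0 \<le> t; t \<le> h\<rbrakk> \<Longrightarrow> x + s *\<^sub>R u + t *\<^sub>R v \<in> S"
  obtains s t where "0 < s" "s < h" "0 < t" "t < h"
    "f (x + h *\<^sub>R u + h *\<^sub>R v) - f (x + h *\<^sub>R u) - f (x + h *\<^sub>R v) + f x =
      h\<^sup>2 * frechet_derivative (\<lambda>y. frechet_derivative f (at y) v) (at (x + s *\<^sub>R u + t *\<^sub>R v)) u"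
proof -
  let ?g = "\<lambda>y. frechet_derivative f (at y) v"
  have df: "((\<lambda>t. f (x + s *\<^sub>R u + t *\<^sub>R v)) has_real_derivative ?g (x + s *\<^sub>R u + t *\<^sub>R v)) (at t)"
    if "0 \<le> s" "s \<le> h" "0 \<le> t" "t \<le> h" for s t
  proof -
    note D = smooth_on_has_derivative[OF assms(1) in_S[OF that]]
    have "((\<lambda>t. f (x + s *\<^sub>R u + t *\<^sub>R v)) has_derivative
        (\<lambda>k. frechet_derivative f (at (x + s *\<^sub>R u + t *\<^sub>R v)) (k *\<^sub>R v))) (at t)"
      by (rule has_derivative_compose[where f="\<lambda>k. x + s *\<^sub>R u + k *\<^sub>R v" and g=f, OF _ D])
        (auto intro!: derivative_eq_intros)
    then show ?thesis
      using linear_cmul[OF has_derivative_linear[OF D]]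
      by (simp add: has_field_derivative_def mult_commute_abs)
  qed
  have dg: "((\<lambda>s. ?g (x + s *\<^sub>R u + t *\<^sub>R v)) has_real_derivative
      frechet_derivative ?g (at (x + s *\<^sub>R u + t *\<^sub>R v)) u) (at s)"
    if "0 \<le> s" "s \<le> h" "0 \<le> t" "t \<le> h" for s t
  proof -
    note D = smooth_on_has_derivative[OF smooth_on_derivative[OF assms(1)] in_S[OF that], of v]
    have "((\<lambda>s. ?g (x + s *\<^sub>R u + t *\<^sub>R v)) has_derivative
        (\<lambda>k. frechet_derivative ?g (at (x + s *\<^sub>R u + t *\<^sub>R v)) (k *\<^sub>R u))) (at s)"
      by (rule has_derivative_compose[where f="\<lambda>k. x + k *\<^sub>R u + t *\<^sub>R v" and g="?g", OF _ D])
        (auto intro!: derivative_eq_intros)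
    then show ?thesis
      using linear_cmul[OF has_derivative_linear[OF D]]
      by (simp add: has_field_derivative_def mult_commute_abs)
  qed
  have "((\<lambda>t. f (x + h *\<^sub>R u + t *\<^sub>R v) - f (x + t *\<^sub>R v)) has_real_derivative
     ?g (x + h *\<^sub>R u + t *\<^sub>R v) - ?g (x + t *\<^sub>R v)) (at t)" if "0 \<le> t" "t \<le> h" for t
    using DERIV_diff[OF df[of h t] df[of 0 t]] that assms(2) by simp
  from MVT2[OF assms(2) this] obtain t where t: "0 < t" "t < h"
    "f (x + h *\<^sub>R u + h *\<^sub>R v) - f (x + h *\<^sub>R v) - (f (x + h *\<^sub>R u) - f x)
       = h * (?g (x + h *\<^sub>R u + t *\<^sub>R v) - ?g (x + t *\<^sub>R v))" by auto
  from MVT2[OF assms(2) dg, of t] t obtain s where "0 < s" "s < h"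
    "?g (x + h *\<^sub>R u + t *\<^sub>R v) - ?g (x + t *\<^sub>R v) =
       h * frechet_derivative ?g (at (x + s *\<^sub>R u + t *\<^sub>R v)) u" by auto
  then show ?thesis using t by (intro that[of s t]) (auto simp: power2_eq_square)
qed

lemma second_derivative_symmetric_real:
  fixes f :: "'e::euclidean_space \<Rightarrow> real"
  assumes "open S" "smooth_on S f" "x \<in> S"
  shows "frechet_derivative (\<lambda>y. frechet_derivative f (at y) v) (at x) u =
         frechet_derivative (\<lambda>y. frechet_derivative f (at y) u) (at x) v" (is "?A u v x = ?B x")
proof -
  define A where "A = (\<lambda>u v x. frechet_derivative (\<lambda>y. frechet_derivative f (at y) v) (at x) u)"
  have cont: "isCont (A u v) x" for u v
    using smooth_on_continuous[OF smooth_on_derivative[OF smooth_on_derivative[OF assms(2)]]]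
      continuous_on_eq_continuous_at[OF assms(1)] assms(3)
    unfolding A_def by blast
  have "\<bar>A u v x - A v u x\<bar> \<le> e" if e: "e > 0" for e
  proof -
    obtain d1 where d1: "d1 > 0" "\<And>y. dist y x < d1 \<Longrightarrow> dist (A u v y) (A u v x) < e/2"
      using cont[of u v] half_gt_zero[OF e] unfolding continuous_at_eps_delta by blast
    obtain d2 where d2: "d2 > 0" "\<And>y. dist y x < d2 \<Longrightarrow> dist (A v u y) (A v u x) < e/2"
      using cont[of v u] half_gt_zero[OF e] unfolding continuous_at_eps_delta by blast
    obtain d3 where d3: "d3 > 0" "ball x d3 \<subseteq> S"
      using assms(1,3) open_contains_ball by blast
    define d where "d = Min {d1,d2,d3}"
    \<comment> \<open>the side of a parallelogram that stays within distance \<open>d\<close> of \<open>x\<close>; the 1 avoids a division by zero\<close>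
    define h where "h = d / (2 * (norm u + norm v + 1))"
    have dpos: "d > 0" "d \<le> d1" "d \<le> d2" "d \<le> d3" using d1 d2 d3 by (auto simp: d_def)
    have nn: "norm u + norm v + 1 > 0" by (simp add: add_nonneg_pos)
    have h: "h > 0" using dpos nn by (simp add: h_def)
    have hd: "h * (norm u + norm v + 1) = d/2" using nn by (simp add: h_def field_simps)
    have near: "dist (x + s *\<^sub>R u + t *\<^sub>R v) x < d" "dist (x + t *\<^sub>R v + s *\<^sub>R u) x < d"
      if "0 \<le> s" "s \<le> h" "0 \<le> t" "t \<le> h" for s t u' v'
    proof -
      have "norm (s *\<^sub>R u + t *\<^sub>R v) \<le> s * norm u + t * norm v"
        using norm_triangle_ineq[of "s *\<^sub>R u" "t *\<^sub>R v"] that by simp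
      also have "\<dots> \<le> h * norm u + h * norm v"
        using that by (intro add_mono mult_right_mono) auto
      also have "\<dots> \<le> d/2" using hd h by (simp add: algebra_simps)
      also have "\<dots> < d" using dpos by simp
      finally show "dist (x + s *\<^sub>R u + t *\<^sub>R v) x < d" "dist (x + t *\<^sub>R v + s *\<^sub>R u) x < d"
        by (simp_all add: dist_norm add.assoc add.commute)
    qed
    have inS: "x + s *\<^sub>R u + t *\<^sub>R v \<in> S" "x + t *\<^sub>R v + s *\<^sub>R u \<in> S"
      if "0 \<le> s" "s \<le> h" "0 \<le> t" "t \<le> h" for s t
      using near[OF that] d3 dpos(4) by (auto simp: subset_iff dist_commute)
    obtain s t where st: "0 < s" "s < h" "0 < t" "t < h"
      "f (x + h *\<^sub>R u + h *\<^sub>R v) - f (x + h *\<^sub>R u) - f (x + h *\<^sub>R v) + f x = h\<^sup>2 * A u v (x + s *\<^sub>R u + t *\<^sub>R v)"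
      using second_difference_mvt[OF assms(2) h, of x u v] inS(1) unfolding A_def by metis
    obtain s' t' where st': "0 < s'" "s' < h" "0 < t'" "t' < h"
      "f (x + h *\<^sub>R v + h *\<^sub>R u) - f (x + h *\<^sub>R v) - f (x + h *\<^sub>R u) + f x = h\<^sup>2 * A v u (x + s' *\<^sub>R v + t' *\<^sub>R u)"
      using second_difference_mvt[OF assms(2) h, of x v u] inS(2) unfolding A_def by metis
    have "h\<^sup>2 * A u v (x + s *\<^sub>R u + t *\<^sub>R v) = h\<^sup>2 * A v u (x + s' *\<^sub>R v + t' *\<^sub>R u)"
      using st(5) st'(5) by (simp add: algebra_simps)
    then have eq: "A u v (x + s *\<^sub>R u + t *\<^sub>R v) = A v u (x + s' *\<^sub>R v + t' *\<^sub>R u)"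
      using h by simp
    have "dist (A u v (x + s *\<^sub>R u + t *\<^sub>R v)) (A u v x) < e/2"
      using near(1)[of s t] st dpos by (intro d1) auto
    moreover have "dist (A v u (x + s' *\<^sub>R v + t' *\<^sub>R u)) (A v u x) < e/2"
      using near(2)[of t' s'] st' dpos by (intro d2) auto
    ultimately show ?thesis unfolding eq dist_real_def by arith
  qed
  then have "\<bar>A u v x - A v u x\<bar> \<le> 0" by (meson dense_ge)
  then show ?thesis by (simp add: A_def)
qed

lemma second_derivative_symmetric:
  fixes f :: "'e::euclidean_space \<Rightarrow> 'f::euclidean_space"
  assumes "open S" "smooth_on S f" "x \<in> S"
  shows "frechet_derivative (\<lambda>y. frechet_derivative f (at y) v) (at x) u =
         frechet_derivative (\<lambda>y. frechet_derivative f (at y) u) (at x) v"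
proof (rule euclidean_eqI)
  fix b :: 'f assume "b \<in> Basis"
  have inner_deriv: "frechet_derivative (\<lambda>y. k y \<bullet> b) (at y) w = frechet_derivative k (at y) w \<bullet> b"
    if "smooth_on S k" "y \<in> S" for k :: "'e \<Rightarrow> 'f" and y w
    using frechet_derivative_at[OF bounded_linear.has_derivative[OF bounded_linear_inner_left
         smooth_on_has_derivative[OF that]]] by metis
  have sm: "smooth_on S (\<lambda>y. f y \<bullet> b)"
    using assms(2) C_k_on_linear[OF assms(1) _ bounded_linear_inner_left] unfolding smooth_on_def by blast
  have "frechet_derivative (\<lambda>y. frechet_derivative f (at y) v) (at x) u \<bullet> b
    = frechet_derivative (\<lambda>y. frechet_derivative (\<lambda>y. f y \<bullet> b) (at y) v) (at x) u" for u v
  proof -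
    have "frechet_derivative (\<lambda>y. frechet_derivative f (at y) v) (at x) u \<bullet> b
      = frechet_derivative (\<lambda>y. frechet_derivative f (at y) v \<bullet> b) (at x) u"
      using inner_deriv[OF smooth_on_derivative[OF assms(2)] assms(3)] by simp
    also have "frechet_derivative (\<lambda>y. frechet_derivative f (at y) v \<bullet> b) (at x)
      = frechet_derivative (\<lambda>y. frechet_derivative (\<lambda>y. f y \<bullet> b) (at y) v) (at x)"
    proof (rule frechet_derivative_transform_within_open[OF _ assms(1,3)])
      show "(\<lambda>y. frechet_derivative f (at y) v \<bullet> b) differentiable at x"
        using bounded_linear.has_derivative[OF bounded_linear_inner_left
         smooth_on_has_derivative[OF smooth_on_derivative[OF assms(2)] assms(3)]]
        by (blast intro: differentiableI)
    qed (simp add: inner_deriv[OF assms(2)])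
    finally show ?thesis .
  qed
  then show "frechet_derivative (\<lambda>y. frechet_derivative f (at y) v) (at x) u \<bullet> b =
         frechet_derivative (\<lambda>y. frechet_derivative f (at y) u) (at x) v \<bullet> b"
    using second_derivative_symmetric_real[OF assms(1) sm assms(3)] by metis
qed

section \<open>Coordinate fields and the Lie bracket\<close>

text \<open>The product rule for \<open>z \<mapsto> DT\<^sub>z(Y(z))\<close>, with the second derivative of \<open>T\<close> written as the
  derivative of \<open>DT\<close> in a fixed direction.\<close>

lemma derivative_along_moving_vector:
  fixes T :: "'e::euclidean_space \<Rightarrow> 'f::euclidean_space"
  assumes "open S" "smooth_on S T" "x \<in> S" "(Y has_derivative Y') (at x)"
  shows "((\<lambda>z. frechet_derivative T (at z) (Y z)) has_derivative
     (\<lambda>w. frechet_derivative (\<lambda>z. frechet_derivative T (at z) (Y x)) (at x) w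
        + frechet_derivative T (at x) (Y' w))) (at x)"
proof -
  let ?DT = "\<lambda>z. frechet_derivative T (at z)"
  let ?D2 = "\<lambda>b. frechet_derivative (\<lambda>z. ?DT z b) (at x)"
  have expand: "?DT z y = (\<Sum>b\<in>Basis. (y \<bullet> b) *\<^sub>R ?DT z b)" if "z \<in> S" for z y
  proof -
    have lin: "linear (?DT z)"
      using smooth_on_has_derivative[OF assms(2) that] has_derivative_linear by blast
    have "?DT z y = ?DT z (\<Sum>b\<in>Basis. (y \<bullet> b) *\<^sub>R b)" by (simp add: euclidean_representation)
    then show ?thesis by (simp add: linear_sum[OF lin] linear_cmul[OF lin])
  qed
  have d2: "((\<lambda>z. ?DT z b) has_derivative ?D2 b) (at x)" for b
    by (rule smooth_on_has_derivative[OF smooth_on_derivative[OF assms(2)] assms(3)])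
  have "((\<lambda>z. \<Sum>b\<in>Basis. (Y x \<bullet> b) *\<^sub>R ?DT z b) has_derivative
     (\<lambda>w. \<Sum>b\<in>Basis. (Y x \<bullet> b) *\<^sub>R ?D2 b w)) (at x)"
    by (intro has_derivative_sum has_derivative_scaleR_right d2)
  then have "((\<lambda>z. ?DT z (Y x)) has_derivative
     (\<lambda>w. \<Sum>b\<in>Basis. (Y x \<bullet> b) *\<^sub>R ?D2 b w)) (at x)"
    by (rule has_derivative_transform_within_open[OF _ assms(1,3)]) (simp flip: expand)
  from frechet_derivative_at[OF this]
  have D2Y: "?D2 (Y x) = (\<lambda>w. \<Sum>b\<in>Basis. (Y x \<bullet> b) *\<^sub>R ?D2 b w)" by (rule sym)
  have "((\<lambda>z. \<Sum>b\<in>Basis. (Y z \<bullet> b) *\<^sub>R ?DT z b) has_derivative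
     (\<lambda>w. \<Sum>b\<in>Basis. (Y x \<bullet> b) *\<^sub>R ?D2 b w + (Y' w \<bullet> b) *\<^sub>R ?DT x b)) (at x)"
    by (intro has_derivative_sum has_derivative_scaleR d2 has_derivative_inner_left assms(4))
  then have "((\<lambda>z. ?DT z (Y z)) has_derivative
     (\<lambda>w. \<Sum>b\<in>Basis. (Y x \<bullet> b) *\<^sub>R ?D2 b w + (Y' w \<bullet> b) *\<^sub>R ?DT x b)) (at x)"
    by (rule has_derivative_transform_within_open[OF _ assms(1,3)]) (simp flip: expand)
  then show ?thesis
    by (simp add: D2Y sum.distrib flip: expand[OF assms(3)])
qed

abbreviation jacobian :: "('a, 'e) chart \<Rightarrow> ('a, 'e) chart \<Rightarrow> 'a \<Rightarrow> 'e \<Rightarrow> 'e::euclidean_space" where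
  "jacobian c d p \<equiv> frechet_derivative (transition c d) (at (chart_map c p))"

abbreviation coord_deriv :: "('a, 'e) chart \<Rightarrow> ('a \<Rightarrow> real) \<Rightarrow> 'a \<Rightarrow> 'e::euclidean_space \<Rightarrow> real" where
  "coord_deriv c h p \<equiv> frechet_derivative (h \<circ> chart_inv c) (at (chart_map c p))"

abbreviation field_deriv ::
    "('a, 'e) chart \<Rightarrow> ('a \<Rightarrow> ('a, 'e) tangent) \<Rightarrow> 'a \<Rightarrow> 'e \<Rightarrow> 'e::euclidean_space" where
  "field_deriv c X p \<equiv> frechet_derivative (coord_rep c X) (at (chart_map c p))"

text \<open>The constant field \<open>v\<close> of the coordinates of \<open>c\<close>, as a tangent vector at \<open>p\<close>. Every tangent
  vector is the value of such a field, and the bracket of a field with it is minus the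
  derivative of that field in the direction \<open>v\<close>, so that tensor identities can be read off in
  one chart.\<close>

definition coord_field ::
    "('a, 'e::euclidean_space) chart set \<Rightarrow> ('a, 'e) chart \<Rightarrow> 'e \<Rightarrow> 'a \<Rightarrow> ('a, 'e) tangent" where
  "coord_field A c v p = (\<lambda>d. if d \<in> A \<and> p \<in> chart_dom d then jacobian c d p v else 0)"

lemma vector_field_on_subset:
  assumes "vector_field_on A U X" "open W" "W \<subseteq> U"
  shows "vector_field_on A W X"
proof -
  have "smooth_on (chart_map c ` (W \<inter> chart_dom c)) (coord_rep c X)" if "c \<in> A" for c
    using assms that unfolding vector_field_on_def
    by (intro smooth_on_subset[of "chart_map c ` (U \<inter> chart_dom c)" _ "chart_map c ` (W \<inter> chart_dom c)"]) auto
  then show ?thesis using assms unfolding vector_field_on_def by auto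
qed

locale smooth_atlas =
  fixes A :: "('a::{t2_space,second_countable_topology}, 'e::euclidean_space) chart set"
  assumes smooth_manifold: "smooth_manifold A"
begin

lemma
  assumes "c \<in> A"
  shows open_chart_dom: "open (chart_dom c)"
    and open_chart_range: "open (chart_map c ` chart_dom c)"
    and continuous_chart_map: "continuous_on (chart_dom c) (chart_map c)"
    and continuous_chart_inv: "continuous_on (chart_map c ` chart_dom c) (chart_inv c)"
    and chart_inv_map [simp]: "\<And>p. p \<in> chart_dom c \<Longrightarrow> chart_inv c (chart_map c p) = p"
    and chart_map_inv [simp]: "\<And>x. x \<in> chart_map c ` chart_dom c \<Longrightarrow> chart_map c (chart_inv c x) = x"
    and chart_inv_in: "\<And>x. x \<in> chart_map c ` chart_dom c \<Longrightarrow> chart_inv c x \<in> chart_dom c"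
  using smooth_manifold assms unfolding smooth_manifold_def is_chart_def homeomorphism_def
  by auto

lemma chart_around: obtains c where "c \<in> A" "p \<in> chart_dom c"
  using smooth_manifold unfolding smooth_manifold_def by blast

lemma open_chart_image:
  assumes "c \<in> A" "open U"
  shows "open (chart_map c ` (U \<inter> chart_dom c))"
proof -
  have "chart_map c ` (U \<inter> chart_dom c) = chart_map c ` chart_dom c \<inter> chart_inv c -` U"
    using assms(1) by auto
  then show ?thesis
    using continuous_open_preimage[OF continuous_chart_inv open_chart_range assms(2)] assms(1) by simp
qed

lemma transition_map: "c \<in> A \<Longrightarrow> p \<in> chart_dom c \<Longrightarrow> transition c d (chart_map c p) = chart_map d p"
  by (simp add: transition_def)

lemma smooth_transition:
  "c \<in> A \<Longrightarrow> d \<in> A \<Longrightarrow> smooth_on (chart_map c ` (chart_dom c \<inter> chart_dom d)) (transition c d)"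
  using smooth_manifold unfolding smooth_manifold_def by blast

lemma open_overlap:
  assumes "c \<in> A" "d \<in> A"
  shows "open (chart_map c ` (chart_dom c \<inter> chart_dom d))"
  using open_chart_image[OF assms(1) open_chart_dom[OF assms(2)]] by (simp add: Int_commute)

lemma transition_has_derivative:
  assumes "c \<in> A" "d \<in> A" "p \<in> chart_dom c" "p \<in> chart_dom d"
  shows "(transition c d has_derivative jacobian c d p) (at (chart_map c p))"
  by (rule smooth_on_has_derivative[OF smooth_transition[OF assms(1,2)]]) (use assms(3,4) in auto)

lemma linear_jacobian:
  assumes "c \<in> A" "d \<in> A" "p \<in> chart_dom c" "p \<in> chart_dom d"
  shows "linear (jacobian c d p)"
  by (rule has_derivative_linear[OF transition_has_derivative[OF assms]])

lemma jacobian_compose: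
  assumes "c \<in> A" "d \<in> A" "e \<in> A" "p \<in> chart_dom c" "p \<in> chart_dom d" "p \<in> chart_dom e"
  shows "jacobian d e p (jacobian c d p v) = jacobian c e p v"
proof -
  have "((\<lambda>x. transition d e (transition c d x)) has_derivative (\<lambda>v. jacobian d e p (jacobian c d p v)))
      (at (chart_map c p))"
    using has_derivative_compose[OF transition_has_derivative[OF assms(1,2,4,5)], of "transition d e" "jacobian d e p"]
      transition_has_derivative[OF assms(2,3,5,6)] transition_map[OF assms(1,4)] by simp
  then have "(transition c e has_derivative (\<lambda>v. jacobian d e p (jacobian c d p v))) (at (chart_map c p))"
    by (rule has_derivative_transform_within_open[OF _ open_overlap[OF assms(1,2)]])
       (use assms in \<open>auto simp: transition_def\<close>)
  from frechet_derivative_at[OF this] show ?thesis by metis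
qed

lemma jacobian_self:
  assumes "c \<in> A" "p \<in> chart_dom c"
  shows "jacobian c c p v = v"
proof -
  have "(transition c c has_derivative (\<lambda>v. v)) (at (chart_map c p))"
    by (rule has_derivative_transform_within_open[OF has_derivative_ident open_overlap[OF assms(1,1)]])
       (use assms in \<open>auto simp: transition_def\<close>)
  from frechet_derivative_at[OF this] show ?thesis by metis
qed

lemma coord_field_tangent:
  assumes "c \<in> A" "p \<in> chart_dom c"
  shows "coord_field A c v p \<in> tangent_space A p"
  using assms by (simp add: tangent_space_def coord_field_def jacobian_compose)

lemma coord_field_self: "c \<in> A \<Longrightarrow> p \<in> chart_dom c \<Longrightarrow> coord_field A c v p c = v"
  by (simp add: coord_field_def jacobian_self)

lemma tangent_eq_coord_field:
  assumes "c \<in> A" "p \<in> chart_dom c" "w \<in> tangent_space A p"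
  shows "coord_field A c (w c) p = w"
proof
  fix d
  show "coord_field A c (w c) p d = w d"
  proof (cases "d \<in> A \<and> p \<in> chart_dom d")
    case True
    then have "w d = jacobian c d p (w c)" using assms unfolding tangent_space_def by blast
    then show ?thesis using True by (simp add: coord_field_def)
  next
    case False
    then have "w d = 0" using assms(3) unfolding tangent_space_def by blast
    then show ?thesis using False by (auto simp: coord_field_def)
  qed
qed

lemma coord_field_add:
  assumes "c \<in> A" "p \<in> chart_dom c"
  shows "coord_field A c (u + v) p = tangent_add (coord_field A c u p) (coord_field A c v p)"
  using assms linear_add[OF linear_jacobian[OF assms(1) _ assms(2)]]
  by (auto simp: coord_field_def tangent_add_def)

lemma coord_field_scale:
  assumes "c \<in> A" "p \<in> chart_dom c"
  shows "coord_field A c (a *\<^sub>R v) p = tangent_scale a (coord_field A c v p)"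
  using assms linear_cmul[OF linear_jacobian[OF assms(1) _ assms(2)]]
  by (auto simp: coord_field_def tangent_scale_def)

lemma coord_field_change:
  assumes "c \<in> A" "d \<in> A" "p \<in> chart_dom c" "p \<in> chart_dom d"
  shows "coord_field A d (jacobian c d p v) p = coord_field A c v p"
  using assms by (simp add: coord_field_def fun_eq_iff jacobian_compose)

lemma coord_field_smooth:
  assumes "c \<in> A"
  shows "vector_field_on A (chart_dom c) (coord_field A c v)"
  unfolding vector_field_on_def
proof (intro conjI ballI)
  show "open (chart_dom c)" by (rule open_chart_dom[OF assms])
  show "coord_field A c v p \<in> tangent_space A p" if "p \<in> chart_dom c" for p
    by (rule coord_field_tangent[OF assms that])
  fix d assume d: "d \<in> A"
  have "smooth_on (chart_map d ` (chart_dom c \<inter> chart_dom d))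
    (\<lambda>x. frechet_derivative (transition c d) (at (transition d c x)) v)"
  proof (rule smooth_on_compose[where T="chart_map c ` (chart_dom c \<inter> chart_dom d)"
        and h="transition d c" and f="\<lambda>y. frechet_derivative (transition c d) (at y) v"])
    show "open (chart_map d ` (chart_dom c \<inter> chart_dom d))"
      using open_overlap[OF d assms] by (simp add: Int_commute)
    show "smooth_on (chart_map d ` (chart_dom c \<inter> chart_dom d)) (transition d c)"
      using smooth_transition[OF d assms] by (simp add: Int_commute)
    show "transition d c ` chart_map d ` (chart_dom c \<inter> chart_dom d) \<subseteq> chart_map c ` (chart_dom c \<inter> chart_dom d)"
      using d by (auto simp: transition_map)
  qed (use open_overlap[OF assms d] smooth_on_derivative[OF smooth_transition[OF assms d]] in auto)
  then show "smooth_on (chart_map d ` (chart_dom c \<inter> chart_dom d)) (coord_rep d (coord_field A c v))"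
    by (rule smooth_on_cong[rotated])
       (use d open_chart_image[OF d open_chart_dom[OF assms]] in
         \<open>auto simp: coord_rep_def coord_field_def transition_map\<close>)
qed

lemma coord_rep_change:
  assumes "vector_field_on A U X" "c \<in> A" "d \<in> A" "p \<in> U" "p \<in> chart_dom c" "p \<in> chart_dom d"
  shows "coord_rep d X (transition c d (chart_map c p)) = jacobian c d p (coord_rep c X (chart_map c p))"
proof -
  have "X p d = jacobian c d p (X p c)"
    using assms unfolding vector_field_on_def tangent_space_def by blast
  then show ?thesis using assms by (simp add: transition_map coord_rep_def)
qed

lemma coord_rep_has_derivative:
  assumes "vector_field_on A U X" "c \<in> A" "p \<in> U" "p \<in> chart_dom c"
  shows "(coord_rep c X has_derivative field_deriv c X p)
     (at (chart_map c p))"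
  using assms unfolding vector_field_on_def by (intro smooth_on_has_derivative) auto

text \<open>The coordinate expressions of the bracket are related by the Jacobian because the two terms with
  second derivatives of the transition map cancel.\<close>

lemma lie_bracket_tangent:
  assumes X: "vector_field_on A U X" and Y: "vector_field_on A U Y" and p: "p \<in> U"
  shows "lie_bracket A X Y p \<in> tangent_space A p"
proof -
  have "lie_bracket A X Y p d = jacobian c d p (lie_bracket A X Y p c)"
    if c: "c \<in> A" "p \<in> chart_dom c" and d: "d \<in> A" "p \<in> chart_dom d" for c d
  proof -
    let ?x = "chart_map c p" and ?T = "transition c d"
    let ?S = "chart_map c ` (chart_dom c \<inter> chart_dom d)"
    let ?S' = "chart_map c ` ((U \<inter> chart_dom d) \<inter> chart_dom c)"
    let ?D2 = "\<lambda>v. frechet_derivative (\<lambda>z. frechet_derivative ?T (at z) v) (at ?x)"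
    have openS: "open ?S" by (rule open_overlap[OF c(1) d(1)])
    have xS: "?x \<in> ?S" and xS': "?x \<in> ?S'"
      using c(2) d(2) p by simp_all
    have openS': "open ?S'"
      using X by (intro open_chart_image[OF c(1)] open_Int open_chart_dom[OF d(1)])
        (simp add: vector_field_on_def)
    \<comment> \<open>differentiate the transformation law \<open>Z\<^sub>d(T x) = DT\<^sub>x(Z\<^sub>c(x))\<close>\<close>
    have main: "field_deriv d Z p (jacobian c d p w)
        = ?D2 (Z p c) w + jacobian c d p (frechet_derivative (coord_rep c Z) (at ?x) w)"
      if Z: "vector_field_on A U Z" for Z w
    proof -
      have "((\<lambda>x. coord_rep d Z (?T x)) has_derivative
         (\<lambda>w. field_deriv d Z p (jacobian c d p w))) (at ?x)"
        using has_derivative_compose[OF transition_has_derivative[OF c(1) d(1) c(2) d(2)]]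
          coord_rep_has_derivative[OF Z d(1) p d(2)] transition_map[OF c] by metis
      moreover have "((\<lambda>x. frechet_derivative ?T (at x) (coord_rep c Z x)) has_derivative
         (\<lambda>w. ?D2 (coord_rep c Z ?x) w + jacobian c d p (frechet_derivative (coord_rep c Z) (at ?x) w))) (at ?x)"
        by (rule derivative_along_moving_vector[OF openS smooth_transition[OF c(1) d(1)] xS
              coord_rep_has_derivative[OF Z c(1) p c(2)]])
      then have "((\<lambda>x. coord_rep d Z (?T x)) has_derivative
         (\<lambda>w. ?D2 (coord_rep c Z ?x) w + jacobian c d p (frechet_derivative (coord_rep c Z) (at ?x) w))) (at ?x)"
        by (rule has_derivative_transform_within_open[OF _ openS' xS'])
           (use coord_rep_change[OF Z c(1) d(1)] in auto)
      ultimately have "(\<lambda>w. field_deriv d Z p (jacobian c d p w))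
         = (\<lambda>w. ?D2 (coord_rep c Z ?x) w + jacobian c d p (frechet_derivative (coord_rep c Z) (at ?x) w))"
        by (rule has_derivative_unique)
      from fun_cong[OF this, of w] show ?thesis using c by (simp add: coord_rep_def)
    qed
    have change: "Z p d = jacobian c d p (Z p c)" if "vector_field_on A U Z" for Z
      using that c d p unfolding vector_field_on_def tangent_space_def by blast
    have "lie_bracket A X Y p d =
       jacobian c d p (frechet_derivative (coord_rep c Y) (at ?x) (X p c))
       - jacobian c d p (frechet_derivative (coord_rep c X) (at ?x) (Y p c))"
      using main[OF X, of "Y p c"] main[OF Y, of "X p c"] d
        second_derivative_symmetric[OF openS smooth_transition[OF c(1) d(1)] xS, of "Y p c" "X p c"]
      by (simp add: lie_bracket_def change[OF X] change[OF Y])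
    then show ?thesis
      using c linear_diff[OF linear_jacobian[OF c(1) d(1) c(2) d(2)]] by (simp add: lie_bracket_def)
  qed
  moreover have "lie_bracket A X Y p c = 0" if "\<not> (c \<in> A \<and> p \<in> chart_dom c)" for c
    using that unfolding lie_bracket_def by argo
  ultimately show ?thesis unfolding tangent_space_def by blast
qed

lemma smooth_function_has_derivative:
  assumes "smooth_function_on A U h" "c \<in> A" "p \<in> U" "p \<in> chart_dom c"
  shows "((h \<circ> chart_inv c) has_derivative coord_deriv c h p)
     (at (chart_map c p))"
  using assms unfolding smooth_function_on_def by (intro smooth_on_has_derivative) auto

lemma smooth_function_derivative_change:
  assumes "smooth_function_on A U h" "c \<in> A" "d \<in> A" "p \<in> U" "p \<in> chart_dom c" "p \<in> chart_dom d"
  shows "coord_deriv d h p (jacobian c d p v)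
    = coord_deriv c h p v"
proof -
  have "((\<lambda>x. (h \<circ> chart_inv d) (transition c d x)) has_derivative
      (\<lambda>v. coord_deriv d h p (jacobian c d p v)))
      (at (chart_map c p))"
    by (rule has_derivative_compose[OF transition_has_derivative[OF assms(2,3,5,6)]])
      (use smooth_function_has_derivative[OF assms(1,3,4,6)] in \<open>simp only: transition_map[OF assms(2,5)]\<close>)
  then have "((h \<circ> chart_inv c) has_derivative
      (\<lambda>v. coord_deriv d h p (jacobian c d p v)))
      (at (chart_map c p))"
    by (rule has_derivative_transform_within_open[OF _ open_overlap[OF assms(2,3)]])
       (use assms in \<open>auto simp: transition_def\<close>)
  from frechet_derivative_at[OF this] show ?thesis by metis
qed

lemma deriv_along_in_chart:
  assumes "smooth_function_on A U h" "c \<in> A" "p \<in> U" "p \<in> chart_dom c" "w \<in> tangent_space A p"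
  shows "deriv_along A p w h = coord_deriv c h p (w c)"
proof -
  have "chart_at A p \<in> A \<and> p \<in> chart_dom (chart_at A p)"
    unfolding chart_at_def by (rule someI_ex) (use chart_around in blast)
  moreover from this have "w (chart_at A p) = jacobian c (chart_at A p) p (w c)"
    using assms unfolding tangent_space_def by blast
  ultimately show ?thesis
    unfolding deriv_along_def Let_def
    using smooth_function_derivative_change[OF assms(1,2) _ assms(3,4), of "chart_at A p"] by simp
qed

end

section \<open>Conformal fields in coordinates\<close>

locale conformal_field = smooth_atlas A
  for A :: "('a::{t2_space,second_countable_topology}, 'e::euclidean_space) chart set" +
  fixes g :: "('a, 'e) metric" and V :: "'a \<Rightarrow> ('a, 'e) tangent" and \<psi> :: "'a \<Rightarrow> real"
    and \<Phi> :: "'a \<Rightarrow> ('a, 'e) tangent \<Rightarrow> ('a, 'e) tangent"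
  assumes metric: "riemannian_metric A g"
    and conformal: "conformal_with_factor A g V \<psi>"
    and associated: "associated_tensor A g V \<Phi>"
    and \<Phi>_V: "\<And>p. \<Phi> p (V p) = tangent_zero"
begin

definition sq_norm :: "'a \<Rightarrow> real" where "sq_norm p = g p (V p) (V p)"

definition eta :: "('a, 'e) chart \<Rightarrow> 'e \<Rightarrow> 'a \<Rightarrow> real" where
  "eta c v p = g p (V p) (coord_field A c v p)"

lemma V_field: "vector_field_on A UNIV V"
  using conformal by (simp add: conformal_with_factor_def)

lemma V_tangent: "V p \<in> tangent_space A p"
  using V_field by (simp add: vector_field_on_def)

lemma tangent_zero_in: "tangent_zero \<in> tangent_space A p"
proof -
  have "jacobian c d p 0 = 0" if "c \<in> A" "d \<in> A" "p \<in> chart_dom c \<inter> chart_dom d" for c d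
    using linear_0[OF linear_jacobian] that by blast
  then show ?thesis unfolding tangent_space_def tangent_zero_def by simp
qed

lemma
  assumes "u \<in> tangent_space A p" "w \<in> tangent_space A p"
  shows metric_sym: "g p u w = g p w u"
    and metric_zero_left: "g p tangent_zero w = 0"
    and metric_zero_right: "g p u tangent_zero = 0"
proof -
  have bilin: "g p (tangent_scale a u) w = a * g p u w" "g p u w = g p w u"
    if "u \<in> tangent_space A p" "w \<in> tangent_space A p" for a u w
    using metric that unfolding riemannian_metric_def by blast+
  have z: "tangent_scale 0 u = tangent_zero" for u :: "('a,'e) tangent"
    by (simp add: tangent_scale_def tangent_zero_def)
  show "g p u w = g p w u" using bilin assms by blast
  show "g p tangent_zero w = 0" using bilin(1)[OF assms, of 0] by (simp add: z)
  then show "g p u tangent_zero = 0"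
    using bilin(2)[OF assms(1) tangent_zero_in] bilin(1)[OF assms(1,1), of 0] by (simp add: z)
qed

lemma metric_add_right:
  assumes "u \<in> tangent_space A p" "v \<in> tangent_space A p" "w \<in> tangent_space A p"
    "tangent_add v w \<in> tangent_space A p"
  shows "g p u (tangent_add v w) = g p u v + g p u w"
proof -
  have "g p (tangent_add v w) u = g p v u + g p w u"
    using metric assms unfolding riemannian_metric_def by blast
  then show ?thesis using assms metric_sym by metis
qed

lemma metric_scale_right:
  assumes "u \<in> tangent_space A p" "v \<in> tangent_space A p" "tangent_scale a v \<in> tangent_space A p"
  shows "g p u (tangent_scale a v) = a * g p u v"
proof -
  have "g p (tangent_scale a v) u = a * g p v u"
    using metric assms unfolding riemannian_metric_def by blast
  then show ?thesis using assms metric_sym by metis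
qed

lemma metric_pos: "v \<in> tangent_space A p \<Longrightarrow> v \<noteq> tangent_zero \<Longrightarrow> g p v v > 0"
  using metric unfolding riemannian_metric_def by blast

lemma metric_smooth:
  "vector_field_on A U X \<Longrightarrow> vector_field_on A U Y \<Longrightarrow> smooth_function_on A U (\<lambda>p. g p (X p) (Y p))"
  using metric unfolding riemannian_metric_def by blast

lemma sq_norm_nonneg: "sq_norm p \<ge> 0"
  using metric_pos[OF V_tangent] metric_zero_left[OF tangent_zero_in tangent_zero_in]
  by (cases "V p = tangent_zero") (auto simp: sq_norm_def less_imp_le)

lemma sq_norm_eq_0_iff: "sq_norm p = 0 \<longleftrightarrow> V p = tangent_zero"
  using metric_pos[OF V_tangent, of p] metric_zero_left[OF tangent_zero_in tangent_zero_in]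
  by (cases "V p = tangent_zero") (auto simp: sq_norm_def)

lemma smooth_sq_norm: "smooth_function_on A UNIV sq_norm"
  using metric_smooth[OF V_field V_field] by (simp add: sq_norm_def[abs_def])

lemma linear_eta:
  assumes "c \<in> A" "p \<in> chart_dom c"
  shows "linear (\<lambda>v. eta c v p)"
proof
  note ct = coord_field_tangent[OF assms]
  show "eta c (u + v) p = eta c u p + eta c v p" for u v
    using metric_add_right[OF V_tangent ct ct, of u v] ct[of "u + v"]
    by (simp add: eta_def coord_field_add[OF assms])
  show "eta c (a *\<^sub>R v) p = a *\<^sub>R eta c v p" for a v
    using metric_scale_right[OF V_tangent ct, of a v] ct[of "a *\<^sub>R v"]
    by (simp add: eta_def coord_field_scale[OF assms])
qed

lemma eta_V: "c \<in> A \<Longrightarrow> p \<in> chart_dom c \<Longrightarrow> eta c (V p c) p = sq_norm p"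
  by (simp add: eta_def sq_norm_def tangent_eq_coord_field V_tangent)

lemma eta_change:
  assumes "c \<in> A" "d \<in> A" "p \<in> chart_dom c" "p \<in> chart_dom d"
  shows "eta d (jacobian c d p v) p = eta c v p"
  using coord_field_change[OF assms] by (simp add: eta_def)

lemma V_field_chart: "c \<in> A \<Longrightarrow> vector_field_on A (chart_dom c) V"
  using vector_field_on_subset[OF V_field open_chart_dom] by simp

lemma smooth_eta: "c \<in> A \<Longrightarrow> smooth_function_on A (chart_dom c) (eta c v)"
  using metric_smooth[OF V_field_chart coord_field_smooth] by (simp add: eta_def[abs_def])

lemma coord_field_constant_derivative:
  assumes "c \<in> A" "p \<in> chart_dom c"
  shows "frechet_derivative (coord_rep c (coord_field A c v)) (at (chart_map c p)) = (\<lambda>_. 0)"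
proof -
  have "(coord_rep c (coord_field A c v) has_derivative (\<lambda>_. 0)) (at (chart_map c p))"
    by (rule has_derivative_transform_within_open[OF has_derivative_const open_chart_range])
       (use assms in \<open>auto simp: coord_rep_def coord_field_self\<close>)
  from frechet_derivative_at[OF this] show ?thesis by (rule sym)
qed

lemma metric_bracket_coord_field:
  assumes "c \<in> A" "p \<in> chart_dom c"
  shows "g p (V p) (lie_bracket A V (coord_field A c v) p) = - eta c (field_deriv c V p v) p"
proof -
  let ?B = "lie_bracket A V (coord_field A c v) p"
  have "?B \<in> tangent_space A p"
    by (rule lie_bracket_tangent[OF V_field_chart[OF assms(1)] coord_field_smooth[OF assms(1)] assms(2)])
  from tangent_eq_coord_field[OF assms this]
  have "g p (V p) ?B = eta c (?B c) p" by (simp add: eta_def)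
  also have "?B c = - field_deriv c V p v"
    using assms by (simp add: lie_bracket_def coord_field_constant_derivative coord_field_self)
  finally show ?thesis by (simp add: linear_neg[OF linear_eta[OF assms]])
qed

text \<open>This is \<open>L\<^sub>V \<eta> = 2 \<psi> \<eta>\<close>. It is the conformal equation for the pair \<open>(V, Y)\<close>, in which the term
  with \<open>[V, V]\<close> vanishes.\<close>

lemma lie_derivative_eta:
  assumes "c \<in> A" "p \<in> chart_dom c"
  shows "coord_deriv c (eta c v) p (V p c) + eta c (field_deriv c V p v) p
     = 2 * \<psi> p * eta c v p"
proof -
  let ?Y = "coord_field A c v"
  have "lie_derivative_metric A g V V ?Y p = 2 * \<psi> p * g p (V p) (?Y p)"
    using conformal V_field_chart[OF assms(1)] coord_field_smooth[OF assms(1)] assms(2)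
    unfolding conformal_with_factor_def by blast
  moreover have "lie_bracket A V V p = tangent_zero"
    by (simp add: lie_bracket_def tangent_zero_def fun_eq_iff)
  moreover have "deriv_along A p (V p) (eta c v)
      = coord_deriv c (eta c v) p (V p c)"
    by (rule deriv_along_in_chart[OF smooth_eta[OF assms(1)] assms(1,2,2) V_tangent])
  ultimately show ?thesis
    using metric_bracket_coord_field[OF assms, of v] metric_zero_left[OF V_tangent coord_field_tangent[OF assms]]
    by (simp add: lie_derivative_metric_def eta_def[abs_def])
qed

lemma exterior_derivative_V:
  assumes "c \<in> A" "p \<in> chart_dom c"
  shows "exterior_derivative A (dual_form g V) V (coord_field A c v) p
     = 2 * \<psi> p * eta c v p - coord_deriv c sq_norm p v"
proof -
  let ?Y = "coord_field A c v"
  have "deriv_along A p (V p) (eta c v)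
      = coord_deriv c (eta c v) p (V p c)"
    by (rule deriv_along_in_chart[OF smooth_eta[OF assms(1)] assms(1,2,2) V_tangent])
  moreover have "deriv_along A p (?Y p) sq_norm
      = coord_deriv c sq_norm p v"
    using deriv_along_in_chart[OF smooth_sq_norm assms(1) UNIV_I assms(2) coord_field_tangent[OF assms]]
    by (simp add: coord_field_self[OF assms])
  ultimately show ?thesis
    using lie_derivative_eta[OF assms, of v] metric_bracket_coord_field[OF assms, of v]
    by (simp add: exterior_derivative_def dual_form_def eta_def[abs_def] sq_norm_def[abs_def])
qed

text \<open>This is \<open>d|V|\<^sup>2 = 2 \<psi> \<eta>\<close>, that is \<open>L\<^sub>V \<eta> = i\<^sub>V d\<eta> + d(\<eta>(V))\<close> with \<open>i\<^sub>V d\<eta> = 0\<close> because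
  \<open>\<Phi>(V) = 0\<close>.\<close>

lemma derivative_sq_norm:
  assumes "c \<in> A" "p \<in> chart_dom c"
  shows "coord_deriv c sq_norm p v = 2 * \<psi> p * eta c v p"
proof -
  have "g p (\<Phi> p (V p)) (coord_field A c v p)
      = 1 / 2 * exterior_derivative A (dual_form g V) V (coord_field A c v) p"
    using associated V_field_chart[OF assms(1)] coord_field_smooth[OF assms(1)] assms(2)
    unfolding associated_tensor_def by blast
  then show ?thesis
    using exterior_derivative_V[OF assms, of v] metric_zero_left[OF V_tangent coord_field_tangent[OF assms]]
    by (simp add: \<Phi>_V)
qed

text \<open>The coordinate fields \<open>X\<close> and \<open>Y\<close> commute, so the bracket drops out of \<open>d\<eta>(X, Y)\<close>.\<close>

lemma metric_associated_tensor:
  assumes "c \<in> A" "p \<in> chart_dom c"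
  shows "2 * g p (\<Phi> p (coord_field A c u p)) (coord_field A c v p) =
    coord_deriv c (eta c v) p u
    - coord_deriv c (eta c u) p v"
proof -
  let ?X = "coord_field A c u" and ?Y = "coord_field A c v"
  have "g p (\<Phi> p (?X p)) (?Y p) = 1 / 2 * exterior_derivative A (dual_form g V) ?X ?Y p"
    using associated coord_field_smooth[OF assms(1)] assms(2)
    unfolding associated_tensor_def by blast
  moreover have "deriv_along A p (coord_field A c w p) (eta c w')
      = frechet_derivative (eta c w' \<circ> chart_inv c) (at (chart_map c p)) w" for w w'
    using deriv_along_in_chart[OF smooth_eta[OF assms(1)] assms(1,2,2) coord_field_tangent[OF assms]]
    by (simp add: coord_field_self[OF assms])
  moreover have "g p (V p) (lie_bracket A ?X ?Y p) = 0"
  proof -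
    have "lie_bracket A ?X ?Y p \<in> tangent_space A p"
      by (rule lie_bracket_tangent[OF coord_field_smooth[OF assms(1)] coord_field_smooth[OF assms(1)] assms(2)])
    moreover have "lie_bracket A ?X ?Y p c = 0"
      using assms by (simp add: lie_bracket_def coord_field_constant_derivative)
    ultimately have "g p (V p) (lie_bracket A ?X ?Y p) = eta c 0 p"
      using tangent_eq_coord_field[OF assms] by (metis eta_def)
    then show ?thesis by (simp add: linear_0[OF linear_eta[OF assms]])
  qed
  ultimately show ?thesis
    by (simp add: exterior_derivative_def dual_form_def eta_def[abs_def])
qed

end

section \<open>Ordinary differential equations in Euclidean space\<close>

text \<open>The Picard operator is a contraction on all bounded continuous functions on the line, because
  the time is clamped to the interval \<open>[-\<epsilon>, \<epsilon>]\<close>. Integrals are taken from \<open>-\<epsilon>\<close> so that both time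
  directions are treated at once; this costs the factor 4 in the estimates.\<close>

lemma picard_lindelof_global_lipschitz:
  fixes W :: "'e::euclidean_space \<Rightarrow> 'e"
  assumes lip: "\<And>x y. norm (W x - W y) \<le> L * norm (x - y)" and "L \<ge> 0"
    and bd: "\<And>x. norm (W x) \<le> M"
    and "\<epsilon> > 0" "\<epsilon> * L \<le> 1/8"
  obtains u :: "real \<Rightarrow> 'e" where "u 0 = y"
    "\<And>t. \<bar>t\<bar> < \<epsilon> \<Longrightarrow> (u has_vector_derivative W (u t)) (at t)"
    "\<And>t. norm (u t - y) \<le> 4 * \<epsilon> * M"
proof -
  let ?I = "{-\<epsilon>..\<epsilon>}"
  define cl where "cl = (\<lambda>t. max (-\<epsilon>) (min \<epsilon> t))"
  have cl: "cl t \<in> ?I" "continuous_on UNIV cl" "\<bar>t\<bar> \<le> \<epsilon> \<Longrightarrow> cl t = t" for t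
    using \<open>\<epsilon> > 0\<close> by (auto simp: cl_def intro!: continuous_intros)
  have contW: "continuous_on UNIV W"
    using lip \<open>L \<ge> 0\<close> by (intro lipschitz_on_continuous_on[of L]) (auto simp: lipschitz_on_def dist_norm)
  define P where "P = (\<lambda>(u :: real \<Rightarrow>\<^sub>C 'e) t.
     y + (integral {-\<epsilon>..t} (\<lambda>s. W (u s)) - integral {-\<epsilon>..0} (\<lambda>s. W (u s))))"
  have contWu: "continuous_on T (\<lambda>s. W (apply_bcontfun u s))" for u T
    using continuous_on_compose2[OF contW continuous_on_apply_bcontfun] by blast
  have intWu: "(\<lambda>s. W (apply_bcontfun u s)) integrable_on {a..b}" for u and a b :: real
    by (intro integrable_continuous_real contWu)
  have int_bound: "norm (integral {-\<epsilon>..t} h) \<le> 2 * \<epsilon> * B"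
    if "t \<in> ?I" "continuous_on {-\<epsilon>..t} h" "\<And>s. norm (h s) \<le> B" for t B and h :: "real \<Rightarrow> 'e"
  proof -
    have "B \<ge> 0" using that(3) norm_ge_zero order_trans by blast
    have "norm (integral {-\<epsilon>..t} h) \<le> B * (t - (-\<epsilon>))"
      using that by (intro integral_bound) auto
    also have "\<dots> \<le> B * (2 * \<epsilon>)"
      using that \<open>B \<ge> 0\<close> by (intro mult_left_mono) auto
    finally show ?thesis by (simp add: mult_ac)
  qed
  have zero: "0 \<in> ?I" using \<open>\<epsilon> > 0\<close> by simp
  have P_bound: "norm (P u t - y) \<le> 4 * \<epsilon> * M" if "t \<in> ?I" for u t
  proof -
    have "norm (P u t - y) \<le> norm (integral {-\<epsilon>..t} (\<lambda>s. W (u s))) + norm (integral {-\<epsilon>..0} (\<lambda>s. W (u s)))"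
      by (simp add: P_def norm_triangle_ineq4)
    also have "\<dots> \<le> 2 * \<epsilon> * M + 2 * \<epsilon> * M"
      using bd by (intro add_mono int_bound that zero contWu)
    finally show ?thesis by (simp add: mult_ac)
  qed
  have P_deriv: "(P u has_vector_derivative W (u t)) (at t within ?I)" if "t \<in> ?I" for u t
    unfolding P_def
    using integral_has_vector_derivative[OF contWu that, of u]
    by (auto intro!: derivative_eq_intros)
  have P_cont: "continuous_on ?I (P u)" for u
    using P_deriv by (intro continuous_on_vector_derivative) auto
  have in_bcont: "(\<lambda>t. P u (cl t)) \<in> bcontfun" for u
  proof (rule bcontfun_normI)
    show "continuous_on UNIV (\<lambda>t. P u (cl t))"
      by (rule continuous_on_compose2[OF P_cont cl(2)]) (use cl(1) in blast)
    show "norm (P u (cl t)) \<le> norm y + 4 * \<epsilon> * M" for t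
      using P_bound[OF cl(1), of u t] norm_triangle_ineq2[of "P u (cl t)" y] by linarith
  qed
  define F where "F = (\<lambda>u. Bcontfun (\<lambda>t. P u (cl t)))"
  have F: "apply_bcontfun (F u) = (\<lambda>t. P u (cl t))" for u
    unfolding F_def by (rule Bcontfun_inverse[OF in_bcont])
  have contr: "dist (F u) (F v) \<le> 1/2 * dist u v" for u v
  proof (rule dist_bound)
    fix t
    let ?h = "\<lambda>s. W (apply_bcontfun u s) - W (apply_bcontfun v s)"
    have hb: "norm (?h s) \<le> L * dist u v" for s
      using lip[of "u s" "v s"] mult_left_mono[OF dist_bounded[of u s v] \<open>L \<ge> 0\<close>] by (simp add: dist_norm)
    have hc: "continuous_on T ?h" for T by (intro continuous_on_diff contWu)
    have "P u (cl t) - P v (cl t) = integral {-\<epsilon>..cl t} ?h - integral {-\<epsilon>..0} ?h"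
      by (simp add: P_def integral_diff[OF intWu intWu])
    then have "norm (P u (cl t) - P v (cl t)) \<le> norm (integral {-\<epsilon>..cl t} ?h) + norm (integral {-\<epsilon>..0} ?h)"
      by (simp add: norm_triangle_ineq4)
    also have "\<dots> \<le> 2 * \<epsilon> * (L * dist u v) + 2 * \<epsilon> * (L * dist u v)"
      by (intro add_mono int_bound cl zero hc hb)
    also have "\<dots> = 4 * (\<epsilon> * L) * dist u v" by simp
    also have "\<dots> \<le> 1/2 * dist u v"
      using \<open>\<epsilon> * L \<le> 1/8\<close> by (intro mult_right_mono) auto
    finally show "dist (F u t) (F v t) \<le> 1/2 * dist u v" by (simp add: F dist_norm)
  qed
  obtain u where u: "F u = u"
    using banach_fix_type[of "1/2" F] contr by auto
  have u_eq: "apply_bcontfun u t = P u (cl t)" for t using F[of u] u by metis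
  show ?thesis
  proof (rule that[of "apply_bcontfun u"])
    show "u 0 = y" using u_eq[of 0] cl(3)[of 0] \<open>\<epsilon> > 0\<close> by (simp add: P_def)
    show "norm (u t - y) \<le> 4 * \<epsilon> * M" for t using P_bound[OF cl(1)] by (simp add: u_eq[of t])
    fix t :: real assume t: "\<bar>t\<bar> < \<epsilon>"
    have "(P u has_vector_derivative W (u t)) (at t)"
      using P_deriv[of t u] t at_within_interior[of t ?I] by (simp add: abs_less_iff minus_less_iff)
    then show "(u has_vector_derivative W (u t)) (at t)"
      by (rule has_vector_derivative_transform_within_open[of _ _ _ "{-\<epsilon><..<\<epsilon>}"])
         (use t cl(3) u_eq in auto)
  qed
qed

text \<open>The squared distance \<open>q\<close> satisfies \<open>|q'| \<le> 2 L q\<close>, so multiplying it by \<open>exp (- 2 L t)\<close> or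
  \<open>exp (2 L t)\<close> makes it monotone.\<close>

lemma gronwall_lipschitz:
  fixes u v :: "real \<Rightarrow> 'e::euclidean_space"
  assumes lip: "\<And>x y. x \<in> K \<Longrightarrow> y \<in> K \<Longrightarrow> norm (W x - W y) \<le> L * norm (x - y)"
    and u: "\<And>t. a < t \<Longrightarrow> t < b \<Longrightarrow> u t \<in> K \<and> (u has_vector_derivative W (u t)) (at t)"
    and v: "\<And>t. a < t \<Longrightarrow> t < b \<Longrightarrow> v t \<in> K \<and> (v has_vector_derivative W (v t)) (at t)"
    and st: "a < s" "s < b" "a < t" "t < b"
  shows "norm (u t - v t) \<le> exp (L * \<bar>t - s\<bar>) * norm (u s - v s)"
proof -
  define q where "q = (\<lambda>t. (u t - v t) \<bullet> (u t - v t))"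
  define q' where "q' = (\<lambda>t. 2 * ((u t - v t) \<bullet> (W (u t) - W (v t))))"
  have dq: "(q has_real_derivative q' t) (at t)" if "a < t" "t < b" for t
  proof -
    have d: "((\<lambda>t. u t - v t) has_derivative (\<lambda>h. h *\<^sub>R (W (u t) - W (v t)))) (at t)"
      using has_vector_derivative_diff[OF u[OF that, THEN conjunct2] v[OF that, THEN conjunct2]]
      by (simp add: has_vector_derivative_def)
    have "(q has_derivative (\<lambda>h. (u t - v t) \<bullet> (h *\<^sub>R (W (u t) - W (v t))) + (h *\<^sub>R (W (u t) - W (v t))) \<bullet> (u t - v t))) (at t)"
      unfolding q_def by (rule has_derivative_inner[OF d d])
    then show ?thesis
      by (rule has_derivative_imp_has_field_derivative) (simp add: q'_def inner_commute algebra_simps)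
  qed
  have bound: "\<bar>q' t\<bar> \<le> 2 * L * q t" if "a < t" "t < b" for t
  proof -
    have "\<bar>(u t - v t) \<bullet> (W (u t) - W (v t))\<bar> \<le> norm (u t - v t) * norm (W (u t) - W (v t))"
      by (rule Cauchy_Schwarz_ineq2)
    also have "\<dots> \<le> norm (u t - v t) * (L * norm (u t - v t))"
      using lip u[OF that] v[OF that] by (intro mult_left_mono) auto
    finally show ?thesis
      by (simp add: q'_def q_def abs_mult power2_norm_eq_inner[symmetric] power2_eq_square mult_ac)
  qed
  have exp_deriv: "((\<lambda>t. exp (k * t) * q t) has_real_derivative exp (k * t) * (k * q t + q' t)) (at t)"
    if "a < t" "t < b" for t k
    by (auto intro!: derivative_eq_intros dq that simp: algebra_simps)
  have "q t \<le> exp (2 * L * \<bar>t - s\<bar>) * q s"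
  proof (cases "s \<le> t")
    case True
    have *: "exp (- (2 * L) * t) * q t \<le> exp (- (2 * L) * s) * q s"
    proof (rule DERIV_nonpos_imp_nonincreasing[OF True])
      fix x assume x: "s \<le> x" "x \<le> t"
      then have "- (2 * L) * q x + q' x \<le> 0" using bound[of x] st by auto
      then show "\<exists>y. ((\<lambda>t. exp (- (2 * L) * t) * q t) has_real_derivative y) (at x) \<and> y \<le> 0"
        using exp_deriv[of x "- (2 * L)"] x st by (auto simp: mult_le_0_iff)
    qed
    have "q t = (exp (2 * L * t) * exp (- (2 * L) * t)) * q t" by (simp add: mult_exp_exp)
    also have "\<dots> = exp (2 * L * t) * (exp (- (2 * L) * t) * q t)" by (simp only: mult.assoc)
    also have "\<dots> \<le> exp (2 * L * t) * (exp (- (2 * L) * s) * q s)"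
      using * by (intro mult_left_mono) auto
    also have "\<dots> = (exp (2 * L * t) * exp (- (2 * L) * s)) * q s" by (simp only: mult.assoc)
    also have "exp (2 * L * t) * exp (- (2 * L) * s) = exp (2 * L * \<bar>t - s\<bar>)"
      using True by (simp add: mult_exp_exp algebra_simps)
    finally show ?thesis .
  next
    case False
    have *: "exp (2 * L * t) * q t \<le> exp (2 * L * s) * q s"
    proof (rule DERIV_nonneg_imp_nondecreasing[where f="\<lambda>t. exp (2 * L * t) * q t"])
      fix x assume x: "t \<le> x" "x \<le> s"
      then have "2 * L * q x + q' x \<ge> 0" using bound[of x] st by auto
      then show "\<exists>y. ((\<lambda>t. exp (2 * L * t) * q t) has_real_derivative y) (at x) \<and> 0 \<le> y"
        using exp_deriv[of x "2 * L"] x st by (auto intro!: mult_nonneg_nonneg exI)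
    qed (use False in simp)
    have "q t = (exp (- (2 * L) * t) * exp (2 * L * t)) * q t" by (simp add: mult_exp_exp)
    also have "\<dots> = exp (- (2 * L) * t) * (exp (2 * L * t) * q t)" by (simp only: mult.assoc)
    also have "\<dots> \<le> exp (- (2 * L) * t) * (exp (2 * L * s) * q s)"
      using * by (intro mult_left_mono) auto
    also have "\<dots> = (exp (- (2 * L) * t) * exp (2 * L * s)) * q s" by (simp only: mult.assoc)
    also have "exp (- (2 * L) * t) * exp (2 * L * s) = exp (2 * L * \<bar>t - s\<bar>)"
      using False by (simp add: mult_exp_exp algebra_simps)
    finally show ?thesis .
  qed
  then have "(norm (u t - v t))\<^sup>2 \<le> exp (2 * L * \<bar>t - s\<bar>) * (norm (u s - v s))\<^sup>2"
    by (simp add: q_def power2_norm_eq_inner)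
  also have "\<dots> = (exp (L * \<bar>t - s\<bar>) * norm (u s - v s))\<^sup>2"
    by (simp add: power_mult_distrib mult.assoc flip: exp_double)
  finally show ?thesis by (rule power2_le_imp_le) simp
qed

lemma continuous_derivative_bounded:
  fixes D :: "'e::euclidean_space \<Rightarrow> 'e \<Rightarrow> 'f::real_normed_vector"
  assumes "compact K" "\<And>b. continuous_on K (\<lambda>x. D x b)" "\<And>x. x \<in> K \<Longrightarrow> linear (D x)"
  obtains B where "B > 0" "\<And>x v. x \<in> K \<Longrightarrow> norm (D x v) \<le> B * norm v"
proof -
  have "\<exists>B. \<forall>x\<in>K. norm (D x b) \<le> B" for b
    using compact_imp_bounded[OF compact_continuous_image[OF assms(2,1)]]
    unfolding bounded_iff by auto
  then obtain C where C: "\<And>b x. x \<in> K \<Longrightarrow> norm (D x b) \<le> C b" by metis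
  show ?thesis
  proof (rule that[of "(\<Sum>b\<in>Basis. \<bar>C b\<bar>) + 1"])
    show "(\<Sum>b\<in>Basis. \<bar>C b\<bar>) + 1 > 0" by (simp add: add_nonneg_pos sum_nonneg)
    fix x v assume x: "x \<in> K"
    have "D x v = (\<Sum>b\<in>Basis. (v \<bullet> b) *\<^sub>R D x b)"
      using linear_sum[OF assms(3)[OF x], of "\<lambda>b. (v \<bullet> b) *\<^sub>R b" Basis]
      by (simp only: euclidean_representation linear_cmul[OF assms(3)[OF x]])
    also have "norm \<dots> \<le> (\<Sum>b\<in>Basis. norm ((v \<bullet> b) *\<^sub>R D x b))" by (rule norm_sum)
    also have "\<dots> \<le> (\<Sum>b\<in>Basis. norm v * \<bar>C b\<bar>)"
    proof (rule sum_mono)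
      fix b :: 'e assume "b \<in> Basis"
      then show "norm ((v \<bullet> b) *\<^sub>R D x b) \<le> norm v * \<bar>C b\<bar>"
        using C[OF x, of b] Basis_le_norm[of b v] by (auto intro!: mult_mono)
    qed
    also have "\<dots> \<le> ((\<Sum>b\<in>Basis. \<bar>C b\<bar>) + 1) * norm v"
      by (simp add: sum_distrib_left[symmetric] algebra_simps)
    finally show "norm (D x v) \<le> ((\<Sum>b\<in>Basis. \<bar>C b\<bar>) + 1) * norm v" .
  qed
qed

lemma C1_lipschitz_on_compact_convex:
  fixes W :: "'e::euclidean_space \<Rightarrow> 'f::euclidean_space"
  assumes "compact K" "convex K"
    and D: "\<And>x. x \<in> K \<Longrightarrow> (W has_derivative D x) (at x)"
    and cont: "\<And>b. continuous_on K (\<lambda>x. D x b)"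
  obtains L where "L > 0" "\<And>x y. x \<in> K \<Longrightarrow> y \<in> K \<Longrightarrow> norm (W x - W y) \<le> L * norm (x - y)"
proof -
  obtain B where B: "B > 0" "\<And>x v. x \<in> K \<Longrightarrow> norm (D x v) \<le> B * norm v"
    by (rule continuous_derivative_bounded[OF assms(1) cont has_derivative_linear[OF D]]) blast+
  have "norm (W x - W y) \<le> B * norm (x - y)" if "x \<in> K" "y \<in> K" for x y
    by (rule differentiable_bound[OF assms(2) has_derivative_at_withinI[OF D]])
       (use that B in \<open>auto intro: onorm_le\<close>)
  then show ?thesis using B(1) that by blast
qed

text \<open>On a compact convex set the derivative is uniformly continuous, so the remainder of the
  linearisation is small uniformly in the base point.\<close>

lemma C1_uniform_remainder:
  fixes W :: "'e::euclidean_space \<Rightarrow> 'f::euclidean_space"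
  assumes "compact K" "convex K"
    and D: "\<And>x. x \<in> K \<Longrightarrow> (W has_derivative D x) (at x)"
    and cont: "\<And>b. continuous_on K (\<lambda>x. D x b)" and "e > 0"
  obtains d where "d > 0" "\<And>x y. \<lbrakk>x \<in> K; y \<in> K; norm (y - x) < d\<rbrakk> \<Longrightarrow>
    norm (W y - W x - D x (y - x)) \<le> e * norm (y - x)"
proof -
  define e' where "e' = e / DIM('e)"
  have e': "e' > 0" using \<open>e > 0\<close> by (simp add: e'_def)
  have "\<exists>d>0. \<forall>x\<in>K. \<forall>y\<in>K. dist y x < d \<longrightarrow> dist (D y b) (D x b) < e'" for b
    using compact_uniformly_continuous[OF cont[of b] assms(1)] e' unfolding uniformly_continuous_on_def by blast
  then obtain \<delta> where \<delta>: "\<And>b. \<delta> b > 0"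
    "\<And>b x y. x \<in> K \<Longrightarrow> y \<in> K \<Longrightarrow> dist y x < \<delta> b \<Longrightarrow> dist (D y b) (D x b) < e'" by metis
  show ?thesis
  proof (rule that[of "Min (\<delta> ` Basis)"])
    show "Min (\<delta> ` Basis) > 0" using \<delta>(1) by (simp add: Min_gr_iff)
    fix x y assume xy: "x \<in> K" "y \<in> K" "norm (y - x) < Min (\<delta> ` Basis)"
    let ?S = "closed_segment x y"
    have SK: "?S \<subseteq> K" using closed_segment_subset xy assms(2) by blast
    have close: "norm (D z v - D x v) \<le> e * norm v" if z: "z \<in> ?S" for z v
    proof -
      have "norm (z - x) \<le> norm (y - x)" using segment_bound(1)[OF z] by (simp add: norm_minus_commute)
      then have zd: "dist z x < \<delta> b" if "b \<in> Basis" for b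
        using xy(3) that by (auto simp: dist_norm Min_gr_iff intro: le_less_trans)
      have lin: "linear (\<lambda>v. D z v - D x v)"
        by (intro linear_compose_sub has_derivative_linear[OF D] xy(1) subsetD[OF SK z])
      have "D z v - D x v = (\<Sum>b\<in>Basis. (v \<bullet> b) *\<^sub>R (D z b - D x b))"
        using linear_sum[OF lin, of "\<lambda>b. (v \<bullet> b) *\<^sub>R b" Basis]
        by (simp only: euclidean_representation linear_cmul[OF lin])
      also have "norm \<dots> \<le> (\<Sum>b\<in>Basis. norm ((v \<bullet> b) *\<^sub>R (D z b - D x b)))" by (rule norm_sum)
      also have "\<dots> \<le> (\<Sum>b\<in>(Basis::'e set). norm v * e')"
      proof (rule sum_mono)
        fix b :: 'e assume b: "b \<in> Basis"
        have "norm (D z b - D x b) \<le> e'"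
          using \<delta>(2)[OF xy(1) subsetD[OF SK z] zd[OF b]] by (simp add: dist_norm)
        then show "norm ((v \<bullet> b) *\<^sub>R (D z b - D x b)) \<le> norm v * e'"
          using Basis_le_norm[OF b, of v] by (auto intro!: mult_mono)
      qed
      also have "\<dots> = e * norm v" by (simp add: e'_def)
      finally show ?thesis .
    qed
    have deriv: "((\<lambda>z. W z - D x z) has_derivative (\<lambda>v. D z v - D x v)) (at z within ?S)" if "z \<in> ?S" for z
      by (intro has_derivative_diff has_derivative_at_withinI[OF D[OF subsetD[OF SK that]]]
          linear_imp_has_derivative has_derivative_linear[OF D[OF xy(1)]])
    have "norm ((W y - D x y) - (W x - D x x)) \<le> e * norm (y - x)"
      by (rule differentiable_bound[OF convex_closed_segment deriv])
         (use close in \<open>auto intro: onorm_le\<close>)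
    moreover have "W y - W x - D x (y - x) = (W y - D x y) - (W x - D x x)"
      by (simp add: linear_diff[OF has_derivative_linear[OF D[OF xy(1)]]])
    ultimately show "norm (W y - W x - D x (y - x)) \<le> e * norm (y - x)" by (simp only:)
  qed
qed

section \<open>Integral curves on manifolds\<close>

text \<open>Both the set of times with the property and its complement are open, and the line is connected.\<close>

lemma real_time_induct:
  fixes P :: "real \<Rightarrow> bool"
  assumes "P 0" and step: "\<And>t. \<exists>\<delta>>0. \<forall>r s. \<bar>r - t\<bar> < \<delta> \<longrightarrow> \<bar>s - t\<bar> < \<delta> \<longrightarrow> P r \<longrightarrow> P s"
  shows "P t"
proof -
  have op: "open {t. Q t}" if Q: "\<And>t. \<exists>\<delta>>0. \<forall>r s. \<bar>r - t\<bar> < \<delta> \<longrightarrow> \<bar>s - t\<bar> < \<delta> \<longrightarrow> Q r \<longrightarrow> Q s"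
    for Q :: "real \<Rightarrow> bool"
    unfolding open_dist
  proof safe
    fix t assume "Q t"
    obtain \<delta> where "\<delta> > 0" "\<forall>r s. \<bar>r - t\<bar> < \<delta> \<longrightarrow> \<bar>s - t\<bar> < \<delta> \<longrightarrow> Q r \<longrightarrow> Q s" using Q by blast
    with \<open>Q t\<close> show "\<exists>e>0. \<forall>y. dist y t < e \<longrightarrow> y \<in> {t. Q t}"
      by (intro exI[of _ \<delta>] conjI allI impI) (simp_all add: dist_real_def, metis abs_zero diff_self)
  qed
  have "open {t. P t}" by (rule op[OF step])
  moreover have "open {t. \<not> P t}"
  proof (rule op)
    show "\<exists>\<delta>>0. \<forall>r s. \<bar>r - t\<bar> < \<delta> \<longrightarrow> \<bar>s - t\<bar> < \<delta> \<longrightarrow> \<not> P r \<longrightarrow> \<not> P s" for t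
      using step[of t] by blast
  qed
  ultimately have "{t. P t} = {} \<or> {t. \<not> P t} = {}"
    using connectedD[OF connected_UNIV, of "{t. P t}" "{t. \<not> P t}"] by blast
  with \<open>P 0\<close> show ?thesis by blast
qed

locale atlas_with_field = smooth_atlas A
  for A :: "('a::{t2_space,second_countable_topology}, 'e::euclidean_space) chart set" +
  fixes V :: "'a \<Rightarrow> ('a, 'e) tangent"
  assumes field: "vector_field_on A UNIV V"
begin

text \<open>The curve \<open>z\<close> follows \<open>V\<close> at time \<open>t\<close>. Continuity is required separately because the chart maps
  have arbitrary values outside their domains.\<close>

definition integral_at :: "(real \<Rightarrow> 'a) \<Rightarrow> real \<Rightarrow> bool" where
  "integral_at z t \<longleftrightarrow> isCont z t \<and>
     (\<forall>c\<in>A. z t \<in> chart_dom c \<longrightarrow> ((\<lambda>s. chart_map c (z s)) has_vector_derivative V (z t) c) (at t))"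

lemma field_has_derivative:
  assumes "c \<in> A" "x \<in> chart_map c ` chart_dom c"
  shows "(coord_rep c V has_derivative frechet_derivative (coord_rep c V) (at x)) (at x)"
  using field assms unfolding vector_field_on_def by (intro smooth_on_has_derivative) auto

lemma field_derivative_continuous:
  assumes "c \<in> A" "K \<subseteq> chart_map c ` chart_dom c"
  shows "continuous_on K (\<lambda>x. frechet_derivative (coord_rep c V) (at x) b)"
proof -
  have "smooth_on (chart_map c ` chart_dom c) (coord_rep c V)"
    using field assms(1) unfolding vector_field_on_def by auto
  then show ?thesis
    using smooth_on_continuous[OF smooth_on_derivative] continuous_on_subset assms(2) by blast
qed

lemma field_change: "c \<in> A \<Longrightarrow> d \<in> A \<Longrightarrow> p \<in> chart_dom c \<Longrightarrow> p \<in> chart_dom d \<Longrightarrow> V p d = jacobian c d p (V p c)"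
  using field unfolding vector_field_on_def tangent_space_def by blast

lemma field_lipschitz:
  assumes "c \<in> A" "K \<subseteq> chart_map c ` chart_dom c" "compact K" "convex K"
  obtains L where "L > 0"
    "\<And>x y. x \<in> K \<Longrightarrow> y \<in> K \<Longrightarrow> norm (coord_rep c V x - coord_rep c V y) \<le> L * norm (x - y)"
proof (rule C1_lipschitz_on_compact_convex[OF assms(3,4)])
  show "(coord_rep c V has_derivative frechet_derivative (coord_rep c V) (at x)) (at x)" if "x \<in> K" for x
    using field_has_derivative[OF assms(1)] that assms(2) by blast
  show "continuous_on K (\<lambda>x. frechet_derivative (coord_rep c V) (at x) b)" for b
    by (rule field_derivative_continuous[OF assms(1,2)])
qed blast

lemma eventually_in_chart:
  assumes "c \<in> A" "isCont z t" "z t \<in> chart_dom c" "open S" "chart_map c (z t) \<in> S"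
  shows "\<exists>\<delta>>0. \<forall>s::real. \<bar>s - t\<bar> < \<delta> \<longrightarrow> z s \<in> chart_dom c \<and> chart_map c (z s) \<in> S"
proof -
  have "open (chart_dom c \<inter> chart_map c -` S)"
    using continuous_open_preimage[OF continuous_chart_map open_chart_dom assms(4)] assms(1) by blast
  moreover have "z t \<in> chart_dom c \<inter> chart_map c -` S" using assms by simp
  moreover have "(z \<longlongrightarrow> z t) (nhds t)"
    using assms(2) by (simp add: isCont_def tendsto_at_iff_tendsto_nhds)
  ultimately have "eventually (\<lambda>s. z s \<in> chart_dom c \<inter> chart_map c -` S) (nhds t)"
    by (intro topological_tendstoD)
  then show ?thesis unfolding eventually_nhds_metric by (auto simp: dist_real_def)
qed

lemma integral_at_chartI:
  assumes c: "c \<in> A" "z t \<in> chart_dom c" and "isCont z t"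
    and "((\<lambda>s. chart_map c (z s)) has_vector_derivative V (z t) c) (at t)"
  shows "integral_at z t"
  unfolding integral_at_def
proof (intro conjI ballI impI)
  show "isCont z t" by fact
  fix d assume d: "d \<in> A" "z t \<in> chart_dom d"
  have "((\<lambda>s. transition c d (chart_map c (z s))) has_derivative
     (\<lambda>h. jacobian c d (z t) (h *\<^sub>R V (z t) c))) (at t)"
    by (rule has_derivative_compose[OF assms(4)[unfolded has_vector_derivative_def]
          transition_has_derivative[OF c(1) d(1) c(2) d(2)]])
  moreover have "jacobian c d (z t) (h *\<^sub>R V (z t) c) = h *\<^sub>R V (z t) d" for h
    using field_change[OF c(1) d(1) c(2) d(2)] linear_cmul[OF linear_jacobian[OF c(1) d(1) c(2) d(2)]] by simp
  ultimately have der: "((\<lambda>s. transition c d (chart_map c (z s))) has_vector_derivative V (z t) d) (at t)"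
    by (simp add: has_vector_derivative_def)
  obtain \<delta> where \<delta>: "\<delta> > 0" "\<And>s. \<bar>s - t\<bar> < \<delta> \<Longrightarrow> z s \<in> chart_dom c"
    using eventually_in_chart[OF c(1) assms(3) c(2) open_UNIV] by auto
  show "((\<lambda>s. chart_map d (z s)) has_vector_derivative V (z t) d) (at t)"
    by (rule has_vector_derivative_transform_within[OF der \<delta>(1)])
       (use \<delta>(2) in \<open>auto simp: transition_map[OF c(1)] dist_real_def\<close>)
qed

lemma integral_at_cong:
  assumes "integral_at z t" "\<delta> > 0" and eq: "\<And>s. \<bar>s - t\<bar> < \<delta> \<Longrightarrow> z s = y s"
  shows "integral_at y t"
proof -
  have yt: "y t = z t" using eq[of t] assms(2) by simp
  have "eventually (\<lambda>s. z s = y s) (nhds t)"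
    unfolding eventually_nhds_metric using assms(2) eq by (auto simp: dist_real_def)
  from isCont_cong[OF this] have "isCont y t"
    using assms(1) unfolding integral_at_def by simp
  moreover have "((\<lambda>s. chart_map c (y s)) has_vector_derivative V (y t) c) (at t)"
    if "c \<in> A" "y t \<in> chart_dom c" for c
  proof (rule has_vector_derivative_transform_within[OF _ assms(2)])
    show "((\<lambda>s. chart_map c (z s)) has_vector_derivative V (y t) c) (at t)"
      using assms(1) that unfolding integral_at_def yt by simp
  qed (use eq in \<open>auto simp: dist_real_def\<close>)
  ultimately show ?thesis unfolding integral_at_def by blast
qed

lemma integral_at_shift:
  assumes "integral_at z (t + k)"
  shows "integral_at (\<lambda>s. z (s + k)) t"
proof -
  have "isCont (\<lambda>s. z (s + k)) t"
    by (rule isCont_o2[where g=z]) (use assms in \<open>simp_all add: integral_at_def\<close>)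
  moreover have "((\<lambda>s. chart_map c (z (s + k))) has_vector_derivative V (z (t + k)) c) (at t)"
    if "c \<in> A" "z (t + k) \<in> chart_dom c" for c
  proof -
    have "((\<lambda>s. chart_map c (z s)) has_vector_derivative V (z (t + k)) c) (at (t + k))"
      using assms that unfolding integral_at_def by blast
    moreover have "((\<lambda>s. s + k) has_vector_derivative 1) (at t)"
      by (auto intro!: derivative_eq_intros)
    ultimately show ?thesis
      using vector_diff_chain_at[of "\<lambda>s. s + k" 1 t "\<lambda>s. chart_map c (z s)"] by (simp add: o_def)
  qed
  ultimately show ?thesis unfolding integral_at_def by blast
qed

lemma integral_at_of_chart_solution:
  assumes c: "c \<in> A" and "\<delta> > 0"
    and u: "\<And>s. \<bar>s - t\<bar> < \<delta> \<Longrightarrow> u s \<in> chart_map c ` chart_dom c"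
    and deriv: "(u has_vector_derivative coord_rep c V (u t)) (at t)"
  shows "integral_at (\<lambda>s. chart_inv c (u s)) t"
proof (rule integral_at_chartI[OF c])
  have ut: "u t \<in> chart_map c ` chart_dom c" using u assms(2) by simp
  show "chart_inv c (u t) \<in> chart_dom c" by (rule chart_inv_in[OF c ut])
  have "isCont (chart_inv c) (u t)"
    using continuous_on_eq_continuous_at[OF open_chart_range[OF c]] continuous_chart_inv[OF c] ut by blast
  then show "isCont (\<lambda>s. chart_inv c (u s)) t"
    using isCont_o2[OF has_vector_derivative_continuous[OF deriv]] by blast
  show "((\<lambda>s. chart_map c (chart_inv c (u s))) has_vector_derivative V (chart_inv c (u t)) c) (at t)"
    by (rule has_vector_derivative_transform_within[OF deriv[unfolded coord_rep_def] assms(2)])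
       (use u c in \<open>auto simp: dist_real_def\<close>)
qed

lemma integral_at_coord:
  assumes "integral_at z t" "c \<in> A" "z t \<in> chart_dom c"
  shows "((\<lambda>s. chart_map c (z s)) has_vector_derivative coord_rep c V (chart_map c (z t))) (at t)"
  using assms unfolding integral_at_def by (simp add: coord_rep_def)

lemma integral_curve_gronwall:
  assumes c: "c \<in> A" "K \<subseteq> chart_map c ` chart_dom c"
    and lip: "\<And>x y. x \<in> K \<Longrightarrow> y \<in> K \<Longrightarrow> norm (coord_rep c V x - coord_rep c V y) \<le> L * norm (x - y)"
    and z: "\<And>t. a < t \<Longrightarrow> t < b \<Longrightarrow> integral_at z t \<and> z t \<in> chart_dom c \<and> chart_map c (z t) \<in> K"
    and y: "\<And>t. a < t \<Longrightarrow> t < b \<Longrightarrow> integral_at y t \<and> y t \<in> chart_dom c \<and> chart_map c (y t) \<in> K"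
    and st: "a < s" "s < b" "a < t" "t < b"
  shows "norm (chart_map c (z t) - chart_map c (y t))
    \<le> exp (L * \<bar>t - s\<bar>) * norm (chart_map c (z s) - chart_map c (y s))"
  by (rule gronwall_lipschitz[where K=K and W="coord_rep c V" and a=a and b=b])
     (use lip z y st integral_at_coord c in auto)

text \<open>The times at which both curves agree form a closed set because the manifold is Hausdorff, and an
  open set by the Gronwall inequality in a chart.\<close>

lemma integral_curve_unique:
  assumes z: "\<And>t. a < t \<Longrightarrow> t < b \<Longrightarrow> integral_at z t"
    and y: "\<And>t. a < t \<Longrightarrow> t < b \<Longrightarrow> integral_at y t"
    and t0: "a < t0" "t0 < b" "z t0 = y t0" and t: "a < t" "t < b"
  shows "z t = y t"
proof -
  let ?E = "{t \<in> {a<..<b}. z t = y t}" and ?N = "{t \<in> {a<..<b}. z t \<noteq> y t}"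
  have "open ?E" unfolding open_dist
  proof
    fix t assume "t \<in> ?E"
    then have t: "a < t" "t < b" "z t = y t" by auto
    obtain c where c: "c \<in> A" "z t \<in> chart_dom c" by (rule chart_around)
    obtain r where r: "r > 0" "cball (chart_map c (z t)) r \<subseteq> chart_map c ` chart_dom c"
      using open_contains_cball open_chart_range[OF c(1)] c(2) by (metis imageI)
    let ?K = "cball (chart_map c (z t)) r"
    obtain L where L: "L > 0"
      "\<And>x y. x \<in> ?K \<Longrightarrow> y \<in> ?K \<Longrightarrow> norm (coord_rep c V x - coord_rep c V y) \<le> L * norm (x - y)"
      using field_lipschitz[OF c(1) r(2)] by auto
    have cont: "isCont z t" "isCont y t" using z[OF t(1,2)] y[OF t(1,2)] by (auto simp: integral_at_def)
    obtain d1 where d1: "d1 > 0" "\<And>s. \<bar>s - t\<bar> < d1 \<Longrightarrow> z s \<in> chart_dom c \<and> chart_map c (z s) \<in> ball (chart_map c (z t)) r"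
      using eventually_in_chart[OF c(1) cont(1) c(2) open_ball[of "chart_map c (z t)" r]] r(1) by auto
    obtain d2 where d2: "d2 > 0" "\<And>s. \<bar>s - t\<bar> < d2 \<Longrightarrow> y s \<in> chart_dom c \<and> chart_map c (y s) \<in> ball (chart_map c (z t)) r"
      using eventually_in_chart[OF c(1) cont(2) _ open_ball[of "chart_map c (z t)" r]] r(1) c(2) t(3) by auto
    define d where "d = Min {d1, d2, t - a, b - t}"
    have d: "d > 0" "d \<le> d1" "d \<le> d2" "d \<le> t - a" "d \<le> b - t" using d1 d2 t by (auto simp: d_def)
    have "z s = y s" if "\<bar>s - t\<bar> < d" for s
    proof -
      have "norm (chart_map c (z s) - chart_map c (y s))
        \<le> exp (L * \<bar>s - t\<bar>) * norm (chart_map c (z t) - chart_map c (y t))"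
      proof (rule integral_curve_gronwall[OF c(1) r(2) L(2), where a="t - d" and b="t + d"])
        fix \<tau> assume \<tau>: "t - d < \<tau>" "\<tau> < t + d"
        then have "\<bar>\<tau> - t\<bar> < d1" "\<bar>\<tau> - t\<bar> < d2" "a < \<tau>" "\<tau> < b" using d by auto
        then show "integral_at z \<tau> \<and> z \<tau> \<in> chart_dom c \<and> chart_map c (z \<tau>) \<in> ?K"
          "integral_at y \<tau> \<and> y \<tau> \<in> chart_dom c \<and> chart_map c (y \<tau>) \<in> ?K"
          using z y d1(2) d2(2) ball_subset_cball by blast+
      qed (use that d in auto)
      then have "chart_map c (z s) = chart_map c (y s)" using t(3) by simp
      moreover have "z s \<in> chart_dom c" "y s \<in> chart_dom c" using d1(2) d2(2) that d by auto
      ultimately show ?thesis using c(1) by (metis chart_inv_map)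
    qed
    then show "\<exists>e>0. \<forall>s. dist s t < e \<longrightarrow> s \<in> ?E"
      using d by (intro exI[of _ d]) (auto simp: dist_real_def abs_less_iff)
  qed
  moreover have "open ?N" unfolding open_dist
  proof
    fix t assume "t \<in> ?N"
    then have t: "a < t" "t < b" "z t \<noteq> y t" by auto
    obtain U W where UW: "open U" "open W" "z t \<in> U" "y t \<in> W" "U \<inter> W = {}"
      using hausdorff[OF t(3)] by blast
    have "(z \<longlongrightarrow> z t) (nhds t)" "(y \<longlongrightarrow> y t) (nhds t)"
      using z[OF t(1,2)] y[OF t(1,2)] by (auto simp: integral_at_def isCont_def tendsto_at_iff_tendsto_nhds)
    then have "eventually (\<lambda>s. z s \<in> U) (nhds t)" "eventually (\<lambda>s. y s \<in> W) (nhds t)"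
      using UW by (auto intro: topological_tendstoD)
    then have "eventually (\<lambda>s. z s \<in> U \<and> y s \<in> W) (nhds t)" by (rule eventually_conj)
    then obtain d where d: "d > 0" "\<And>s. dist s t < d \<Longrightarrow> z s \<in> U \<and> y s \<in> W"
      unfolding eventually_nhds_metric by blast
    show "\<exists>e>0. \<forall>s. dist s t < e \<longrightarrow> s \<in> ?N"
    proof (intro exI[of _ "Min {d, t - a, b - t}"] conjI allI impI)
      fix s assume "dist s t < Min {d, t - a, b - t}"
      then have "dist s t < d" "a < s" "s < b" by (auto simp: dist_real_def abs_less_iff)
      then show "s \<in> ?N" using d(2)[of s] UW(5) by auto
    qed (use d t in auto)
  qed
  ultimately have "?E \<inter> {a<..<b} = {} \<or> ?N \<inter> {a<..<b} = {}"
    by (intro connectedD[OF connected_Ioo]) auto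
  moreover have "t0 \<in> ?E" using t0 by simp
  ultimately have "?N \<inter> {a<..<b} = {}" by blast
  then show ?thesis using t by auto
qed

text \<open>Composing the coordinate expression of \<open>V\<close> with the nearest point projection onto a ball makes
  it globally Lipschitz and bounded, and the solutions do not leave the ball for a short time,
  which is the same for all initial points near \<open>p\<close>.\<close>

lemma local_integral_curves:
  assumes c: "c \<in> A" "p \<in> chart_dom c" and S: "open S" "chart_map c p \<in> S" "S \<subseteq> chart_map c ` chart_dom c"
  obtains K U \<epsilon> where "compact K" "convex K" "K \<subseteq> S" "open U" "p \<in> U" "U \<subseteq> chart_dom c" "\<epsilon> > 0"
    "\<And>x. x \<in> U \<Longrightarrow> \<exists>z. z 0 = x \<and>
       (\<forall>t. \<bar>t\<bar> < \<epsilon> \<longrightarrow> integral_at z t \<and> z t \<in> chart_dom c \<and> chart_map c (z t) \<in> K)"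
proof -
  let ?p = "chart_map c p"
  obtain R where R: "R > 0" "cball ?p R \<subseteq> S"
    using open_contains_cball S by blast
  define K where "K = cball ?p R"
  have K: "compact K" "convex K" "closed K" "K \<noteq> {}" "K \<subseteq> S" "K \<subseteq> chart_map c ` chart_dom c"
    using R S(3) by (auto simp: K_def)
  obtain L where L: "L > 0"
    "\<And>x y. x \<in> K \<Longrightarrow> y \<in> K \<Longrightarrow> norm (coord_rep c V x - coord_rep c V y) \<le> L * norm (x - y)"
    using field_lipschitz[OF c(1) K(6,1,2)] by blast
  define W where "W = (\<lambda>x. coord_rep c V (closest_point K x))"
  have cp: "closest_point K x \<in> K" for x using closest_point_in_set K by blast
  have lipW: "norm (W x - W y) \<le> L * norm (x - y)" for x y
  proof -
    have "norm (W x - W y) \<le> L * norm (closest_point K x - closest_point K y)"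
      unfolding W_def using L(2) cp by blast
    also have "\<dots> \<le> L * norm (x - y)"
      using closest_point_lipschitz[OF K(2-4), of x y] L(1) by (simp add: dist_norm)
    finally show ?thesis .
  qed
  define M where "M = norm (coord_rep c V ?p) + L * R + 1"
  have M: "M > 0" using L(1) R(1) by (simp add: M_def add_nonneg_pos)
  have bdW: "norm (W x) \<le> M" for x
  proof -
    have "norm (coord_rep c V (closest_point K x) - coord_rep c V ?p) \<le> L * norm (closest_point K x - ?p)"
      using L(2)[OF cp, of ?p] R(1) by (simp add: K_def)
    also have "\<dots> \<le> L * R" using cp[of x] L(1) by (simp add: K_def dist_norm norm_minus_commute)
    finally show ?thesis
      unfolding W_def M_def using norm_triangle_ineq2[of "coord_rep c V (closest_point K x)" "coord_rep c V ?p"] by linarith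
  qed
  \<comment> \<open>the first bound makes the Picard operator contract, the second keeps the solution in the ball\<close>
  define \<epsilon> where "\<epsilon> = min (1 / (8 * L)) (R / (8 * M))"
  have \<epsilon>: "\<epsilon> > 0" "\<epsilon> * L \<le> 1/8" "4 * \<epsilon> * M \<le> R / 2"
  proof -
    show "\<epsilon> > 0" using L(1) M R(1) by (simp add: \<epsilon>_def)
    have "\<epsilon> * L \<le> 1 / (8 * L) * L" using L(1) by (intro mult_right_mono) (auto simp: \<epsilon>_def)
    then show "\<epsilon> * L \<le> 1/8" using L(1) by simp
    have "\<epsilon> * M \<le> R / (8 * M) * M" using M by (intro mult_right_mono) (auto simp: \<epsilon>_def)
    then show "4 * \<epsilon> * M \<le> R / 2" using M by simp
  qed
  define U where "U = chart_dom c \<inter> chart_map c -` ball ?p (R / 2)"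
  have "open U" unfolding U_def
    using continuous_open_preimage[OF continuous_chart_map open_chart_dom open_ball] c(1) by blast
  moreover have "p \<in> U" using c R(1) by (simp add: U_def)
  moreover have "U \<subseteq> chart_dom c" by (simp add: U_def)
  moreover have "\<exists>z. z 0 = x \<and>
       (\<forall>t. \<bar>t\<bar> < \<epsilon> \<longrightarrow> integral_at z t \<and> z t \<in> chart_dom c \<and> chart_map c (z t) \<in> K)" if x: "x \<in> U" for x
  proof -
    obtain u where u: "u 0 = chart_map c x"
      "\<And>t. \<bar>t\<bar> < \<epsilon> \<Longrightarrow> (u has_vector_derivative W (u t)) (at t)"
      "\<And>t. norm (u t - chart_map c x) \<le> 4 * \<epsilon> * M"
      using picard_lindelof_global_lipschitz[OF lipW less_imp_le[OF L(1)] bdW \<epsilon>(1,2), of "chart_map c x"] by blast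
    have uK: "u t \<in> K" for t
    proof -
      have "norm (u t - chart_map c x) \<le> R / 2" using u(3)[of t] \<epsilon>(3) by linarith
      moreover have "norm (chart_map c x - ?p) \<le> R / 2"
        using x by (simp add: U_def dist_norm norm_minus_commute)
      ultimately have "norm (u t - ?p) \<le> R"
        using norm_triangle_ineq[of "u t - chart_map c x" "chart_map c x - ?p"] by simp
      then show ?thesis by (simp add: K_def dist_norm norm_minus_commute)
    qed
    have uR: "u t \<in> chart_map c ` chart_dom c" for t using uK K(6) by blast
    show ?thesis
    proof (intro exI[of _ "\<lambda>t. chart_inv c (u t)"] conjI allI impI)
      show "chart_inv c (u 0) = x" using u(1) x c(1) by (simp add: U_def)
      fix t assume t: "\<bar>t\<bar> < \<epsilon>"
      have "W (u t) = coord_rep c V (u t)" by (simp add: W_def closest_point_self[OF uK])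
      then show "integral_at (\<lambda>t. chart_inv c (u t)) t"
        using u(2)[OF t] by (intro integral_at_of_chart_solution[OF c(1) zero_less_one uR]) simp
      show "chart_inv c (u t) \<in> chart_dom c" by (rule chart_inv_in[OF c(1) uR])
      show "chart_map c (chart_inv c (u t)) \<in> K" using chart_map_inv[OF c(1) uR] uK by simp
    qed
  qed
  ultimately show ?thesis using that[OF K(1,2,5)] \<epsilon>(1) by blast
qed

end

section \<open>The flow on a compact manifold\<close>

context atlas_with_field
begin

definition flows_for :: "real \<Rightarrow> bool" where
  "flows_for T \<longleftrightarrow> (\<forall>x. \<exists>z. z 0 = x \<and> (\<forall>t. \<bar>t\<bar> < T \<longrightarrow> integral_at z t))"

lemma integral_curve_glue:
  assumes y: "\<And>t. a < t \<Longrightarrow> t < b \<Longrightarrow> integral_at y t"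
    and z: "\<And>t. a' < t \<Longrightarrow> t < b' \<Longrightarrow> integral_at z t"
    and m: "a < m" "a' < m" "m < b" "m < b'" "y m = z m"
    and t: "a < t" "t < b'"
  shows "integral_at (\<lambda>t. if t < m then y t else z t) t"
proof -
  have agree: "y s = z s" if "max a a' < s" "s < min b b'" for s
    by (rule integral_curve_unique[where z=y and y=z and t=s and a="max a a'" and b="min b b'" and ?t0.0=m])
      (use y z m that in auto)
  consider "t < m" | "t = m" | "t > m" by linarith
  then show ?thesis
  proof cases
    case 1
    then have "integral_at y t" using y t m by simp
    then show ?thesis by (rule integral_at_cong[where \<delta>="m - t"]) (use 1 in \<open>auto simp: abs_less_iff\<close>)
  next
    case 2
    then have "integral_at z t" using z m by simp
    then show ?thesis
    proof (rule integral_at_cong[where \<delta>="m - max a a'"])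
      fix s assume "\<bar>s - t\<bar> < m - max a a'"
      then have "max a a' < s" using 2 by (auto simp: abs_less_iff)
      then show "z s = (if s < m then y s else z s)" using agree[of s] m by auto
    qed (use m in auto)
  next
    case 3
    then have "integral_at z t" using z t m by simp
    then show ?thesis by (rule integral_at_cong[where \<delta>="t - m"]) (use 3 in \<open>auto simp: abs_less_iff\<close>)
  qed
qed

text \<open>Restarting the curve at the times \<open>T / 2\<close> and \<open>- T / 2\<close> gives overlapping pieces, so that the
  glued curve is differentiable at the junctions.\<close>

lemma flows_for_extend:
  assumes "flows_for T" "T > 0"
  shows "flows_for (3 / 2 * T)"
  unfolding flows_for_def
proof
  fix x
  obtain z0 where z0: "z0 0 = x" "\<And>t. \<bar>t\<bar> < T \<Longrightarrow> integral_at z0 t"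
    using assms(1) unfolding flows_for_def by blast
  obtain z1 where z1: "z1 0 = z0 (T / 2)" "\<And>t. \<bar>t\<bar> < T \<Longrightarrow> integral_at z1 t"
    using assms(1) unfolding flows_for_def by blast
  obtain z2 where z2: "z2 0 = z0 (- (T / 2))" "\<And>t. \<bar>t\<bar> < T \<Longrightarrow> integral_at z2 t"
    using assms(1) unfolding flows_for_def by blast
  define y1 where "y1 = (\<lambda>t. z1 (t + - (T / 2)))"
  define y2 where "y2 = (\<lambda>t. z2 (t + T / 2))"
  have y1: "integral_at y1 t" if "- (T / 2) < t" "t < 3 / 2 * T" for t
    unfolding y1_def by (rule integral_at_shift) (use z1(2) that in \<open>auto simp: abs_less_iff\<close>)
  have y2: "integral_at y2 t" if "- (3 / 2 * T) < t" "t < T / 2" for t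
    unfolding y2_def by (rule integral_at_shift) (use z2(2) that in \<open>auto simp: abs_less_iff\<close>)
  define w where "w = (\<lambda>t. if t < T / 2 then z0 t else y1 t)"
  have w: "integral_at w t" if "- T < t" "t < 3 / 2 * T" for t
    unfolding w_def
    by (rule integral_curve_glue[where y=z0 and z=y1 and m="T / 2" and t=t and a="- T" and b=T and a'="- (T / 2)" and b'="3 / 2 * T"])
       (use z0 y1 z1(1) assms(2) that in \<open>auto simp: y1_def\<close>)
  define v where "v = (\<lambda>t. if t < - (T / 2) then y2 t else w t)"
  have v: "integral_at v t" if "- (3 / 2 * T) < t" "t < 3 / 2 * T" for t
    unfolding v_def
    by (rule integral_curve_glue[where y=y2 and z=w and m="- (T / 2)" and t=t and a="- (3 / 2 * T)" and b="T / 2" and a'="- T" and b'="3 / 2 * T"])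
       (use y2 w z2(1) assms(2) that in \<open>auto simp: y2_def w_def\<close>)
  have "v 0 = x" using assms(2) z0(1) by (simp add: v_def w_def)
  with v show "\<exists>z. z 0 = x \<and> (\<forall>t. \<bar>t\<bar> < 3 / 2 * T \<longrightarrow> integral_at z t)"
    by (intro exI[of _ v]) (auto simp: abs_less_iff)
qed

end

locale compact_flow = atlas_with_field +
  assumes compact: "compact (UNIV :: 'a set)"
begin

lemma flows_for_some: "\<exists>T>0. flows_for T"
proof -
  have "\<exists>U \<epsilon>. open U \<and> p \<in> U \<and> \<epsilon> > 0 \<and>
     (\<forall>x\<in>U. \<exists>z. z 0 = x \<and> (\<forall>t::real. \<bar>t\<bar> < \<epsilon> \<longrightarrow> integral_at z t))" for p
  proof -
    obtain c where c: "c \<in> A" "p \<in> chart_dom c" by (rule chart_around)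
    obtain K U \<epsilon> where "open U" "p \<in> U" "\<epsilon> > 0"
      "\<And>x. x \<in> U \<Longrightarrow> \<exists>z. z 0 = x \<and>
       (\<forall>t::real. \<bar>t\<bar> < \<epsilon> \<longrightarrow> integral_at z t \<and> z t \<in> chart_dom c \<and> chart_map c (z t) \<in> K)"
      using local_integral_curves[OF c open_chart_range[OF c(1)] imageI[OF c(2)] order_refl] by metis
    then show ?thesis by (intro exI[of _ U] exI[of _ \<epsilon>]) blast
  qed
  then obtain U \<epsilon> where U: "\<And>p. open (U p)" "\<And>p. p \<in> U p" "\<And>p. \<epsilon> p > (0::real)"
    "\<And>p x. x \<in> U p \<Longrightarrow> \<exists>z. z 0 = x \<and> (\<forall>t. \<bar>t\<bar> < \<epsilon> p \<longrightarrow> integral_at z t)"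
    by metis
  obtain C where C: "finite C" "UNIV \<subseteq> (\<Union>p\<in>C. U p)"
    by (rule compactE_image[OF compact, of UNIV U]) (use U in auto)
  have "C \<noteq> {}" using C(2) by auto
  show ?thesis
  proof (intro exI[of _ "Min (\<epsilon> ` C)"] conjI)
    show "Min (\<epsilon> ` C) > 0" using C(1) \<open>C \<noteq> {}\<close> U(3) by (simp add: Min_gr_iff)
    show "flows_for (Min (\<epsilon> ` C))"
      unfolding flows_for_def
    proof
      fix x
      obtain p where p: "p \<in> C" "x \<in> U p" using C(2) by blast
      then have "Min (\<epsilon> ` C) \<le> \<epsilon> p" using C(1) by simp
      then show "\<exists>z. z 0 = x \<and> (\<forall>t. \<bar>t\<bar> < Min (\<epsilon> ` C) \<longrightarrow> integral_at z t)"
        using U(4)[OF p(2)] less_le_trans by blast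
    qed
  qed
qed

lemma flows_for_all: "flows_for T"
proof -
  obtain T0 where T0: "T0 > 0" "flows_for T0" using flows_for_some by blast
  have "flows_for ((3 / 2) ^ n * T0)" for n
  proof (induction n)
    case (Suc n)
    then show ?case using flows_for_extend[OF Suc] T0(1) by (simp add: mult_ac)
  qed (use T0 in simp)
  moreover obtain n where "T / T0 < (3 / 2) ^ n" using real_arch_pow[of "3 / 2" "T / T0"] by auto
  then have "T < (3 / 2) ^ n * T0" using T0(1) by (simp add: field_simps)
  ultimately show ?thesis unfolding flows_for_def by (meson less_trans)
qed

text \<open>By uniqueness the value does not depend on the interval on which the integral curve is chosen;
  any interval that contains \<open>t\<close> in its interior will do.\<close>

definition flow :: "real \<Rightarrow> 'a \<Rightarrow> 'a" where
  "flow t x = (SOME z. z 0 = x \<and> (\<forall>s. \<bar>s\<bar> < \<bar>t\<bar> + 1 \<longrightarrow> integral_at z s)) t"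

lemma flow_zero [simp]: "flow 0 x = x"
  and flow_integral: "integral_at (\<lambda>t. flow t x) t"
proof -
  define Z where "Z = (\<lambda>T. SOME z. z 0 = x \<and> (\<forall>s. \<bar>s\<bar> < T \<longrightarrow> integral_at z s))"
  have Z: "Z T 0 = x" "\<bar>s\<bar> < T \<Longrightarrow> integral_at (Z T) s" for T s
  proof -
    have "Z T 0 = x \<and> (\<forall>s. \<bar>s\<bar> < T \<longrightarrow> integral_at (Z T) s)"
      unfolding Z_def by (rule someI_ex[of "\<lambda>z. z 0 = x \<and> (\<forall>s. \<bar>s\<bar> < T \<longrightarrow> integral_at z s)"])
        (use flows_for_all[of T] in \<open>unfold flows_for_def, blast\<close>)
    then show "Z T 0 = x" "\<bar>s\<bar> < T \<Longrightarrow> integral_at (Z T) s" by auto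
  qed
  have flow_Z: "flow t x = Z (\<bar>t\<bar> + 1) t" for t by (simp add: flow_def Z_def)
  show "flow 0 x = x" by (simp add: flow_Z Z)
  have "integral_at (Z (\<bar>t\<bar> + 2)) t" by (simp add: Z)
  then show "integral_at (\<lambda>t. flow t x) t"
  proof (rule integral_at_cong[OF _ zero_less_one])
    fix s assume "\<bar>s - t\<bar> < 1"
    then have s: "\<bar>s\<bar> < \<bar>t\<bar> + 2" by linarith
    define T where "T = min (\<bar>t\<bar> + 2) (\<bar>s\<bar> + 1)"
    have "Z (\<bar>t\<bar> + 2) s = Z (\<bar>s\<bar> + 1) s"
    proof (rule integral_curve_unique[where z="Z (\<bar>t\<bar> + 2)" and y="Z (\<bar>s\<bar> + 1)" and t=s and a="- T" and b=T and ?t0.0=0])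
      show "integral_at (Z (\<bar>t\<bar> + 2)) r" "integral_at (Z (\<bar>s\<bar> + 1)) r" if "- T < r" "r < T" for r
      proof -
        have "\<bar>r\<bar> < T" using that by linarith
        then show "integral_at (Z (\<bar>t\<bar> + 2)) r" "integral_at (Z (\<bar>s\<bar> + 1)) r"
          by (auto intro!: Z(2) simp: T_def)
      qed
      show "- T < 0" "0 < T" by (simp_all add: T_def add_nonneg_pos)
      show "- T < s" "s < T" using s unfolding T_def by linarith+
    qed (simp add: Z(1))
    then show "Z (\<bar>t\<bar> + 2) s = flow s x" by (simp add: flow_Z)
  qed
qed

lemma flow_time_cont: "isCont (\<lambda>t. flow t x) t"
  using flow_integral unfolding integral_at_def by blast

lemma flow_unique:
  assumes "\<And>t. a < t \<Longrightarrow> t < b \<Longrightarrow> integral_at z t" "a < t0" "t0 < b" "z t0 = flow t0 x" "a < t" "t < b"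
  shows "flow t x = z t"
  by (rule integral_curve_unique[where z="\<lambda>t. flow t x" and y=z and t=t and a=a and b=b and ?t0.0=t0])
    (use assms flow_integral in auto)

text \<open>All orbits that pass through \<open>U\<close> stay in one compact convex coordinate set for a definite time;
  this is the setting for estimates in a chart.\<close>

lemma flow_box:
  assumes c: "c \<in> A" "p \<in> chart_dom c" and S: "open S" "chart_map c p \<in> S" "S \<subseteq> chart_map c ` chart_dom c"
  obtains K U \<epsilon> where "compact K" "convex K" "K \<subseteq> S" "open U" "p \<in> U" "U \<subseteq> chart_dom c" "\<epsilon> > 0"
    "\<And>x t0 t. flow t0 x \<in> U \<Longrightarrow> \<bar>t - t0\<bar> < \<epsilon> \<Longrightarrow> flow t x \<in> chart_dom c \<and> chart_map c (flow t x) \<in> K"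
proof -
  obtain K U \<epsilon> where K: "compact K" "convex K" "K \<subseteq> S" "open U" "p \<in> U" "U \<subseteq> chart_dom c" "\<epsilon> > 0"
    and loc: "\<And>x. x \<in> U \<Longrightarrow> \<exists>z. z 0 = x \<and>
       (\<forall>t. \<bar>t\<bar> < \<epsilon> \<longrightarrow> integral_at z t \<and> z t \<in> chart_dom c \<and> chart_map c (z t) \<in> K)"
    by (rule local_integral_curves[OF c S]) blast
  have "flow t x \<in> chart_dom c \<and> chart_map c (flow t x) \<in> K"
    if x: "flow t0 x \<in> U" and t: "\<bar>t - t0\<bar> < \<epsilon>" for x t0 t
  proof -
    obtain z where z: "z 0 = flow t0 x"
      "\<And>t. \<bar>t\<bar> < \<epsilon> \<Longrightarrow> integral_at z t \<and> z t \<in> chart_dom c \<and> chart_map c (z t) \<in> K"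
      using loc[OF x] by blast
    have "flow t x = z (t + - t0)"
    proof (rule flow_unique[where a="t0 - \<epsilon>" and b="t0 + \<epsilon>" and ?t0.0=t0])
      fix s assume "t0 - \<epsilon> < s" "s < t0 + \<epsilon>"
      then have "\<bar>s + - t0\<bar> < \<epsilon>" by (simp add: abs_less_iff)
      then show "integral_at (\<lambda>s. z (s + - t0)) s" using z(2) by (intro integral_at_shift) blast
    qed (use z(1) t \<open>\<epsilon> > 0\<close> in \<open>auto simp: abs_less_iff\<close>)
    then show ?thesis using z(2)[of "t - t0"] t by simp
  qed
  with K show ?thesis by (intro that) blast+
qed

lemma flow_box_lipschitz:
  assumes c: "c \<in> A" and K: "compact K" "convex K" "K \<subseteq> chart_map c ` chart_dom c"
    and box: "\<And>x t0 t. flow t0 x \<in> U \<Longrightarrow> \<bar>t - t0\<bar> < \<epsilon> \<Longrightarrow> flow t x \<in> chart_dom c \<and> chart_map c (flow t x) \<in> K"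
  obtains B where "B > 0" "\<And>x y t0 t. \<lbrakk>flow t0 x \<in> U; flow t0 y \<in> U; \<bar>t - t0\<bar> < \<epsilon>\<rbrakk> \<Longrightarrow>
     norm (chart_map c (flow t x) - chart_map c (flow t y)) \<le>
       B * norm (chart_map c (flow t0 x) - chart_map c (flow t0 y))"
proof -
  obtain L where L: "L > 0"
    "\<And>x y. x \<in> K \<Longrightarrow> y \<in> K \<Longrightarrow> norm (coord_rep c V x - coord_rep c V y) \<le> L * norm (x - y)"
    using field_lipschitz[OF c K(3,1,2)] by blast
  have "norm (chart_map c (flow t x) - chart_map c (flow t y)) \<le>
       exp (L * \<epsilon>) * norm (chart_map c (flow t0 x) - chart_map c (flow t0 y))"
    if xy: "flow t0 x \<in> U" "flow t0 y \<in> U" and t: "\<bar>t - t0\<bar> < \<epsilon>" for x y t0 t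
  proof -
    have "norm (chart_map c (flow t x) - chart_map c (flow t y)) \<le>
       exp (L * \<bar>t - t0\<bar>) * norm (chart_map c (flow t0 x) - chart_map c (flow t0 y))"
    proof (rule integral_curve_gronwall[OF c K(3) L(2), where a="t0 - \<epsilon>" and b="t0 + \<epsilon>"])
      fix s assume "t0 - \<epsilon> < s" "s < t0 + \<epsilon>"
      then have s: "\<bar>s - t0\<bar> < \<epsilon>" by (simp add: abs_less_iff)
      show "integral_at (\<lambda>t. flow t x) s \<and> flow s x \<in> chart_dom c \<and> chart_map c (flow s x) \<in> K"
        "integral_at (\<lambda>t. flow t y) s \<and> flow s y \<in> chart_dom c \<and> chart_map c (flow s y) \<in> K"
        using flow_integral box[OF xy(1) s] box[OF xy(2) s] by auto
    qed (use t in \<open>auto simp: abs_less_iff\<close>)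
    also have "\<dots> \<le> exp (L * \<epsilon>) * norm (chart_map c (flow t0 x) - chart_map c (flow t0 y))"
      using t L(1) by (intro mult_right_mono) auto
    finally show ?thesis .
  qed
  then show ?thesis by (intro that[of "exp (L * \<epsilon>)"]) auto
qed


lemma chart_map_tendsto: "c \<in> A \<Longrightarrow> p \<in> chart_dom c \<Longrightarrow> (chart_map c \<longlongrightarrow> chart_map c p) (nhds p)"
  using continuous_on_eq_continuous_at[OF open_chart_dom] continuous_chart_map
  by (metis isCont_def tendsto_at_iff_tendsto_nhds)

lemma chart_inv_tendsto:
  "c \<in> A \<Longrightarrow> x \<in> chart_map c ` chart_dom c \<Longrightarrow> (chart_inv c \<longlongrightarrow> chart_inv c x) (nhds x)"
  using continuous_on_eq_continuous_at[OF open_chart_range] continuous_chart_inv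
  by (metis isCont_def tendsto_at_iff_tendsto_nhds)

lemma flow_time_tendsto: "((\<lambda>t. flow t x) \<longlongrightarrow> flow t x) (nhds t)"
  using flow_time_cont tendsto_at_iff_tendsto_nhds[of "\<lambda>t. flow t x" t] by (simp add: isCont_def)

lemma tendsto_via_chart:
  assumes c: "c \<in> A" "p \<in> chart_dom c" and "((\<lambda>y. chart_map c (h y)) \<longlongrightarrow> chart_map c p) F"
    and "eventually (\<lambda>y. h y \<in> chart_dom c) F"
  shows "(h \<longlongrightarrow> p) F"
proof -
  have "((\<lambda>y. chart_inv c (chart_map c (h y))) \<longlongrightarrow> chart_inv c (chart_map c p)) F"
    using filterlim_compose[OF chart_inv_tendsto[OF c(1) imageI[OF c(2)]] assms(3)] .
  then show ?thesis
    using c assms(4) by (auto elim!: Lim_transform_eventually eventually_mono)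
qed

text \<open>Continuity in the initial point passes from one time to a nearby one by the Lipschitz estimate
  in a flow box, and hence to all times.\<close>

lemma flow_space_tendsto: "(flow t \<longlongrightarrow> flow t x) (nhds x)"
proof (rule real_time_induct[where P="\<lambda>t. (flow t \<longlongrightarrow> flow t x) (nhds x)"])
  show "(flow 0 \<longlongrightarrow> flow 0 x) (nhds x)"
    by (simp add: filterlim_def eventually_filtermap le_filter_def)
  fix t
  obtain c where c: "c \<in> A" "flow t x \<in> chart_dom c" by (rule chart_around)
  obtain K U \<epsilon> where K: "compact K" "convex K" "K \<subseteq> chart_map c ` chart_dom c"
    and U: "open U" "flow t x \<in> U" "U \<subseteq> chart_dom c" "\<epsilon> > 0"
    and box: "\<And>x t0 t. flow t0 x \<in> U \<Longrightarrow> \<bar>t - t0\<bar> < \<epsilon> \<Longrightarrow> flow t x \<in> chart_dom c \<and> chart_map c (flow t x) \<in> K"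
    by (rule flow_box[OF c open_chart_range[OF c(1)] imageI[OF c(2)] order_refl]) blast
  obtain B where B: "B > 0" "\<And>x y t0 t. \<lbrakk>flow t0 x \<in> U; flow t0 y \<in> U; \<bar>t - t0\<bar> < \<epsilon>\<rbrakk> \<Longrightarrow>
     norm (chart_map c (flow t x) - chart_map c (flow t y)) \<le>
       B * norm (chart_map c (flow t0 x) - chart_map c (flow t0 y))"
    by (rule flow_box_lipschitz[OF c(1) K box]) blast+
  have "eventually (\<lambda>s. flow s x \<in> U) (nhds t)"
    by (rule topological_tendstoD[OF flow_time_tendsto U(1,2)])
  then obtain \<delta> where \<delta>: "\<delta> > 0" "\<And>s. \<bar>s - t\<bar> < \<delta> \<Longrightarrow> flow s x \<in> U"
    unfolding eventually_nhds_metric dist_real_def by blast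
  show "\<exists>\<delta>>0. \<forall>r s. \<bar>r - t\<bar> < \<delta> \<longrightarrow> \<bar>s - t\<bar> < \<delta> \<longrightarrow>
     (flow r \<longlongrightarrow> flow r x) (nhds x) \<longrightarrow> (flow s \<longlongrightarrow> flow s x) (nhds x)"
  proof (intro exI[of _ "min \<delta> (\<epsilon> / 2)"] conjI allI impI)
    fix r s
    assume r: "\<bar>r - t\<bar> < min \<delta> (\<epsilon> / 2)" and s: "\<bar>s - t\<bar> < min \<delta> (\<epsilon> / 2)"
      and cont: "(flow r \<longlongrightarrow> flow r x) (nhds x)"
    have sr: "\<bar>s - r\<bar> < \<epsilon>" using r s by linarith
    have rU: "flow r x \<in> U" using r \<delta>(2) by simp
    have ev: "eventually (\<lambda>y. flow r y \<in> U) (nhds x)"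
      by (rule topological_tendstoD[OF cont U(1) rU])
    have "((\<lambda>y. chart_map c (flow r y)) \<longlongrightarrow> chart_map c (flow r x)) (nhds x)"
      using filterlim_compose[OF chart_map_tendsto cont] c(1) rU U(3) by blast
    then have lim: "((\<lambda>y. B * norm (chart_map c (flow r y) - chart_map c (flow r x))) \<longlongrightarrow> 0) (nhds x)"
      using tendsto_mult_right_zero[OF tendsto_norm_zero[OF LIM_zero]] by blast
    have "((\<lambda>y. chart_map c (flow s y)) \<longlongrightarrow> chart_map c (flow s x)) (nhds x)"
    proof (rule LIM_zero_cancel[OF Lim_null_comparison[OF _ lim]])
      show "eventually (\<lambda>y. norm (chart_map c (flow s y) - chart_map c (flow s x))
          \<le> B * norm (chart_map c (flow r y) - chart_map c (flow r x))) (nhds x)"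
        using ev by eventually_elim (use B(2) rU sr in blast)
    qed
    moreover have "eventually (\<lambda>y. flow s y \<in> chart_dom c) (nhds x)"
      using ev by eventually_elim (use box sr in blast)
    ultimately show "(flow s \<longlongrightarrow> flow s x) (nhds x)"
      using tendsto_via_chart[OF c(1)] box[OF rU sr] by blast
  qed (use \<delta> U in auto)
qed

lemma flow_tendsto: "((\<lambda>z. flow (fst z) (snd z)) \<longlongrightarrow> flow t x) (nhds t \<times>\<^sub>F nhds x)"
proof -
  obtain c where c: "c \<in> A" "flow t x \<in> chart_dom c" by (rule chart_around)
  obtain K U \<epsilon> where K: "compact K" "convex K" "K \<subseteq> chart_map c ` chart_dom c"
    and U: "open U" "flow t x \<in> U" "U \<subseteq> chart_dom c" "\<epsilon> > 0"
    and box: "\<And>x t0 t. flow t0 x \<in> U \<Longrightarrow> \<bar>t - t0\<bar> < \<epsilon> \<Longrightarrow> flow t x \<in> chart_dom c \<and> chart_map c (flow t x) \<in> K"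
    by (rule flow_box[OF c open_chart_range[OF c(1)] imageI[OF c(2)] order_refl]) blast
  obtain B where B: "B > 0" "\<And>x y t0 t. \<lbrakk>flow t0 x \<in> U; flow t0 y \<in> U; \<bar>t - t0\<bar> < \<epsilon>\<rbrakk> \<Longrightarrow>
     norm (chart_map c (flow t x) - chart_map c (flow t y)) \<le>
       B * norm (chart_map c (flow t0 x) - chart_map c (flow t0 y))"
    by (rule flow_box_lipschitz[OF c(1) K box]) blast+
  let ?F = "nhds t \<times>\<^sub>F nhds x"
  have "eventually (\<lambda>s. \<bar>s - t\<bar> < \<epsilon>) (nhds t)"
    unfolding eventually_nhds_metric using U(4) by (auto simp: dist_real_def)
  then have ev1: "eventually (\<lambda>z. \<bar>fst z - t\<bar> < \<epsilon>) ?F"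
    by (rule eventually_compose_filterlim[OF _ filterlim_fst])
  have ev2: "eventually (\<lambda>z. flow t (snd z) \<in> U) ?F"
    by (rule eventually_compose_filterlim[OF topological_tendstoD[OF flow_space_tendsto U(1,2)] filterlim_snd])
  have "((\<lambda>z. chart_map c (flow t (snd z))) \<longlongrightarrow> chart_map c (flow t x)) ?F"
    by (intro filterlim_compose[OF chart_map_tendsto[OF c]] filterlim_compose[OF flow_space_tendsto filterlim_snd])
  then have l1: "((\<lambda>z. B * norm (chart_map c (flow t (snd z)) - chart_map c (flow t x))) \<longlongrightarrow> 0) ?F"
    using tendsto_mult_right_zero[OF tendsto_norm_zero[OF LIM_zero]] by blast
  have "((\<lambda>z. chart_map c (flow (fst z) x)) \<longlongrightarrow> chart_map c (flow t x)) ?F"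
    by (intro filterlim_compose[OF chart_map_tendsto[OF c]] filterlim_compose[OF flow_time_tendsto filterlim_fst])
  then have l2: "((\<lambda>z. norm (chart_map c (flow (fst z) x) - chart_map c (flow t x))) \<longlongrightarrow> 0) ?F"
    using tendsto_norm_zero[OF LIM_zero] by blast
  have "((\<lambda>z. chart_map c (flow (fst z) (snd z))) \<longlongrightarrow> chart_map c (flow t x)) ?F"
  proof (rule LIM_zero_cancel[OF Lim_null_comparison[OF _ tendsto_add_zero[OF l1 l2]]])
    show "eventually (\<lambda>z. norm (chart_map c (flow (fst z) (snd z)) - chart_map c (flow t x))
       \<le> B * norm (chart_map c (flow t (snd z)) - chart_map c (flow t x))
         + norm (chart_map c (flow (fst z) x) - chart_map c (flow t x))) ?F"
      using ev1 ev2
    proof eventually_elim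
      case (elim z)
      have "norm (chart_map c (flow (fst z) (snd z)) - chart_map c (flow (fst z) x))
        \<le> B * norm (chart_map c (flow t (snd z)) - chart_map c (flow t x))"
        using B(2)[OF elim(2) U(2) elim(1)] .
      then show ?case
        using norm_triangle_ineq[of "chart_map c (flow (fst z) (snd z)) - chart_map c (flow (fst z) x)"
          "chart_map c (flow (fst z) x) - chart_map c (flow t x)"] by simp
    qed
  qed
  moreover have "eventually (\<lambda>z. flow (fst z) (snd z) \<in> chart_dom c) ?F"
    using ev1 ev2 by eventually_elim (use box in blast)
  ultimately show ?thesis by (rule tendsto_via_chart[OF c])
qed

end

section \<open>Transport of an invariant one-form\<close>

lemma has_real_derivative_zeroI:
  fixes R :: "real \<Rightarrow> real"
  assumes "\<And>e. e > 0 \<Longrightarrow> eventually (\<lambda>s. \<bar>R s - R s0\<bar> \<le> e * \<bar>s - s0\<bar>) (nhds s0)"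
  shows "(R has_real_derivative 0) (at s0)"
  unfolding has_field_derivative_def has_derivative_at_alt
proof (intro conjI allI impI)
  fix e :: real assume "e > 0"
  from assms[OF this] show "\<exists>d>0. \<forall>y. norm (y - s0) < d \<longrightarrow> norm (R y - R s0 - 0 * (y - s0)) \<le> e * norm (y - s0)"
    unfolding eventually_nhds_metric dist_norm by simp
qed (rule bounded_linear_mult_right)

lemma has_field_derivative_eventually_eq:
  assumes "(f has_field_derivative D) (at x)" "eventually (\<lambda>y. f y = g y) (nhds x)"
  shows "(g has_field_derivative D) (at x)"
  using DERIV_cong_ev[OF refl assms(2) refl] assms(1) by blast

lemma tendsto_of_pointwise_lipschitz:
  fixes x :: "real \<Rightarrow> 'e::real_normed_vector"
  assumes "eventually (\<lambda>s. norm (x s - x s0) \<le> C * \<bar>s - s0\<bar>) (nhds s0)"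
  shows "(x \<longlongrightarrow> x s0) (nhds s0)"
proof (rule LIM_zero_cancel[OF Lim_null_comparison[OF assms]])
  have "((\<lambda>s. C * \<bar>s - s0\<bar>) \<longlongrightarrow> C * \<bar>s0 - s0\<bar>) (nhds s0)"
    by (intro tendsto_intros filterlim_ident)
  then show "((\<lambda>s. C * \<bar>s - s0\<bar>) \<longlongrightarrow> 0) (nhds s0)" by simp
qed

text \<open>The remainder of the linearisation of \<open>\<phi>\<close> at \<open>x(s\<^sub>0)\<close> is \<open>o(|x(s) - x(s\<^sub>0)|) = o(|s - s\<^sub>0|)\<close>. So
  \<open>\<phi>\<close> can be differentiated along a curve that is merely Lipschitz at the point, provided that
  \<open>\<phi>'\<close> can.\<close>

lemma has_real_derivative_along_lipschitz:
  fixes \<phi> :: "'e::real_normed_vector \<Rightarrow> real"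
  assumes D: "(\<phi> has_derivative \<phi>') (at (x s0))"
    and lip: "eventually (\<lambda>s. norm (x s - x s0) \<le> C * \<bar>s - s0\<bar>) (nhds s0)"
    and d: "((\<lambda>s. \<phi>' (x s)) has_real_derivative a) (at s0)"
  shows "((\<lambda>s. \<phi> (x s)) has_real_derivative a) (at s0)"
proof -
  define R where "R = (\<lambda>s. \<phi> (x s) - \<phi>' (x s))"
  have "(R has_real_derivative 0) (at s0)"
  proof (rule has_real_derivative_zeroI)
    fix e :: real assume "e > 0"
    then have e': "e / (\<bar>C\<bar> + 1) > 0" by (simp add: add_nonneg_pos)
    then obtain d where d: "d > 0"
      "\<And>y. norm (y - x s0) < d \<Longrightarrow> norm (\<phi> y - \<phi> (x s0) - \<phi>' (y - x s0)) \<le> e / (\<bar>C\<bar> + 1) * norm (y - x s0)"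
      using D unfolding has_derivative_at_alt by blast
    have "eventually (\<lambda>s. x s \<in> ball (x s0) d) (nhds s0)"
      by (rule topological_tendstoD[OF tendsto_of_pointwise_lipschitz[OF lip]]) (use d in auto)
    with lip show "eventually (\<lambda>s. \<bar>R s - R s0\<bar> \<le> e * \<bar>s - s0\<bar>) (nhds s0)"
    proof eventually_elim
      case (elim s)
      have "\<bar>R s - R s0\<bar> = norm (\<phi> (x s) - \<phi> (x s0) - \<phi>' (x s - x s0))"
        by (simp add: R_def linear_diff[OF has_derivative_linear[OF D]] algebra_simps)
      also have "\<dots> \<le> e / (\<bar>C\<bar> + 1) * norm (x s - x s0)"
        using elim(2) by (intro d(2)) (simp add: dist_norm norm_minus_commute)
      also have "\<dots> \<le> e / (\<bar>C\<bar> + 1) * ((\<bar>C\<bar> + 1) * \<bar>s - s0\<bar>)"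
      proof (rule mult_left_mono)
        have "C * \<bar>s - s0\<bar> \<le> (\<bar>C\<bar> + 1) * \<bar>s - s0\<bar>" by (intro mult_right_mono) auto
        with elim(1) show "norm (x s - x s0) \<le> (\<bar>C\<bar> + 1) * \<bar>s - s0\<bar>" by linarith
      qed (use e' in simp)
      also have "\<dots> = e * \<bar>s - s0\<bar>" using add_nonneg_pos[of "\<bar>C\<bar>" 1] by simp
      finally show ?case .
    qed
  qed
  from DERIV_add[OF this d] show ?thesis by (simp add: R_def)
qed

text \<open>A one-form \<open>\<beta>\<close> on an open flow-invariant set \<open>N\<close>, given by its components in the charts, with
  \<open>\<beta>(V) = 1\<close> and \<open>L\<^sub>V \<beta> = 0\<close>, and a function \<open>f\<close> with \<open>df = b \<beta>\<close>, so that \<open>b = V f\<close>.\<close>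

locale flow_invariant_form = compact_flow A V
  for A :: "('a::{t2_space,second_countable_topology}, 'e::euclidean_space) chart set" and V +
  fixes N :: "'a set" and \<beta> :: "('a, 'e) chart \<Rightarrow> 'e \<Rightarrow> 'a \<Rightarrow> real" and f b :: "'a \<Rightarrow> real"
  assumes N_open: "open N"
    and N_flow: "\<And>x t. x \<in> N \<Longrightarrow> flow t x \<in> N"
    and form_linear: "\<And>c p. c \<in> A \<Longrightarrow> p \<in> chart_dom c \<Longrightarrow> p \<in> N \<Longrightarrow> linear (\<lambda>v. \<beta> c v p)"
    and form_change: "\<And>c d p v. c \<in> A \<Longrightarrow> d \<in> A \<Longrightarrow> p \<in> chart_dom c \<Longrightarrow> p \<in> chart_dom d \<Longrightarrow> p \<in> N \<Longrightarrow>
      \<beta> d (jacobian c d p v) p = \<beta> c v p"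
    and form_derivative: "\<And>c p v. c \<in> A \<Longrightarrow> p \<in> chart_dom c \<Longrightarrow> p \<in> N \<Longrightarrow>
      (\<beta> c v \<circ> chart_inv c has_derivative coord_deriv c (\<beta> c v) p)
        (at (chart_map c p))"
    and form_invariant: "\<And>c p v. c \<in> A \<Longrightarrow> p \<in> chart_dom c \<Longrightarrow> p \<in> N \<Longrightarrow>
      coord_deriv c (\<beta> c v) p (V p c)
        + \<beta> c (field_deriv c V p v) p = 0"
    and form_field: "\<And>c p. c \<in> A \<Longrightarrow> p \<in> chart_dom c \<Longrightarrow> p \<in> N \<Longrightarrow> \<beta> c (V p c) p = 1"
    and f_derivative: "\<And>c p. c \<in> A \<Longrightarrow> p \<in> chart_dom c \<Longrightarrow> p \<in> N \<Longrightarrow>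
      (f \<circ> chart_inv c has_derivative (\<lambda>v. b p * \<beta> c v p)) (at (chart_map c p))"
    and b_continuous: "continuous_on N b"
begin

abbreviation domN :: "('a, 'e) chart \<Rightarrow> 'e set" where
  "domN c \<equiv> chart_map c ` (N \<inter> chart_dom c)"

lemma open_domN: "c \<in> A \<Longrightarrow> open (domN c)"
  by (rule open_chart_image[OF _ N_open])

lemma form_expand:
  assumes "c \<in> A" "p \<in> chart_dom c" "p \<in> N"
  shows "\<beta> c v p = (\<Sum>i\<in>Basis. (v \<bullet> i) * \<beta> c i p)"
  using linear_sum[OF form_linear[OF assms], of "\<lambda>i. (v \<bullet> i) *\<^sub>R i" Basis]
  by (simp only: euclidean_representation linear_cmul[OF form_linear[OF assms]] real_scaleR_def)

lemma bounded_linear_form: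
  assumes "c \<in> A" "p \<in> chart_dom c" "p \<in> N"
  shows "bounded_linear (\<lambda>v. \<beta> c v p)"
  using form_linear[OF assms] linear_conv_bounded_linear by blast

lemma form_continuous: "c \<in> A \<Longrightarrow> continuous_on (domN c) (\<lambda>x. \<beta> c v (chart_inv c x))"
proof (rule continuous_at_imp_continuous_on, rule ballI)
  fix x assume c: "c \<in> A" and "x \<in> domN c"
  then obtain p where p: "p \<in> N" "p \<in> chart_dom c" "x = chart_map c p" by blast
  show "isCont (\<lambda>x. \<beta> c v (chart_inv c x)) x"
    using has_derivative_continuous[OF form_derivative[OF c p(2,1), of v]] p(3) by (simp add: o_def)
qed

text \<open>To first order, \<open>\<sigma>\<close> moves with \<open>\<beta>\<close>-speed \<open>a\<close> at \<open>s\<^sub>0\<close>. This is a version of \<open>\<beta>(\<sigma>'(s\<^sub>0)) = a\<close>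
  that the Gronwall estimate shows to be stable under the flow: a Lipschitz bound at \<open>s\<^sub>0\<close>
  together with the derivative of the \<open>\<beta>\<close>-component.\<close>

definition moves_at :: "('a, 'e) chart \<Rightarrow> (real \<Rightarrow> 'a) \<Rightarrow> real \<Rightarrow> real \<Rightarrow> bool" where
  "moves_at c \<sigma> s0 a \<longleftrightarrow>
     (\<exists>C. eventually (\<lambda>s. \<sigma> s \<in> chart_dom c \<and>
        norm (chart_map c (\<sigma> s) - chart_map c (\<sigma> s0)) \<le> C * \<bar>s - s0\<bar>) (nhds s0)) \<and>
     ((\<lambda>s. \<beta> c (chart_map c (\<sigma> s)) (\<sigma> s0)) has_real_derivative a) (at s0)"

lemma moves_at_change:
  assumes c: "c \<in> A" "\<sigma> s0 \<in> chart_dom c" and d: "d \<in> A" "\<sigma> s0 \<in> chart_dom d"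
    and N: "\<sigma> s0 \<in> N" and moves: "moves_at c \<sigma> s0 a"
  shows "moves_at d \<sigma> s0 a"
proof -
  let ?T = "transition c d" and ?p = "\<sigma> s0"
  let ?x = "\<lambda>s. chart_map c (\<sigma> s)"
  obtain C where C: "eventually (\<lambda>s. \<sigma> s \<in> chart_dom c \<and> norm (?x s - ?x s0) \<le> C * \<bar>s - s0\<bar>) (nhds s0)"
    and a: "((\<lambda>s. \<beta> c (?x s) ?p) has_real_derivative a) (at s0)"
    using moves unfolding moves_at_def by blast
  have lip: "eventually (\<lambda>s. norm (?x s - ?x s0) \<le> C * \<bar>s - s0\<bar>) (nhds s0)"
    using C by eventually_elim blast
  note xlim = tendsto_of_pointwise_lipschitz[OF lip]
  have DT: "(?T has_derivative jacobian c d ?p) (at (?x s0))"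
    by (rule transition_has_derivative[OF c(1) d(1) c(2) d(2)])
  have inD: "eventually (\<lambda>s. \<sigma> s \<in> chart_dom c \<and> \<sigma> s \<in> chart_dom d) (nhds s0)"
  proof -
    have "eventually (\<lambda>s. ?x s \<in> chart_map c ` (chart_dom c \<inter> chart_dom d)) (nhds s0)"
      by (rule topological_tendstoD[OF xlim open_overlap[OF c(1) d(1)]]) (use c d in auto)
    with C show ?thesis
    proof eventually_elim
      case (elim s)
      then obtain q where q: "q \<in> chart_dom c" "q \<in> chart_dom d" "?x s = chart_map c q" by blast
      have "\<sigma> s = q" using arg_cong[OF q(3), of "chart_inv c"] elim(1) q(1) c(1) by simp
      then show ?case using q by blast
    qed
  qed
  obtain BJ where BJ: "\<And>v. norm (jacobian c d ?p v) \<le> BJ * norm v" "BJ > 0"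
    using bounded_linear.pos_bounded[OF has_derivative_bounded_linear[OF DT]] by (auto simp: mult.commute)
  obtain \<delta> where \<delta>: "\<delta> > 0"
    "\<And>y. norm (y - ?x s0) < \<delta> \<Longrightarrow> norm (?T y - ?T (?x s0) - jacobian c d ?p (y - ?x s0)) \<le> 1 * norm (y - ?x s0)"
    using DT zero_less_one unfolding has_derivative_at_alt by blast
  have "eventually (\<lambda>s. ?x s \<in> ball (?x s0) \<delta>) (nhds s0)"
    by (rule topological_tendstoD[OF xlim]) (use \<delta> in auto)
  with lip inD have lipT: "eventually (\<lambda>s. \<sigma> s \<in> chart_dom d \<and>
      norm (chart_map d (\<sigma> s) - chart_map d ?p) \<le> ((BJ + 1) * C) * \<bar>s - s0\<bar>) (nhds s0)"
  proof eventually_elim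
    case (elim s)
    have "norm (?T (?x s) - ?T (?x s0)) \<le> norm (?T (?x s) - ?T (?x s0) - jacobian c d ?p (?x s - ?x s0))
        + norm (jacobian c d ?p (?x s - ?x s0))"
      using norm_triangle_sub[of "?T (?x s) - ?T (?x s0)" "jacobian c d ?p (?x s - ?x s0)"] by linarith
    also have "\<dots> \<le> 1 * norm (?x s - ?x s0) + BJ * norm (?x s - ?x s0)"
      using elim(3) by (intro add_mono \<delta>(2) BJ(1)) (simp add: dist_norm norm_minus_commute)
    also have "\<dots> = (BJ + 1) * norm (?x s - ?x s0)" by (simp add: algebra_simps)
    also have "\<dots> \<le> (BJ + 1) * (C * \<bar>s - s0\<bar>)" using elim(1) BJ(2) by (intro mult_left_mono) auto
    finally show ?case using elim(2) c by (simp add: transition_map mult.assoc)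
  qed
  have "((\<lambda>y. \<beta> d (?T y) ?p) has_derivative (\<lambda>v. \<beta> d (jacobian c d ?p v) ?p)) (at (?x s0))"
    by (rule bounded_linear.has_derivative[OF bounded_linear_form[OF d N] DT])
  then have "((\<lambda>y. \<beta> d (?T y) ?p) has_derivative (\<lambda>v. \<beta> c v ?p)) (at (?x s0))"
    using form_change[OF c(1) d(1) c(2) d(2) N] by simp
  from has_real_derivative_along_lipschitz[OF this lip a]
  have "((\<lambda>s. \<beta> d (?T (?x s)) ?p) has_real_derivative a) (at s0)" .
  moreover have "eventually (\<lambda>s. \<beta> d (?T (?x s)) ?p = \<beta> d (chart_map d (\<sigma> s)) ?p) (nhds s0)"
    using inD by eventually_elim (simp add: transition_map[OF c(1)])
  ultimately have "((\<lambda>s. \<beta> d (chart_map d (\<sigma> s)) ?p) has_real_derivative a) (at s0)"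
    by (rule has_field_derivative_eventually_eq)
  with lipT show ?thesis unfolding moves_at_def by blast
qed

lemma moves_at_f:
  assumes c: "c \<in> A" "\<sigma> s0 \<in> chart_dom c" and N: "\<sigma> s0 \<in> N" and moves: "moves_at c \<sigma> s0 a"
  shows "((\<lambda>s. f (\<sigma> s)) has_real_derivative b (\<sigma> s0) * a) (at s0)"
proof -
  let ?x = "\<lambda>s. chart_map c (\<sigma> s)"
  obtain C where C: "eventually (\<lambda>s. \<sigma> s \<in> chart_dom c \<and> norm (?x s - ?x s0) \<le> C * \<bar>s - s0\<bar>) (nhds s0)"
    and a: "((\<lambda>s. \<beta> c (?x s) (\<sigma> s0)) has_real_derivative a) (at s0)"
    using moves unfolding moves_at_def by blast
  have lip: "eventually (\<lambda>s. norm (?x s - ?x s0) \<le> C * \<bar>s - s0\<bar>) (nhds s0)"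
    using C by eventually_elim blast
  have "((\<lambda>s. (f \<circ> chart_inv c) (?x s)) has_real_derivative b (\<sigma> s0) * a) (at s0)"
    by (rule has_real_derivative_along_lipschitz[OF f_derivative[OF c N] lip DERIV_cmult[OF a]])
  moreover have "eventually (\<lambda>s. (f \<circ> chart_inv c) (?x s) = f (\<sigma> s)) (nhds s0)"
    using C by eventually_elim (use c in simp)
  ultimately show ?thesis by (rule has_field_derivative_eventually_eq)
qed

text \<open>The invariance of \<open>\<beta>\<close> in infinitesimal form: \<open>\<beta>(w)\<close> is constant along the flow if \<open>w\<close> satisfies
  the linearised equation \<open>w' = DV(w)\<close>.\<close>

lemma form_derivative_along_flow:
  assumes c: "c \<in> A" "z t \<in> chart_dom c" "z t \<in> N" and z: "integral_at z t"
    and w: "(w has_vector_derivative w') (at t)"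
  shows "((\<lambda>s. \<beta> c (w s) (z s)) has_real_derivative
     \<beta> c (w' - field_deriv c V (z t) (w t)) (z t)) (at t)"
proof -
  let ?DV = "field_deriv c V (z t)"
  have "open (N \<inter> chart_dom c)" using N_open open_chart_dom[OF c(1)] by blast
  moreover have "(z \<longlongrightarrow> z t) (nhds t)"
    using z by (simp add: integral_at_def isCont_def tendsto_at_iff_tendsto_nhds)
  ultimately have ev: "eventually (\<lambda>s. z s \<in> N \<inter> chart_dom c) (nhds t)"
    using c by (intro topological_tendstoD) auto
  have dz: "((\<lambda>s. chart_map c (z s)) has_derivative (\<lambda>h. h *\<^sub>R V (z t) c)) (at t)"
    using z c unfolding integral_at_def has_vector_derivative_def by blast
  have d\<beta>: "((\<lambda>s. \<beta> c i (z s)) has_real_derivative - \<beta> c (?DV i) (z t)) (at t)" for i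
  proof -
    let ?D = "coord_deriv c (\<beta> c i) (z t)"
    have "((\<lambda>s. (\<beta> c i \<circ> chart_inv c) (chart_map c (z s))) has_derivative (\<lambda>h. ?D (h *\<^sub>R V (z t) c))) (at t)"
      by (rule has_derivative_compose[OF dz form_derivative[OF c]])
    moreover have "?D (V (z t) c) = - \<beta> c (?DV i) (z t)"
      using form_invariant[OF c, of i] by linarith
    then have "?D (h *\<^sub>R V (z t) c) = - \<beta> c (?DV i) (z t) * h" for h
      by (simp add: linear_cmul[OF has_derivative_linear[OF form_derivative[OF c]]])
    ultimately have "((\<lambda>s. (\<beta> c i \<circ> chart_inv c) (chart_map c (z s))) has_real_derivative - \<beta> c (?DV i) (z t)) (at t)"
      by (intro has_derivative_imp_has_field_derivative) (auto simp: mult.commute)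
    moreover have "eventually (\<lambda>s. (\<beta> c i \<circ> chart_inv c) (chart_map c (z s)) = \<beta> c i (z s)) (nhds t)"
      using ev by eventually_elim (use c in simp)
    ultimately show ?thesis by (rule has_field_derivative_eventually_eq)
  qed
  have dw: "((\<lambda>s. w s \<bullet> i) has_real_derivative w' \<bullet> i) (at t)" for i
  proof -
    have "((\<lambda>s. w s \<bullet> i) has_derivative (\<lambda>h. (h *\<^sub>R w') \<bullet> i)) (at t)"
      using w has_derivative_inner_left unfolding has_vector_derivative_def by blast
    then show ?thesis by (simp add: has_field_derivative_def mult_commute_abs)
  qed
  have deriv: "((\<lambda>s. \<Sum>i\<in>Basis. (w s \<bullet> i) * \<beta> c i (z s)) has_real_derivative
     (\<Sum>i\<in>Basis. (w' \<bullet> i) * \<beta> c i (z t) + (- \<beta> c (?DV i) (z t)) * (w t \<bullet> i))) (at t)"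
    by (intro DERIV_sum DERIV_mult dw d\<beta>)
  have val: "(\<Sum>i\<in>Basis. (w' \<bullet> i) * \<beta> c i (z t) + (- \<beta> c (?DV i) (z t)) * (w t \<bullet> i))
     = \<beta> c (w' - ?DV (w t)) (z t)"
  proof -
    have linDV: "linear ?DV"
      using has_derivative_linear[OF field_has_derivative[OF c(1)]] c(2) by blast
    have lin2: "linear (\<lambda>v. \<beta> c (?DV v) (z t))"
      using linear_compose[OF linDV form_linear[OF c]] by (simp add: o_def)
    have "\<beta> c (?DV (w t)) (z t) = (\<Sum>i\<in>Basis. (w t \<bullet> i) * \<beta> c (?DV i) (z t))"
      using linear_sum[OF lin2, of "\<lambda>i. (w t \<bullet> i) *\<^sub>R i" Basis]
      by (simp only: euclidean_representation linear_cmul[OF lin2] real_scaleR_def)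
    then show ?thesis
      using form_expand[OF c, of w'] linear_diff[OF form_linear[OF c], of w' "?DV (w t)"]
      by (simp add: sum_subtractf mult.commute)
  qed
  have "eventually (\<lambda>s. (\<Sum>i\<in>Basis. (w s \<bullet> i) * \<beta> c i (z s)) = \<beta> c (w s) (z s)) (nhds t)"
    using ev by eventually_elim (use form_expand[OF c(1)] in simp)
  from has_field_derivative_eventually_eq[OF deriv this] show ?thesis unfolding val .
qed

text \<open>Within a flow box, the coordinate difference of two orbits satisfies the linearised equation up
  to an error \<open>o(|s - s\<^sub>0|)\<close>, by the Gronwall inequality and the uniform remainder of \<open>V\<close>. So
  its \<open>\<beta>\<close>-component is conserved up to \<open>o(|s - s\<^sub>0|)\<close>.\<close>

lemma moves_at_flow_step:
  assumes c: "c \<in> A" and K: "compact K" "convex K" "K \<subseteq> domN c"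
    and U: "open U" "U \<subseteq> chart_dom c"
    and box: "\<And>x t0 t. flow t0 x \<in> U \<Longrightarrow> \<bar>t - t0\<bar> < \<epsilon> \<Longrightarrow> flow t x \<in> chart_dom c \<and> chart_map c (flow t x) \<in> K"
    and t0: "flow t0 (\<gamma> s0) \<in> U" and t1: "\<bar>t1 - t0\<bar> < \<epsilon>"
    and moves: "moves_at c (\<lambda>s. flow t0 (\<gamma> s)) s0 a"
  shows "moves_at c (\<lambda>s. flow t1 (\<gamma> s)) s0 a"
proof -
  let ?x0 = "\<gamma> s0"
  let ?y = "\<lambda>s t. chart_map c (flow t (\<gamma> s))"
  have KR: "K \<subseteq> chart_map c ` chart_dom c" using K(3) by blast
  have \<epsilon>: "\<epsilon> > 0" using t1 by linarith
  obtain C where C: "eventually (\<lambda>s. flow t0 (\<gamma> s) \<in> chart_dom c \<and> norm (?y s t0 - ?y s0 t0) \<le> C * \<bar>s - s0\<bar>) (nhds s0)"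
    and a: "((\<lambda>s. \<beta> c (?y s t0) (flow t0 ?x0)) has_real_derivative a) (at s0)"
    using moves unfolding moves_at_def by blast
  have lip0: "eventually (\<lambda>s. norm (?y s t0 - ?y s0 t0) \<le> C * \<bar>s - s0\<bar>) (nhds s0)"
    using C by eventually_elim blast
  have "((\<lambda>s. flow t0 (\<gamma> s)) \<longlongrightarrow> flow t0 ?x0) (nhds s0)"
  proof (rule tendsto_via_chart[OF c])
    show "flow t0 ?x0 \<in> chart_dom c" using t0 U(2) by blast
    show "((\<lambda>s. ?y s t0) \<longlongrightarrow> ?y s0 t0) (nhds s0)" by (rule tendsto_of_pointwise_lipschitz[OF lip0])
    show "eventually (\<lambda>s. flow t0 (\<gamma> s) \<in> chart_dom c) (nhds s0)" using C by eventually_elim blast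
  qed
  from topological_tendstoD[OF this U(1) t0]
  have inU: "eventually (\<lambda>s. flow t0 (\<gamma> s) \<in> U) (nhds s0)" .
  obtain B where B: "B > 0" "\<And>x y t0 t. \<lbrakk>flow t0 x \<in> U; flow t0 y \<in> U; \<bar>t - t0\<bar> < \<epsilon>\<rbrakk> \<Longrightarrow>
     norm (chart_map c (flow t x) - chart_map c (flow t y)) \<le>
       B * norm (chart_map c (flow t0 x) - chart_map c (flow t0 y))"
    by (rule flow_box_lipschitz[OF c K(1,2) KR box]) blast+
  have lipt: "norm (?y s t - ?y s0 t) \<le> (B * C) * \<bar>s - s0\<bar>"
    if "flow t0 (\<gamma> s) \<in> U" "norm (?y s t0 - ?y s0 t0) \<le> C * \<bar>s - s0\<bar>" "\<bar>t - t0\<bar> < \<epsilon>" for s t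
  proof -
    have "norm (?y s t - ?y s0 t) \<le> B * norm (?y s t0 - ?y s0 t0)" by (rule B(2)[OF that(1) t0 that(3)])
    also have "\<dots> \<le> B * (C * \<bar>s - s0\<bar>)" using that(2) B(1) by (intro mult_left_mono) auto
    finally show ?thesis by (simp add: mult.assoc)
  qed
  have lip1: "eventually (\<lambda>s. flow t1 (\<gamma> s) \<in> chart_dom c \<and> norm (?y s t1 - ?y s0 t1) \<le> (B * C) * \<bar>s - s0\<bar>) (nhds s0)"
    using inU lip0 by eventually_elim (use box t1 lipt in blast)
  obtain M where M: "M > 0" "\<And>x v. x \<in> K \<Longrightarrow> norm (\<beta> c v (chart_inv c x)) \<le> M * norm v"
  proof (rule continuous_derivative_bounded[OF K(1), of "\<lambda>x v. \<beta> c v (chart_inv c x)"])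
    show "continuous_on K (\<lambda>x. \<beta> c v (chart_inv c x))" for v
      by (rule continuous_on_subset[OF form_continuous[OF c] K(3)])
    show "linear (\<lambda>v. \<beta> c v (chart_inv c x))" if "x \<in> K" for x
    proof -
      obtain p where p: "p \<in> N" "p \<in> chart_dom c" "x = chart_map c p" using K(3) \<open>x \<in> K\<close> by blast
      then show ?thesis using form_linear[OF c p(2,1)] c by simp
    qed
  qed blast
  define R where "R = (\<lambda>s. \<beta> c (?y s t1) (flow t1 ?x0) - \<beta> c (?y s t0) (flow t0 ?x0))"
  have inN: "flow t ?x0 \<in> chart_dom c" "flow t ?x0 \<in> N" "?y s0 t \<in> K" if "\<bar>t - t0\<bar> < \<epsilon>" for t
  proof -
    have *: "flow t ?x0 \<in> chart_dom c \<and> ?y s0 t \<in> K" by (rule box[OF t0 that])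
    then obtain p where p: "p \<in> N" "p \<in> chart_dom c" "?y s0 t = chart_map c p" using K(3) by blast
    then have "flow t ?x0 = p" using * c by (metis chart_inv_map)
    then show "flow t ?x0 \<in> chart_dom c" "flow t ?x0 \<in> N" "?y s0 t \<in> K" using p * by auto
  qed
  have "(R has_real_derivative 0) (at s0)"
  proof (rule has_real_derivative_zeroI)
    fix e :: real assume "e > 0"
    define C1 where "C1 = B * \<bar>C\<bar> + 1"
    \<comment> \<open>chosen such that the bounds for \<open>\<beta>\<close>, for the distance of the orbits and for the time multiply to \<open>e\<close>\<close>
    define e' where "e' = e / (M * C1 * \<epsilon>)"
    have C1: "C1 > 0" using B(1) by (simp add: C1_def add_nonneg_pos)
    have e': "e' > 0" using \<open>e > 0\<close> M(1) C1 \<epsilon> by (simp add: e'_def)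
    obtain \<delta> where \<delta>: "\<delta> > 0" "\<And>x y. \<lbrakk>x \<in> K; y \<in> K; norm (y - x) < \<delta>\<rbrakk> \<Longrightarrow>
       norm (coord_rep c V y - coord_rep c V x - frechet_derivative (coord_rep c V) (at x) (y - x)) \<le> e' * norm (y - x)"
    proof (rule C1_uniform_remainder[OF K(1,2) _ field_derivative_continuous[OF c KR] e'])
      show "(coord_rep c V has_derivative frechet_derivative (coord_rep c V) (at x)) (at x)" if "x \<in> K" for x
        using field_has_derivative[OF c] that KR by blast
    qed blast
    have "((\<lambda>s. C1 * \<bar>s - s0\<bar>) \<longlongrightarrow> C1 * \<bar>s0 - s0\<bar>) (nhds s0)"
      by (intro tendsto_intros filterlim_ident)
    then have "((\<lambda>s. C1 * \<bar>s - s0\<bar>) \<longlongrightarrow> 0) (nhds s0)" by simp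
    from order_tendstoD(2)[OF this \<delta>(1)]
    have "eventually (\<lambda>s. C1 * \<bar>s - s0\<bar> < \<delta>) (nhds s0)" .
    with inU lip0 show "eventually (\<lambda>s. \<bar>R s - R s0\<bar> \<le> e * \<bar>s - s0\<bar>) (nhds s0)"
    proof eventually_elim
      case (elim s)
      \<comment> \<open>the \<open>\<beta>\<close>-component of the difference of the two orbits, and its derivative in time\<close>
      define D where "D = (\<lambda>t. \<beta> c (?y s t - ?y s0 t) (flow t ?x0))"
      define D' where "D' = (\<lambda>t. \<beta> c (coord_rep c V (?y s t) - coord_rep c V (?y s0 t)
         - frechet_derivative (coord_rep c V) (at (?y s0 t)) (?y s t - ?y s0 t)) (flow t ?x0))"
      have near: "norm (?y s t - ?y s0 t) \<le> C1 * \<bar>s - s0\<bar>" if t: "\<bar>t - t0\<bar> < \<epsilon>" for t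
      proof -
        have "norm (?y s t - ?y s0 t) \<le> (B * C) * \<bar>s - s0\<bar>" by (rule lipt[OF elim(1,2) t])
        also have "\<dots> \<le> C1 * \<bar>s - s0\<bar>"
        proof (rule mult_right_mono)
          have "B * C \<le> B * \<bar>C\<bar>" using B(1) by (intro mult_left_mono) auto
          then show "B * C \<le> C1" by (simp add: C1_def)
        qed simp
        finally show ?thesis .
      qed
      have dD: "(D has_real_derivative D' t) (at t)" if t: "\<bar>t - t0\<bar> < \<epsilon>" for t
        unfolding D_def D'_def
      proof (rule form_derivative_along_flow[where z="\<lambda>t. flow t ?x0", OF c inN(1,2)[OF t] flow_integral])
        have "flow t (\<gamma> s) \<in> chart_dom c" using box[OF elim(1) t] by blast
        then show "((\<lambda>t. ?y s t - ?y s0 t) has_vector_derivative coord_rep c V (?y s t) - coord_rep c V (?y s0 t)) (at t)"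
          using integral_at_coord[OF flow_integral c] inN(1)[OF t]
          by (intro has_vector_derivative_diff) blast+
      qed
      have bD: "norm (D' t) \<le> M * (e' * (C1 * \<bar>s - s0\<bar>))" if t: "\<bar>t - t0\<bar> < \<epsilon>" for t
      proof -
        let ?w = "coord_rep c V (?y s t) - coord_rep c V (?y s0 t)
         - frechet_derivative (coord_rep c V) (at (?y s0 t)) (?y s t - ?y s0 t)"
        have "norm (D' t) \<le> M * norm ?w"
          using M(2)[OF inN(3)[OF t], of ?w] inN(1)[OF t] c by (simp add: D'_def)
        also have "norm ?w \<le> e' * norm (?y s t - ?y s0 t)"
          using near[OF t] elim(3) box[OF elim(1) t] by (intro \<delta>(2) inN(3) t) auto
        also have "\<dots> \<le> e' * (C1 * \<bar>s - s0\<bar>)" using near[OF t] e' by (intro mult_left_mono) auto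
        finally show ?thesis using M(1) by simp
      qed
      have "norm (D t1 - D t0) \<le> M * (e' * (C1 * \<bar>s - s0\<bar>)) * norm (t1 - t0)"
      proof (rule differentiable_bound[where S="{t0 - \<epsilon><..<t0 + \<epsilon>}" and f=D and f'="\<lambda>t h. D' t * h"])
        fix t assume "t \<in> {t0 - \<epsilon><..<t0 + \<epsilon>}"
        then have t: "\<bar>t - t0\<bar> < \<epsilon>" by (simp add: abs_less_iff)
        show "(D has_derivative (\<lambda>h. D' t * h)) (at t within {t0 - \<epsilon><..<t0 + \<epsilon>})"
          using dD[OF t] has_derivative_at_withinI unfolding has_field_derivative_def by blast
        show "onorm (\<lambda>h. D' t * h) \<le> M * (e' * (C1 * \<bar>s - s0\<bar>))"
          using bD[OF t] by (intro onorm_le) (auto simp: abs_mult intro: mult_right_mono)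
      qed (use t1 \<epsilon> in \<open>auto simp: abs_less_iff\<close>)
      also have "\<dots> \<le> M * (e' * (C1 * \<bar>s - s0\<bar>)) * \<epsilon>"
        using t1 M(1) e' C1 by (intro mult_left_mono) auto
      also have "\<dots> = e * \<bar>s - s0\<bar>" using M(1) C1 \<epsilon> by (simp add: e'_def field_simps)
      finally have "norm (D t1 - D t0) \<le> e * \<bar>s - s0\<bar>" .
      moreover have "R s - R s0 = D t1 - D t0"
        using linear_diff[OF form_linear[OF c inN(1,2)[OF t1]]] linear_diff[OF form_linear[OF c inN(1,2)]] \<epsilon>
        by (simp add: R_def D_def)
      ultimately show ?case by simp
    qed
  qed
  from DERIV_add[OF this a] have "((\<lambda>s. \<beta> c (?y s t1) (flow t1 ?x0)) has_real_derivative a) (at s0)"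
    by (simp add: R_def)
  with lip1 show ?thesis unfolding moves_at_def by blast
qed

lemma moves_at_flow:
  assumes c0: "c0 \<in> A" "\<gamma> s0 \<in> chart_dom c0" and N: "\<gamma> s0 \<in> N" and moves: "moves_at c0 \<gamma> s0 a"
  shows "\<exists>c\<in>A. flow t (\<gamma> s0) \<in> chart_dom c \<and> moves_at c (\<lambda>s. flow t (\<gamma> s)) s0 a"
proof (rule real_time_induct[where P="\<lambda>t. \<exists>c\<in>A. flow t (\<gamma> s0) \<in> chart_dom c \<and> moves_at c (\<lambda>s. flow t (\<gamma> s)) s0 a"])
  show "\<exists>c\<in>A. flow 0 (\<gamma> s0) \<in> chart_dom c \<and> moves_at c (\<lambda>s. flow 0 (\<gamma> s)) s0 a"
    using c0 moves by auto
  fix t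
  let ?p = "flow t (\<gamma> s0)"
  obtain c where c: "c \<in> A" "?p \<in> chart_dom c" by (rule chart_around)
  have "chart_map c ?p \<in> domN c" "domN c \<subseteq> chart_map c ` chart_dom c" using c N_flow[OF N] by auto
  then obtain K U \<epsilon> where K: "compact K" "convex K" "K \<subseteq> domN c"
    and U: "open U" "?p \<in> U" "U \<subseteq> chart_dom c" "\<epsilon> > 0"
    and box: "\<And>x t0 t. flow t0 x \<in> U \<Longrightarrow> \<bar>t - t0\<bar> < \<epsilon> \<Longrightarrow> flow t x \<in> chart_dom c \<and> chart_map c (flow t x) \<in> K"
    by (rule flow_box[OF c open_domN[OF c(1)]]) blast
  have "eventually (\<lambda>s. flow s (\<gamma> s0) \<in> U) (nhds t)"
    by (rule topological_tendstoD[OF flow_time_tendsto U(1,2)])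
  then obtain \<delta> where \<delta>: "\<delta> > 0" "\<And>s. \<bar>s - t\<bar> < \<delta> \<Longrightarrow> flow s (\<gamma> s0) \<in> U"
    unfolding eventually_nhds_metric dist_real_def by blast
  show "\<exists>\<delta>>0. \<forall>q r. \<bar>q - t\<bar> < \<delta> \<longrightarrow> \<bar>r - t\<bar> < \<delta> \<longrightarrow>
     (\<exists>c\<in>A. flow q (\<gamma> s0) \<in> chart_dom c \<and> moves_at c (\<lambda>s. flow q (\<gamma> s)) s0 a) \<longrightarrow>
     (\<exists>c\<in>A. flow r (\<gamma> s0) \<in> chart_dom c \<and> moves_at c (\<lambda>s. flow r (\<gamma> s)) s0 a)"
  proof (intro exI[of _ "min \<delta> (\<epsilon> / 2)"] conjI allI impI)
    fix q r
    assume q: "\<bar>q - t\<bar> < min \<delta> (\<epsilon> / 2)" and r: "\<bar>r - t\<bar> < min \<delta> (\<epsilon> / 2)"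
      and ex: "\<exists>c\<in>A. flow q (\<gamma> s0) \<in> chart_dom c \<and> moves_at c (\<lambda>s. flow q (\<gamma> s)) s0 a"
    then obtain d where d: "d \<in> A" "flow q (\<gamma> s0) \<in> chart_dom d" "moves_at d (\<lambda>s. flow q (\<gamma> s)) s0 a" by blast
    have qU: "flow q (\<gamma> s0) \<in> U" and rU: "flow r (\<gamma> s0) \<in> U" using q r \<delta>(2) by auto
    have "moves_at c (\<lambda>s. flow q (\<gamma> s)) s0 a"
      by (rule moves_at_change[OF d(1) _ c(1)]) (use d qU U(3) N_flow[OF N] in auto)
    moreover have "\<bar>r - q\<bar> < \<epsilon>" using q r by linarith
    ultimately have "moves_at c (\<lambda>s. flow r (\<gamma> s)) s0 a"
      by (intro moves_at_flow_step[where ?t0.0=q and ?t1.0=r and \<gamma>=\<gamma> and ?s0.0=s0 and a=a, OF c(1) K U(1,3) box qU])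
    then show "\<exists>c\<in>A. flow r (\<gamma> s0) \<in> chart_dom c \<and> moves_at c (\<lambda>s. flow r (\<gamma> s)) s0 a"
      using c(1) rU U(3) by blast
  qed (use \<delta> U in auto)
qed

text \<open>This is the transport equation \<open>w\<^sub>s = \<beta>(\<gamma>') w\<^sub>t\<close> for \<open>w(s, t) = f(\<phi>\<^sub>t(\<gamma>(s)))\<close>: the flow
  preserves the \<open>\<beta>\<close>-speed \<open>a\<close>, and \<open>df = b \<beta>\<close>.\<close>

lemma f_flow_curve_derivative:
  assumes "c0 \<in> A" "\<gamma> s0 \<in> chart_dom c0" and N: "\<gamma> s0 \<in> N" and "moves_at c0 \<gamma> s0 a"
  shows "((\<lambda>s. f (flow t (\<gamma> s))) has_real_derivative b (flow t (\<gamma> s0)) * a) (at s0)"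
proof -
  obtain c where "c \<in> A" "flow t (\<gamma> s0) \<in> chart_dom c" "moves_at c (\<lambda>s. flow t (\<gamma> s)) s0 a"
    using moves_at_flow[OF assms] by blast
  then show ?thesis using moves_at_f[of c "\<lambda>s. flow t (\<gamma> s)"] N_flow[OF N] by blast
qed

lemma f_flow_time_derivative:
  assumes N: "x \<in> N"
  shows "((\<lambda>t. f (flow t x)) has_real_derivative b (flow t x)) (at t)"
proof -
  obtain c where c: "c \<in> A" "flow t x \<in> chart_dom c" by (rule chart_around)
  note cN = c N_flow[OF N]
  have "((\<lambda>s. chart_map c (flow s x)) has_derivative (\<lambda>h. h *\<^sub>R V (flow t x) c)) (at t)"
    using flow_integral[of x t] c unfolding integral_at_def has_vector_derivative_def by blast
  from has_derivative_compose[OF this f_derivative[OF cN]]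
  have "((\<lambda>s. (f \<circ> chart_inv c) (chart_map c (flow s x))) has_derivative (\<lambda>h. b (flow t x) * \<beta> c (h *\<^sub>R V (flow t x) c) (flow t x))) (at t)" .
  then have "((\<lambda>s. (f \<circ> chart_inv c) (chart_map c (flow s x))) has_real_derivative b (flow t x)) (at t)"
    by (simp add: has_field_derivative_def linear_cmul[OF form_linear[OF cN]] form_field[OF cN])
  moreover have "eventually (\<lambda>s. flow s x \<in> chart_dom c) (nhds t)"
    by (rule topological_tendstoD[OF flow_time_tendsto open_chart_dom[OF c(1)] c(2)])
  then have "eventually (\<lambda>s. (f \<circ> chart_inv c) (chart_map c (flow s x)) = f (flow s x)) (nhds t)"
    by eventually_elim (use c in simp)
  ultimately show ?thesis by (rule has_field_derivative_eventually_eq)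
qed

end

section \<open>Curves traded for time\<close>

text \<open>The average of an affine function over a segment is its value at the midpoint. Applied to the
  sides of a small triangle this replaces Stokes' theorem.\<close>

lemma segment_average_derivative:
  fixes F :: "'e::real_normed_vector \<Rightarrow> real"
  assumes D: "(F has_derivative F') (at x)" and S: "open S" "x \<in> S" "continuous_on S F"
  shows "((\<lambda>h. (integral {0..1} (\<lambda>s. F (x + h *\<^sub>R (p + s *\<^sub>R w))) - F x) / h) \<longlongrightarrow> F' (p + (1/2) *\<^sub>R w)) (at_right 0)"
proof (rule tendstoI)
  fix e :: real assume "e > 0"
  define n where "n = norm p + norm w + 1"
  have n: "n > 0" by (simp add: n_def add_nonneg_pos)
  have e': "e / (2 * n) > 0" using \<open>e > 0\<close> n by simp
  obtain d where d: "d > 0"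
    "\<And>y. norm (y - x) < d \<Longrightarrow> norm (F y - F x - F' (y - x)) \<le> e / (2 * n) * norm (y - x)"
    using D e' unfolding has_derivative_at_alt by blast
  obtain r where r: "r > 0" "ball x r \<subseteq> S" using S open_contains_ball by blast
  define h0 where "h0 = min d r / n"
  have h0: "h0 > 0" using d(1) r(1) n by (simp add: h0_def)
  have "dist ((integral {0..1} (\<lambda>s. F (x + h *\<^sub>R (p + s *\<^sub>R w))) - F x) / h) (F' (p + (1/2) *\<^sub>R w)) < e"
    if h: "0 < h" "h < h0" for h
  proof -
    let ?y = "\<lambda>s. x + h *\<^sub>R (p + s *\<^sub>R w)"
    have hn: "h * n < d" "h * n < r" using h n by (auto simp: h0_def field_simps)
    have ny: "norm (?y s - x) \<le> h * n" if "0 \<le> s" "s \<le> 1" for s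
    proof -
      have "norm (p + s *\<^sub>R w) \<le> norm p + s * norm w" using norm_triangle_ineq[of p "s *\<^sub>R w"] that by simp
      also have "\<dots> \<le> n" using that mult_right_mono[of s 1 "norm w"] by (simp add: n_def)
      finally show ?thesis using h by simp
    qed
    have inS: "?y s \<in> S" if "0 \<le> s" "s \<le> 1" for s
      using ny[OF that] hn(2) r(2) by (auto simp: subset_iff dist_norm norm_minus_commute)
    have cont: "continuous_on {0..1} (\<lambda>s. F (?y s))"
      by (rule continuous_on_compose2[OF S(3)]) (use inS in \<open>auto intro!: continuous_intros\<close>)
    let ?L = "\<lambda>s. (F x + h * F' p) + s * (h * F' w)"
    have contL: "continuous_on {0..1} ?L" by (intro continuous_intros)
    have intL: "integral {0..1} ?L = F x + h * F' (p + (1/2) *\<^sub>R w)"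
    proof -
      have lin: "((\<lambda>s::real. s * (h * F' w)) has_integral ((1\<^sup>2 - 0\<^sup>2) / 2) * (h * F' w)) {0..1}"
        by (intro has_integral_mult_left ident_has_integral) simp
      have const: "((\<lambda>s::real. F x + h * F' p) has_integral (F x + h * F' p)) {0..1}"
        using has_integral_const_real[of "F x + h * F' p" 0 1] by simp
      from integral_unique[OF has_integral_add[OF const lin]] show ?thesis
        using linear_add[OF has_derivative_linear[OF D], of p "(1/2) *\<^sub>R w"] linear_cmul[OF has_derivative_linear[OF D], of "1/2" w]
        by (simp add: algebra_simps)
    qed
    have "norm (integral {0..1} (\<lambda>s. F (?y s) - ?L s)) \<le> (e / (2 * n) * (h * n)) * (1 - 0)"
    proof (rule integral_bound)
      show "continuous_on {0..1} (\<lambda>s. F (?y s) - ?L s)" by (intro continuous_on_diff cont contL)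
      fix s :: real assume "s \<in> {0..1}"
      then have s: "0 \<le> s" "s \<le> 1" by auto
      have "F' (?y s - x) = h * F' p + s * (h * F' w)"
        using linear_add[OF has_derivative_linear[OF D]] linear_cmul[OF has_derivative_linear[OF D]]
        by (simp add: algebra_simps)
      then have "norm (F (?y s) - ?L s) = norm (F (?y s) - F x - F' (?y s - x))" by (simp add: algebra_simps)
      also have "\<dots> \<le> e / (2 * n) * norm (?y s - x)"
        using ny[OF s] hn(1) by (intro d(2)) linarith
      also have "\<dots> \<le> e / (2 * n) * (h * n)" using ny[OF s] e' by (intro mult_left_mono) auto
      finally show "norm (F (?y s) - ?L s) \<le> e / (2 * n) * (h * n)" .
    qed simp
    also have "integral {0..1} (\<lambda>s. F (?y s) - ?L s) = integral {0..1} (\<lambda>s. F (?y s)) - integral {0..1} ?L"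
      by (intro integral_diff integrable_continuous_real cont contL)
    also have "\<dots> = (integral {0..1} (\<lambda>s. F (?y s)) - F x) - h * F' (p + (1/2) *\<^sub>R w)"
      unfolding intL by simp
    also have "(e / (2 * n) * (h * n)) * (1 - 0) = e / 2 * h" using n by simp
    finally have "\<bar>(integral {0..1} (\<lambda>s. F (?y s)) - F x) - h * F' (p + (1/2) *\<^sub>R w)\<bar> \<le> e / 2 * h"
      by simp
    then have "\<bar>((integral {0..1} (\<lambda>s. F (?y s)) - F x) - h * F' (p + (1/2) *\<^sub>R w)) / h\<bar> \<le> e / 2"
      using h by (simp add: pos_divide_le_eq)
    moreover have "((integral {0..1} (\<lambda>s. F (?y s)) - F x) - h * F' (p + (1/2) *\<^sub>R w)) / h
        = (integral {0..1} (\<lambda>s. F (?y s)) - F x) / h - F' (p + (1/2) *\<^sub>R w)"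
      using h by (simp add: diff_divide_distrib)
    ultimately show ?thesis using \<open>e > 0\<close> by (simp add: dist_real_def)
  qed
  then show "eventually (\<lambda>h. dist ((integral {0..1} (\<lambda>s. F (x + h *\<^sub>R (p + s *\<^sub>R w))) - F x) / h) (F' (p + (1/2) *\<^sub>R w)) < e) (at_right 0)"
    using h0 unfolding eventually_at_right_field by blast
qed

text \<open>The difference quotients with the periods as increments vanish, and they converge to the
  derivative.\<close>

lemma arbitrarily_small_periods_imp_constant:
  fixes m :: "real \<Rightarrow> real"
  assumes deriv: "\<And>t. (m has_real_derivative m' t) (at t)"
    and period: "eventually (\<lambda>h. \<forall>t. m (t + \<epsilon> h) = m t) G"
    and \<epsilon>: "filterlim \<epsilon> (at 0) G" and "G \<noteq> bot"
  shows "m t = m 0"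
proof -
  have "m' t = 0" for t
  proof -
    have "((\<lambda>h. (m (t + h) - m t) / h) \<longlongrightarrow> m' t) (at 0)" using deriv by (simp add: DERIV_def)
    from filterlim_compose[OF this \<epsilon>]
    have lim: "((\<lambda>h. (m (t + \<epsilon> h) - m t) / \<epsilon> h) \<longlongrightarrow> m' t) G" .
    have "eventually (\<lambda>h. (m (t + \<epsilon> h) - m t) / \<epsilon> h = 0) G"
      using period by eventually_elim simp
    from Lim_transform_eventually[OF lim this] have "((\<lambda>h. 0) \<longlongrightarrow> m' t) G" .
    then show ?thesis using tendsto_unique[OF \<open>G \<noteq> bot\<close> _ tendsto_const] by blast
  qed
  then show ?thesis using DERIV_isconst_all[of m t 0] deriv by simp
qed

context flow_invariant_form
begin

lemma domN_inv:
  assumes "c \<in> A" "x \<in> domN c"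
  shows "chart_inv c x \<in> N" "chart_inv c x \<in> chart_dom c" "chart_map c (chart_inv c x) = x"
proof -
  obtain p where "p \<in> N" "p \<in> chart_dom c" "x = chart_map c p" using assms(2) by blast
  then show "chart_inv c x \<in> N" "chart_inv c x \<in> chart_dom c" "chart_map c (chart_inv c x) = x"
    using assms(1) by simp_all
qed

lemma moves_at_segment:
  assumes c: "c \<in> A" and x: "x + s0 *\<^sub>R v \<in> domN c"
  shows "moves_at c (\<lambda>s. chart_inv c (x + s *\<^sub>R v)) s0 (\<beta> c v (chart_inv c (x + s0 *\<^sub>R v)))"
proof -
  let ?p = "chart_inv c (x + s0 *\<^sub>R v)"
  note p = domN_inv[OF c x]
  have "((\<lambda>s. x + s *\<^sub>R v) \<longlongrightarrow> x + s0 *\<^sub>R v) (nhds s0)" by (intro tendsto_intros filterlim_ident)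
  from topological_tendstoD[OF this open_domN[OF c] x]
  have ev: "eventually (\<lambda>s. x + s *\<^sub>R v \<in> domN c) (nhds s0)" .
  have "eventually (\<lambda>s. chart_inv c (x + s *\<^sub>R v) \<in> chart_dom c \<and>
     norm (chart_map c (chart_inv c (x + s *\<^sub>R v)) - chart_map c ?p) \<le> norm v * \<bar>s - s0\<bar>) (nhds s0)"
    using ev
  proof eventually_elim
    case (elim s)
    have "(x + s *\<^sub>R v) - (x + s0 *\<^sub>R v) = (s - s0) *\<^sub>R v" by (simp add: algebra_simps)
    then show ?case using domN_inv[OF c elim] p by (simp add: mult.commute)
  qed
  moreover have "((\<lambda>s. \<beta> c (chart_map c (chart_inv c (x + s *\<^sub>R v))) ?p) has_real_derivative \<beta> c v ?p) (at s0)"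
  proof (rule has_field_derivative_eventually_eq)
    show "((\<lambda>s. \<beta> c x ?p + s * \<beta> c v ?p) has_real_derivative \<beta> c v ?p) (at s0)"
      by (auto intro!: derivative_eq_intros)
    show "eventually (\<lambda>s. \<beta> c x ?p + s * \<beta> c v ?p = \<beta> c (chart_map c (chart_inv c (x + s *\<^sub>R v))) ?p) (nhds s0)"
      using ev
    proof eventually_elim
      case (elim s)
      then show ?case
        using domN_inv[OF c elim] linear_add[OF form_linear[OF c p(2,1)]] linear_cmul[OF form_linear[OF c p(2,1)]] by simp
    qed
  qed
  ultimately show ?thesis unfolding moves_at_def by blast
qed

definition segment_form :: "('a, 'e) chart \<Rightarrow> 'e \<Rightarrow> 'e \<Rightarrow> real" where
  "segment_form c x v = integral {0..1} (\<lambda>s. \<beta> c v (chart_inv c (x + s *\<^sub>R v)))"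

text \<open>Along the characteristic \<open>s \<mapsto> (s, \<tau>(s))\<close> with \<open>\<tau>' = - \<beta>(\<gamma>')\<close> the transport equation makes
  \<open>w(s, t) = f(\<phi>\<^sub>t(\<gamma>(s)))\<close> constant.\<close>

lemma f_along_segment:
  assumes c: "c \<in> A" and seg: "\<And>s. 0 \<le> s \<Longrightarrow> s \<le> 1 \<Longrightarrow> x + s *\<^sub>R v \<in> domN c"
  shows "f (flow t (chart_inv c (x + v))) = f (flow (t + segment_form c x v) (chart_inv c x))"
proof -
  define \<gamma> where "\<gamma> = (\<lambda>s. chart_inv c (x + s *\<^sub>R v))"
  define \<alpha> where "\<alpha> = (\<lambda>s. \<beta> c v (\<gamma> s))"
  define w where "w = (\<lambda>s t. f (flow t (\<gamma> s)))"
  define T where "T = t + segment_form c x v"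
  \<comment> \<open>the characteristic that ends at \<open>(1, t)\<close>\<close>
  define \<tau> where "\<tau> = (\<lambda>s. T - integral {0..s} \<alpha>)"
  let ?I = "{0..1::real}"
  have \<gamma>N: "\<gamma> s \<in> N" "\<gamma> s \<in> chart_dom c" if "s \<in> ?I" for s
    using domN_inv[OF c seg] that by (auto simp: \<gamma>_def)
  have \<alpha>_cont: "continuous_on ?I \<alpha>"
    unfolding \<alpha>_def \<gamma>_def
    by (rule continuous_on_compose2[OF form_continuous[OF c, of v]]) (use seg in \<open>auto intro!: continuous_intros\<close>)
  have ws: "((\<lambda>s. w s t) has_derivative (\<lambda>h. (b (flow t (\<gamma> s)) * \<alpha> s) * h)) (at s within ?I)" if s: "s \<in> ?I" for s t
  proof -
    have "moves_at c \<gamma> s (\<alpha> s)"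
      unfolding \<gamma>_def \<alpha>_def by (rule moves_at_segment[OF c seg]) (use s in auto)
    from f_flow_curve_derivative[where \<gamma>=\<gamma>, OF c \<gamma>N(2)[OF s] \<gamma>N(1)[OF s] this, of t]
    show ?thesis unfolding w_def has_field_derivative_def by (rule has_derivative_at_withinI)
  qed
  have wt: "((\<lambda>t. w s t) has_derivative blinfun_apply (blinfun_scaleR_left (b (flow t (\<gamma> s))))) (at t within UNIV)"
    if s: "s \<in> ?I" for s t
  proof -
    have "(*) (b (flow t (\<gamma> s))) = blinfun_apply (blinfun_scaleR_left (b (flow t (\<gamma> s))))"
      by (simp add: fun_eq_iff)
    then show ?thesis
      using f_flow_time_derivative[OF \<gamma>N(1)[OF s], of t] unfolding has_field_derivative_def w_def by simp
  qed
  have b_lim: "((\<lambda>z. b (flow (snd z) (\<gamma> (fst z)))) \<longlongrightarrow> b (flow t (\<gamma> s))) (at (s, t) within ?I \<times> UNIV)"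
    if s: "s \<in> ?I" for s t
  proof -
    let ?F = "at (s, t) within ?I \<times> (UNIV :: real set)"
    have F: "filterlim fst (nhds s) ?F" "filterlim snd (nhds t) ?F"
      by (auto intro!: tendsto_eq_intros)
    have "(\<gamma> \<longlongrightarrow> \<gamma> s) (nhds s)"
      unfolding \<gamma>_def
    proof (rule filterlim_compose[OF chart_inv_tendsto])
      show "x + s *\<^sub>R v \<in> chart_map c ` chart_dom c" using seg[of s] s by auto
      show "((\<lambda>s. x + s *\<^sub>R v) \<longlongrightarrow> x + s *\<^sub>R v) (nhds s)" by (intro tendsto_intros filterlim_ident)
    qed (rule c)
    then have "filterlim (\<lambda>z. (snd z, \<gamma> (fst z))) (nhds t \<times>\<^sub>F nhds (\<gamma> s)) ?F"
      using F by (intro filterlim_Pair) (auto intro: filterlim_compose)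
    from filterlim_compose[OF flow_tendsto this]
    have lim: "((\<lambda>z. flow (snd z) (\<gamma> (fst z))) \<longlongrightarrow> flow t (\<gamma> s)) ?F" by simp
    have "isCont b (flow t (\<gamma> s))"
      using b_continuous N_open N_flow[OF \<gamma>N(1)[OF s]] continuous_on_eq_continuous_at by blast
    then have "(b \<longlongrightarrow> b (flow t (\<gamma> s))) (nhds (flow t (\<gamma> s)))"
      by (simp add: isCont_def tendsto_at_iff_tendsto_nhds)
    from filterlim_compose[OF this lim] show ?thesis .
  qed
  \<comment> \<open>one partial derivative is continuous, so \<open>w\<close> is totally differentiable\<close>
  have w2: "((\<lambda>(s, t). w s t) has_derivative
      (\<lambda>(h, k). (b (flow t (\<gamma> s)) * \<alpha> s) * h + blinfun_apply (blinfun_scaleR_left (b (flow t (\<gamma> s)))) k))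
      (at (s, t) within ?I \<times> UNIV)" if s: "s \<in> ?I" for s t
  proof (rule has_derivative_partialsI[where fy="\<lambda>s t. blinfun_scaleR_left (b (flow t (\<gamma> s)))"])
    show "((\<lambda>s. w s t) has_derivative (\<lambda>h. (b (flow t (\<gamma> s)) * \<alpha> s) * h)) (at s within ?I)" by (rule ws[OF s])
    show "((\<lambda>t. w s t) has_derivative blinfun_apply (blinfun_scaleR_left (b (flow t (\<gamma> s))))) (at t within UNIV)"
      if "s \<in> ?I" for s t by (rule wt[OF that])
    show "continuous (at (s, t) within ?I \<times> UNIV) (\<lambda>(s, t). blinfun_scaleR_left (b (flow t (\<gamma> s))))"
      unfolding continuous_within
      using bounded_linear.tendsto[OF bounded_linear_blinfun_scaleR_left b_lim[OF s, of t]]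
      by (simp add: case_prod_beta')
  qed auto
  have d\<tau>: "(\<tau> has_derivative (\<lambda>h. - (h * \<alpha> s))) (at s within ?I)" if s: "s \<in> ?I" for s
    using integral_has_vector_derivative[OF \<alpha>_cont s] unfolding \<tau>_def has_vector_derivative_def
    by (auto intro!: derivative_eq_intros)
  have "((\<lambda>s. w s (\<tau> s)) has_derivative (\<lambda>h. 0)) (at s within ?I)" if s: "s \<in> ?I" for s
  proof -
    have "((\<lambda>s. (s, \<tau> s)) has_derivative (\<lambda>h. (h, - (h * \<alpha> s)))) (at s within ?I)"
      by (intro has_derivative_Pair has_derivative_ident d\<tau>[OF s])
    moreover have "((\<lambda>(s, t). w s t) has_derivative
      (\<lambda>(h, k). (b (flow (\<tau> s) (\<gamma> s)) * \<alpha> s) * h + blinfun_apply (blinfun_scaleR_left (b (flow (\<tau> s) (\<gamma> s)))) k))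
      (at (s, \<tau> s) within (\<lambda>s. (s, \<tau> s)) ` ?I)"
      by (rule has_derivative_subset[OF w2[OF s]]) auto
    ultimately show ?thesis
      using has_derivative_in_compose by (fastforce simp: algebra_simps)
  qed
  from has_derivative_zero_constant[OF convex_real_interval(5) this]
  obtain k where "\<And>s. s \<in> ?I \<Longrightarrow> w s (\<tau> s) = k" by blast
  from this[of 0] this[of 1] have "w 1 (\<tau> 1) = w 0 (\<tau> 0)" by simp
  then show ?thesis
    by (simp add: w_def \<tau>_def \<gamma>_def T_def segment_form_def \<alpha>_def)
qed

lemma segment_form_scale:
  assumes c: "c \<in> A" and seg: "\<And>s. 0 \<le> s \<Longrightarrow> s \<le> 1 \<Longrightarrow> x + s *\<^sub>R (h *\<^sub>R v) \<in> domN c"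
  shows "segment_form c x (h *\<^sub>R v) = h * integral {0..1} (\<lambda>s. \<beta> c v (chart_inv c (x + s *\<^sub>R (h *\<^sub>R v))))"
proof -
  have "segment_form c x (h *\<^sub>R v) = integral {0..1} (\<lambda>s. h * \<beta> c v (chart_inv c (x + s *\<^sub>R (h *\<^sub>R v))))"
    unfolding segment_form_def
  proof (rule integral_cong)
    fix s :: real assume "s \<in> {0..1}"
    then have "x + s *\<^sub>R (h *\<^sub>R v) \<in> domN c" using seg by auto
    from linear_cmul[OF form_linear[OF c domN_inv(2,1)[OF c this]], of h v]
    show "\<beta> c (h *\<^sub>R v) (chart_inv c (x + s *\<^sub>R (h *\<^sub>R v))) = h * \<beta> c v (chart_inv c (x + s *\<^sub>R (h *\<^sub>R v)))" by simp
  qed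
  then show ?thesis by simp
qed

text \<open>The boundary of the triangle with vertices \<open>x\<close>, \<open>x + h u\<close>, \<open>x + h v\<close> has \<open>\<beta>\<close>-integral
  \<open>\<epsilon>(h) = h\<^sup>2 d\<beta>(u, v) / 2 + o(h\<^sup>2)\<close>. Running along the two ways from \<open>x\<close> to \<open>x + h v\<close> shows
  that \<open>\<epsilon>(h)\<close> is a period of \<open>t \<mapsto> f(\<phi>\<^sub>t(q))\<close>.\<close>

lemma f_constant_on_orbit:
  assumes c: "c \<in> A" "q \<in> chart_dom c" and N: "q \<in> N"
    and curv: "coord_deriv c (\<beta> c v) q u \<noteq>
      coord_deriv c (\<beta> c u) q v"
  shows "f (flow t q) = f q"
proof -
  let ?x = "chart_map c q"
  let ?F = "\<lambda>w y. \<beta> c w (chart_inv c y)"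
  let ?D = "\<lambda>w. frechet_derivative (\<beta> c w \<circ> chart_inv c) (at ?x)"
  let ?av = "\<lambda>w p k h. integral {0..1} (\<lambda>s. ?F w (?x + h *\<^sub>R (p + s *\<^sub>R k)))"
  define \<epsilon> where "\<epsilon> = (\<lambda>h. segment_form c ?x (h *\<^sub>R u) + segment_form c (?x + h *\<^sub>R u) (h *\<^sub>R (v - u))
     - segment_form c ?x (h *\<^sub>R v))"
  have x: "?x \<in> domN c" using c N by blast
  have DF: "(?F w has_derivative ?D w) (at ?x)" for w
    using form_derivative[OF c N, of w] by (simp add: o_def)
  \<comment> \<open>the values at \<open>x\<close> cancel around the triangle\<close>
  have Fdiff: "?F (v - u) y = ?F v y - ?F u y" if "y \<in> domN c" for y
    by (rule linear_diff[OF form_linear[OF c(1) domN_inv(2,1)[OF c(1) that]]])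
  have "((\<lambda>y. ?F v y - ?F u y) has_derivative (\<lambda>y. ?D v y - ?D u y)) (at ?x)"
    by (intro has_derivative_diff DF)
  then have "(?F (v - u) has_derivative (\<lambda>y. ?D v y - ?D u y)) (at ?x)"
    by (rule has_derivative_transform_within_open[OF _ open_domN[OF c(1)] x]) (simp add: Fdiff)
  from fun_cong[OF has_derivative_unique[OF DF this]]
  have Ddiff: "?D (v - u) y = ?D v y - ?D u y" for y .
  note av = segment_average_derivative[OF DF open_domN[OF c(1)] x form_continuous[OF c(1)]]
  \<comment> \<open>the average over each side, compared with the value at \<open>x\<close>, tends to the derivative at the midpoint of the side\<close>
  have lim0: "((\<lambda>h. (?av u 0 u h - ?F u ?x) / h + (?av (v - u) u (v - u) h - ?F (v - u) ?x) / h - (?av v 0 v h - ?F v ?x) / h)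
     \<longlongrightarrow> ?D u (0 + (1/2) *\<^sub>R u) + ?D (v - u) (u + (1/2) *\<^sub>R (v - u)) - ?D v (0 + (1/2) *\<^sub>R v)) (at_right 0)"
    by (intro tendsto_diff tendsto_add av)
  have val: "?D u (0 + (1/2) *\<^sub>R u) + ?D (v - u) (u + (1/2) *\<^sub>R (v - u)) - ?D v (0 + (1/2) *\<^sub>R v)
     = (?D v u - ?D u v) / 2"
    by (simp add: Ddiff linear_add[OF has_derivative_linear[OF DF]] linear_diff[OF has_derivative_linear[OF DF]]
        linear_cmul[OF has_derivative_linear[OF DF]]) (simp add: field_simps)
  from lim0[unfolded val] have lim: "((\<lambda>h. (?av u 0 u h - ?F u ?x) / h + (?av (v - u) u (v - u) h - ?F (v - u) ?x) / h
     - (?av v 0 v h - ?F v ?x) / h) \<longlongrightarrow> (?D v u - ?D u v) / 2) (at_right 0)" .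
  obtain r where r: "r > 0" "ball ?x r \<subseteq> domN c" using open_domN[OF c(1)] x open_contains_ball by blast
  define h0 where "h0 = r / (norm u + norm v + 1)"
  have n: "norm u + norm v + 1 > 0" by (simp add: add_nonneg_pos)
  have h0: "h0 > 0" using r n by (simp add: h0_def)
  have tri: "?x + h *\<^sub>R (a *\<^sub>R u + b *\<^sub>R v) \<in> domN c" if h: "0 < h" "h < h0" and ab: "0 \<le> a" "a \<le> 1" "0 \<le> b" "b \<le> 1" for h a b
  proof -
    have "norm (a *\<^sub>R u + b *\<^sub>R v) \<le> a * norm u + b * norm v"
      using norm_triangle_ineq[of "a *\<^sub>R u" "b *\<^sub>R v"] ab by simp
    also have "\<dots> \<le> norm u + norm v"
      using mult_right_mono[of a 1 "norm u"] mult_right_mono[of b 1 "norm v"] ab by simp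
    finally have "norm (h *\<^sub>R (a *\<^sub>R u + b *\<^sub>R v)) \<le> h * (norm u + norm v + 1)"
      using h by (simp add: mult_left_mono)
    also have "\<dots> < r" using h n by (simp add: h0_def pos_less_divide_eq)
    finally show ?thesis using r(2) by (auto simp: dist_norm subset_iff)
  qed
  have seg1: "?x + s *\<^sub>R (h *\<^sub>R u) \<in> domN c" and seg3: "?x + s *\<^sub>R (h *\<^sub>R v) \<in> domN c"
    and seg2: "?x + h *\<^sub>R u + s *\<^sub>R (h *\<^sub>R (v - u)) \<in> domN c"
    if h: "0 < h" "h < h0" and s: "0 \<le> s" "s \<le> 1" for h s
    using tri[OF h, of s 0] tri[OF h, of 0 s] tri[OF h, of "1 - s" s] s by (simp_all add: algebra_simps)
  have near: "eventually (\<lambda>h. 0 < h \<and> h < h0) (at_right 0)"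
    using h0 unfolding eventually_at_right_field by blast
  have "eventually (\<lambda>h. (?av u 0 u h - ?F u ?x) / h + (?av (v - u) u (v - u) h - ?F (v - u) ?x) / h
     - (?av v 0 v h - ?F v ?x) / h = \<epsilon> h / h\<^sup>2) (at_right 0)"
    using near
  proof eventually_elim
    case (elim h)
    then have h: "0 < h" "h < h0" by auto
    have "segment_form c ?x (h *\<^sub>R u) = h * ?av u 0 u h" "segment_form c ?x (h *\<^sub>R v) = h * ?av v 0 v h"
      using segment_form_scale[OF c(1) seg1[OF h]] segment_form_scale[OF c(1) seg3[OF h]] by (simp_all add: mult.commute)
    moreover have "segment_form c (?x + h *\<^sub>R u) (h *\<^sub>R (v - u)) = h * ?av (v - u) u (v - u) h"
      using segment_form_scale[OF c(1) seg2[OF h]]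
      by (simp add: scaleR_add_right add.assoc mult.commute)
    moreover have alg: "(a - fu) / h + (b' - (fv - fu)) / h - (d - fv) / h = (h * a + h * b' - h * d) / h\<^sup>2"
      for a b' d fu fv :: real
      using h by (simp add: field_simps power2_eq_square)
    ultimately show ?case
      unfolding \<epsilon>_def Fdiff[OF x] by (simp only: alg)
  qed
  from Lim_transform_eventually[OF lim this]
  have lim2: "((\<lambda>h. \<epsilon> h / h\<^sup>2) \<longlongrightarrow> (?D v u - ?D u v) / 2) (at_right 0)" .
  have h2: "((\<lambda>h::real. h\<^sup>2) \<longlongrightarrow> 0) (at_right 0)"
    by (auto intro!: tendsto_eq_intros)
  have "((\<lambda>h. \<epsilon> h / h\<^sup>2 * h\<^sup>2) \<longlongrightarrow> 0) (at_right 0)"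
    using tendsto_mult[OF lim2 h2] by simp
  moreover have "eventually (\<lambda>h. \<epsilon> h / h\<^sup>2 * h\<^sup>2 = \<epsilon> h) (at_right 0)"
    using near by eventually_elim simp
  ultimately have "(\<epsilon> \<longlongrightarrow> 0) (at_right 0)" by (rule Lim_transform_eventually)
  moreover have "(?D v u - ?D u v) / 2 \<noteq> 0" using curv by simp
  from tendsto_imp_eventually_ne[OF lim2 this]
  have "eventually (\<lambda>h. \<epsilon> h \<noteq> 0) (at_right 0)" by eventually_elim auto
  ultimately have \<epsilon>: "filterlim \<epsilon> (at 0) (at_right 0)" by (intro filterlim_atI)
  have "eventually (\<lambda>h. \<forall>t. f (flow (t + \<epsilon> h) q) = f (flow t q)) (at_right 0)"
    using near
  proof eventually_elim
    case (elim h)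
    then have h: "0 < h" "h < h0" by auto
    show ?case
    proof
      fix t
      let ?t = "t - segment_form c ?x (h *\<^sub>R v)"
      have "f (flow ?t (chart_inv c (?x + h *\<^sub>R v))) = f (flow t q)"
        using f_along_segment[OF c(1) seg3[OF h], of ?t] c by simp
      moreover have "f (flow ?t (chart_inv c (?x + h *\<^sub>R v)))
        = f (flow (?t + segment_form c (?x + h *\<^sub>R u) (h *\<^sub>R (v - u))) (chart_inv c (?x + h *\<^sub>R u)))"
        using f_along_segment[OF c(1) seg2[OF h], of ?t] by (simp add: algebra_simps)
      moreover have "\<dots> = f (flow (t + \<epsilon> h) q)"
        using f_along_segment[OF c(1) seg1[OF h], of "?t + segment_form c (?x + h *\<^sub>R u) (h *\<^sub>R (v - u))"] c
        by (simp add: \<epsilon>_def algebra_simps)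
      ultimately show "f (flow (t + \<epsilon> h) q) = f (flow t q)" by simp
    qed
  qed
  from arbitrarily_small_periods_imp_constant[OF f_flow_time_derivative[OF N] this \<epsilon>, of t]
  show ?thesis by simp
qed

text \<open>The points whose entire orbit lies in the level set of \<open>q\<close> form a closed set, and an open one
  because a neighbour can be reached by a segment, which only shifts the time.\<close>

lemma f_globally_constant:
  assumes conn: "connected (UNIV :: 'a set)" and f_cont: "continuous_on UNIV f"
    and level: "\<And>x. f x = f q \<Longrightarrow> x \<in> N" and orbit: "\<And>t. f (flow t q) = f q"
  shows "f x = f q"
proof -
  define S where "S = {x. \<forall>t. f (flow t x) = f q}"
  have "closed S"
  proof -
    have "continuous_on UNIV (flow t)" for t
      using flow_space_tendsto[of t] by (simp add: continuous_on_eq_continuous_at isCont_def tendsto_at_iff_tendsto_nhds)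
    then have "closed {x. f (flow t x) = f q}" for t
      using continuous_on_compose2[OF f_cont] by (intro closed_Collect_eq) auto
    then have "closed (\<Inter>t. {x. f (flow t x) = f q})" by blast
    moreover have "S = (\<Inter>t. {x. f (flow t x) = f q})" unfolding S_def by blast
    ultimately show ?thesis by simp
  qed
  moreover have "open S"
  proof (subst open_subopen, rule ballI)
    fix x assume "x \<in> S"
    then have x: "\<And>t. f (flow t x) = f q" by (simp add: S_def)
    have xN: "x \<in> N" using level x[of 0] by simp
    obtain c where c: "c \<in> A" "x \<in> chart_dom c" by (rule chart_around)
    then obtain r where r: "r > 0" "ball (chart_map c x) r \<subseteq> domN c"
      using open_domN[OF c(1)] xN open_contains_ball by blast
    let ?U = "chart_dom c \<inter> chart_map c -` ball (chart_map c x) r"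
    have "open ?U"
      using continuous_open_preimage[OF continuous_chart_map open_chart_dom open_ball] c(1) by blast
    moreover have "x \<in> ?U" using c r by simp
    moreover have "?U \<subseteq> S"
    proof
      fix y assume y: "y \<in> ?U"
      let ?v = "chart_map c y - chart_map c x"
      have seg: "chart_map c x + s *\<^sub>R ?v \<in> domN c" if "0 \<le> s" "s \<le> 1" for s
      proof -
        have "norm (s *\<^sub>R ?v) \<le> 1 * norm ?v" using that by (simp add: mult_left_le_one_le)
        also have "\<dots> < r" using y by (simp add: dist_norm norm_minus_commute)
        finally show ?thesis using r(2) by (auto simp: dist_norm subset_iff)
      qed
      have "f (flow t y) = f q" for t
        using f_along_segment[OF c(1) seg, of t] x y c by simp
      then show "y \<in> S" by (simp add: S_def)
    qed
    ultimately show "\<exists>T. open T \<and> x \<in> T \<and> T \<subseteq> S" by blast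
  qed
  moreover have "q \<in> S" using orbit by (simp add: S_def)
  ultimately have "S = UNIV"
    using connectedD[OF conn, of S "- S"] by (auto simp: open_Compl)
  then have "f (flow 0 x) = f q" unfolding S_def by blast
  then show ?thesis by simp
qed

end

section \<open>Conformal fields annihilated by their associated tensor\<close>

lemma (in smooth_atlas) smooth_function_continuous:
  assumes "smooth_function_on A UNIV h"
  shows "continuous_on UNIV h"
proof (rule continuous_at_imp_continuous_on, rule ballI)
  fix p
  obtain c where c: "c \<in> A" "p \<in> chart_dom c" by (rule chart_around)
  have "isCont (h \<circ> chart_inv c) (chart_map c p)"
    by (rule has_derivative_continuous[OF smooth_function_has_derivative[OF assms c(1) UNIV_I c(2)]])
  moreover have "isCont (chart_map c) p"
    using continuous_on_eq_continuous_at[OF open_chart_dom[OF c(1)]] continuous_chart_map[OF c(1)] c(2) by blast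
  ultimately have cont: "isCont (\<lambda>q. (h \<circ> chart_inv c) (chart_map c q)) p"
    using isCont_o2[where f="chart_map c" and g="h \<circ> chart_inv c"] by blast
  have "eventually (\<lambda>q. (h \<circ> chart_inv c) (chart_map c q) = h q) (nhds p)"
    using eventually_nhds_in_open[OF open_chart_dom[OF c(1)] c(2)]
    by eventually_elim (use c in simp)
  from isCont_cong[OF this] cont show "isCont h p" by simp
qed

locale compact_conformal_field = conformal_field A g V \<psi> \<Phi>
  for A :: "('a::{t2_space,second_countable_topology}, 'e::euclidean_space) chart set"
    and g V \<psi> \<Phi> +
  assumes compact: "compact (UNIV :: 'a set)"

sublocale compact_conformal_field \<subseteq> compact_flow A V
  by unfold_locales (rule V_field compact)+

context compact_conformal_field
begin

definition beta :: "('a, 'e) chart \<Rightarrow> 'e \<Rightarrow> 'a \<Rightarrow> real" where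
  "beta c v p = eta c v p / sq_norm p"

lemma eta_has_derivative:
  assumes "c \<in> A" "p \<in> chart_dom c"
  shows "(eta c v \<circ> chart_inv c has_derivative coord_deriv c (eta c v) p)
    (at (chart_map c p))"
  by (rule smooth_function_has_derivative[OF smooth_eta[OF assms(1)] assms(1,2,2)])

lemma sq_norm_has_derivative:
  assumes "c \<in> A" "p \<in> chart_dom c"
  shows "(sq_norm \<circ> chart_inv c has_derivative (\<lambda>v. 2 * \<psi> p * eta c v p)) (at (chart_map c p))"
  using smooth_function_has_derivative[OF smooth_sq_norm assms(1) UNIV_I assms(2)]
  by (simp add: derivative_sq_norm[OF assms, abs_def])

lemma beta_has_derivative:
  assumes "c \<in> A" "p \<in> chart_dom c" "sq_norm p > 0"
  shows "(beta c v \<circ> chart_inv c has_derivative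
    (\<lambda>u. coord_deriv c (eta c v) p u / sq_norm p
       - 2 * \<psi> p * eta c u p * eta c v p / (sq_norm p * sq_norm p))) (at (chart_map c p))"
proof -
  have "((\<lambda>x. (eta c v \<circ> chart_inv c) x / (sq_norm \<circ> chart_inv c) x) has_derivative
    (\<lambda>u. (coord_deriv c (eta c v) p u * (sq_norm \<circ> chart_inv c) (chart_map c p)
       - (eta c v \<circ> chart_inv c) (chart_map c p) * (2 * \<psi> p * eta c u p)) /
       ((sq_norm \<circ> chart_inv c) (chart_map c p) * (sq_norm \<circ> chart_inv c) (chart_map c p)))) (at (chart_map c p))"
    by (rule has_derivative_divide'[OF eta_has_derivative[OF assms(1,2)] sq_norm_has_derivative[OF assms(1,2)]])
       (use assms in simp)
  moreover have "(beta c v \<circ> chart_inv c) = (\<lambda>x. (eta c v \<circ> chart_inv c) x / (sq_norm \<circ> chart_inv c) x)"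
    by (simp add: beta_def fun_eq_iff)
  ultimately show ?thesis
    using assms by (simp add: diff_divide_distrib mult_ac)
qed

lemma beta_derivative:
  assumes "c \<in> A" "p \<in> chart_dom c" "sq_norm p > 0"
  shows "coord_deriv c (beta c v) p u =
    coord_deriv c (eta c v) p u / sq_norm p
       - 2 * \<psi> p * eta c u p * eta c v p / (sq_norm p * sq_norm p)"
  using fun_cong[OF frechet_derivative_at[OF beta_has_derivative[OF assms]], of v u] by simp

text \<open>At a zero of \<open>V\<close> the constant curve is an integral curve, so no other orbit can reach it.\<close>

lemma zeros_are_fixed:
  assumes "sq_norm (flow t x) = 0"
  shows "flow t x = x"
proof -
  have "V (flow t x) = tangent_zero" using assms sq_norm_eq_0_iff by blast
  then have "integral_at (\<lambda>_. flow t x) s" for s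
    unfolding integral_at_def by (simp add: tangent_zero_def)
  from flow_unique[OF this, of "- \<bar>t\<bar> - 1" t "\<bar>t\<bar> + 1" x 0]
  show ?thesis by simp
qed

sublocale flow_invariant_form A V "{p. sq_norm p > 0}" beta sq_norm "\<lambda>p. 2 * \<psi> p * sq_norm p"
proof (intro flow_invariant_form.intro compact_flow_axioms flow_invariant_form_axioms.intro)
  have cont_sq: "continuous_on UNIV sq_norm" by (rule smooth_function_continuous[OF smooth_sq_norm])
  show "open {p. sq_norm p > 0}" using cont_sq by (intro open_Collect_less) auto
  show "flow t x \<in> {p. sq_norm p > 0}" if "x \<in> {p. sq_norm p > 0}" for x t
    using zeros_are_fixed[of t x] that sq_norm_nonneg[of "flow t x"] by fastforce
  have "smooth_function_on A UNIV \<psi>" using conformal by (simp add: conformal_with_factor_def)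
  from smooth_function_continuous[OF this] cont_sq
  show "continuous_on {p. sq_norm p > 0} (\<lambda>p. 2 * \<psi> p * sq_norm p)"
    by (intro continuous_intros) (auto intro: continuous_on_subset)
  fix c p assume c: "c \<in> A" "p \<in> chart_dom c" and "p \<in> {p. sq_norm p > 0}"
  then have pos: "sq_norm p > 0" by simp
  show "linear (\<lambda>v. beta c v p)"
    using linear_add[OF linear_eta[OF c]] linear_cmul[OF linear_eta[OF c]]
    by (intro linearI) (simp_all add: beta_def add_divide_distrib)
  show "beta c (V p c) p = 1" using pos by (simp add: beta_def eta_V[OF c])
  show "(sq_norm \<circ> chart_inv c has_derivative (\<lambda>v. 2 * \<psi> p * sq_norm p * beta c v p)) (at (chart_map c p))"
    using sq_norm_has_derivative[OF c] pos by (simp add: beta_def mult.assoc)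
  fix v
  show "(beta c v \<circ> chart_inv c has_derivative coord_deriv c (beta c v) p)
      (at (chart_map c p))"
    by (subst frechet_derivative_at[OF beta_has_derivative[OF c pos], symmetric]) (rule beta_has_derivative[OF c pos])
  have "coord_deriv c (eta c v) p (V p c) = 2 * \<psi> p * eta c v p - eta c (field_deriv c V p v) p"
    using lie_derivative_eta[OF c, of v] by linarith
  then show "coord_deriv c (beta c v) p (V p c) + beta c (field_deriv c V p v) p = 0"
    using pos by (simp add: beta_derivative[OF c pos] eta_V[OF c]) (simp add: beta_def diff_divide_distrib)
next
  fix c d p v
  assume "c \<in> A" "d \<in> A" "p \<in> chart_dom c" "p \<in> chart_dom d"
  then show "beta d (jacobian c d p v) p = beta c v p" by (simp add: beta_def eta_change)
qed

text \<open>If \<open>V\<close> vanished at all nearby points where \<open>d\<eta> \<noteq> 0\<close>, then \<open>\<eta>\<close> and with it \<open>d\<eta>\<close> would vanish on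
  an open set.\<close>

lemma curvature_at_regular_point:
  assumes c: "c \<in> A" "p \<in> chart_dom c"
    and curv: "coord_deriv c (eta c w) p u \<noteq>
      coord_deriv c (eta c u) p w"
  obtains q where "q \<in> chart_dom c" "sq_norm q > 0"
    "coord_deriv c (eta c w) q u \<noteq>
      coord_deriv c (eta c u) q w"
proof -
  let ?R = "chart_map c ` chart_dom c"
  define \<kappa> where "\<kappa> = (\<lambda>x. frechet_derivative (eta c w \<circ> chart_inv c) (at x) u
    - frechet_derivative (eta c u \<circ> chart_inv c) (at x) w)"
  have sm: "smooth_on ?R (eta c v \<circ> chart_inv c)" for v
    using smooth_eta[OF c(1), of v] c(1) unfolding smooth_function_on_def by fastforce
  have "continuous_on ?R \<kappa>" unfolding \<kappa>_def
    by (intro continuous_on_diff smooth_on_continuous[OF smooth_on_derivative] sm)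
  then have "open (?R \<inter> \<kappa> -` (- {0}))"
    by (intro continuous_open_preimage open_chart_range[OF c(1)]) auto
  moreover have "chart_map c p \<in> ?R \<inter> \<kappa> -` (- {0})" using c curv by (simp add: \<kappa>_def)
  moreover define Z where "Z = ?R \<inter> \<kappa> -` (- {0})"
  ultimately have Z: "open Z" "chart_map c p \<in> Z" by auto
  have "\<exists>q\<in>chart_dom c. chart_map c q \<in> Z \<and> sq_norm q > 0"
  proof (rule ccontr)
    assume contr: "\<not> (\<exists>q\<in>chart_dom c. chart_map c q \<in> Z \<and> sq_norm q > 0)"
    have zero: "(eta c v \<circ> chart_inv c) x = 0" if x: "x \<in> Z" for x v
    proof -
      obtain q where q: "q \<in> chart_dom c" "x = chart_map c q" using x by (auto simp: Z_def)
      then have "sq_norm q = 0" using contr x sq_norm_nonneg[of q] by fastforce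
      then have "V q = tangent_zero" by (simp add: sq_norm_eq_0_iff)
      then show ?thesis
        using q c(1) metric_zero_left[OF V_tangent coord_field_tangent[OF c(1) q(1)]] by (simp add: eta_def)
    qed
    have "(eta c v \<circ> chart_inv c has_derivative (\<lambda>_. 0)) (at (chart_map c p))" for v
      by (rule has_derivative_transform_within_open[OF has_derivative_const Z]) (use zero in simp)
    from frechet_derivative_at[OF this, symmetric] have "\<kappa> (chart_map c p) = 0" by (simp add: \<kappa>_def)
    then show False using Z(2) by (simp add: Z_def)
  qed
  then show ?thesis using that by (auto simp: Z_def \<kappa>_def)
qed

text \<open>Where \<open>|V|\<^sup>2 > 0\<close>, the differentials of \<open>\<beta>\<close> and \<open>\<eta>\<close> agree up to the factor \<open>1 / |V|\<^sup>2\<close>, since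
  \<open>d|V|\<^sup>2\<close> is proportional to \<open>\<eta>\<close>. So \<open>|V|\<^sup>2\<close> is constant on an orbit, then everywhere, and
  \<open>0 = d|V|\<^sup>2(V) = 2 \<psi> |V|\<^sup>2\<close>.\<close>

lemma conformal_factor_zero_if_not_closed:
  assumes conn: "connected (UNIV :: 'a set)"
    and v: "v \<in> tangent_space A p" and nz: "\<Phi> p v \<noteq> tangent_zero"
  shows "\<psi> x = 0"
proof -
  obtain c where c: "c \<in> A" "p \<in> chart_dom c" by (rule chart_around)
  let ?w = "\<Phi> p v"
  have w: "?w \<in> tangent_space A p"
    using associated v unfolding associated_tensor_def tensor_field_1_1_def by blast
  have "2 * g p ?w ?w = coord_deriv c (eta c (?w c)) p (v c)
    - coord_deriv c (eta c (v c)) p (?w c)"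
    using metric_associated_tensor[OF c, of "v c" "?w c"] by (simp add: tangent_eq_coord_field[OF c] v w)
  with metric_pos[OF w nz]
  have "coord_deriv c (eta c (?w c)) p (v c) \<noteq>
      coord_deriv c (eta c (v c)) p (?w c)" by auto
  then obtain q where q: "q \<in> chart_dom c" "sq_norm q > 0"
    "coord_deriv c (eta c (?w c)) q (v c) \<noteq>
      coord_deriv c (eta c (v c)) q (?w c)"
    by (rule curvature_at_regular_point[OF c])
  have orbit: "sq_norm (flow t q) = sq_norm q" for t
  proof (rule f_constant_on_orbit[OF c(1) q(1), of "?w c" "v c"])
    show "coord_deriv c (beta c (?w c)) q (v c) \<noteq>
      coord_deriv c (beta c (v c)) q (?w c)"
      using q by (simp add: beta_derivative[OF c(1) q(1,2)] mult_ac)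
  qed (use q in simp)
  have const: "sq_norm y = sq_norm q" for y
    by (rule f_globally_constant[OF conn smooth_function_continuous[OF smooth_sq_norm] _ orbit]) (use q in simp)
  obtain d where d: "d \<in> A" "x \<in> chart_dom d" by (rule chart_around)
  have "(sq_norm \<circ> chart_inv d) = (\<lambda>_. sq_norm q)" using const by (simp add: fun_eq_iff)
  then have "0 = 2 * \<psi> x * sq_norm x"
    using derivative_sq_norm[OF d, of "V x d"] eta_V[OF d] by simp
  then show ?thesis using const[of x] q(2) by simp
qed

end

theorem proposition1p2:
  fixes A :: "('a::{t2_space,second_countable_topology}, 'e::euclidean_space) chart set"
    and g :: "('a, 'e) metric"
    and V :: "'a \<Rightarrow> ('a, 'e) tangent"
    and \<Phi> :: "'a \<Rightarrow> ('a, 'e) tangent \<Rightarrow> ('a, 'e) tangent"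
  assumes "riemannian_manifold A g"
    and "compact (UNIV :: 'a set)"
    and "connected (UNIV :: 'a set)"
    and "conformal_vector_field A g V"
    and "\<not> killing_vector_field A g V"
    and "associated_tensor A g V \<Phi>"
    and "\<forall>p. \<Phi> p (V p) = tangent_zero"
  shows "(\<forall>p. \<forall>v\<in>tangent_space A p. \<Phi> p v = tangent_zero) \<and> closed_vector_field A g V"
proof -
  obtain \<psi> where \<psi>: "conformal_with_factor A g V \<psi>"
    using assms(4) unfolding conformal_vector_field_def by blast
  interpret compact_conformal_field A g V \<psi> \<Phi>
    by unfold_locales (use assms \<psi> in \<open>auto simp: riemannian_manifold_def\<close>)
  have not_killing: "\<exists>x. \<psi> x \<noteq> 0"
  proof (rule ccontr)
    assume "\<not> (\<exists>x. \<psi> x \<noteq> 0)"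
    then have "killing_vector_field A g V"
      using \<psi> unfolding killing_vector_field_def conformal_with_factor_def by auto
    with assms(5) show False by blast
  qed
  have \<Phi>_zero: "\<Phi> p v = tangent_zero" if "v \<in> tangent_space A p" for p v
    using conformal_factor_zero_if_not_closed[OF assms(3) that] not_killing by blast
  moreover have "closed_vector_field A g V"
    unfolding closed_vector_field_def
  proof (intro allI impI ballI)
    fix U X Y p
    assume XY: "vector_field_on A U X" "vector_field_on A U Y" and p: "p \<in> U"
    have "X p \<in> tangent_space A p" "Y p \<in> tangent_space A p"
      using XY p unfolding vector_field_on_def by blast+
    then have "g p (\<Phi> p (X p)) (Y p) = 0" using \<Phi>_zero metric_zero_left by simp
    moreover have "g p (\<Phi> p (X p)) (Y p) = 1 / 2 * exterior_derivative A (dual_form g V) X Y p"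
      using assms(6) XY p unfolding associated_tensor_def by blast
    ultimately show "exterior_derivative A (dual_form g V) X Y p = 0" by simp
  qed
  ultimately show ?thesis by blast
qed

end
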